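(* The following two assertions are equivalent. (i) For all $x,y,z,n\in\mathbb{N}$ with $n\ge 3$, $$\lim_{\tau\to\infty}\frac{1}{\tau}\left\{\int_{\frac{x^n+y^n}{z^n}\frac{\tau}{1-c}}^{\frac{x^n+y^n}{z^n}\frac{\tau}{1-c}+1}\ln\Gamma(t)\,dt-\int_{\varphi_1\left(\frac{x^n+y^n}{z^n}\frac{\tau}{1-c}\right)}^{\varphi_1\left(\frac{x^n+y^n}{z^n}\frac{\tau}{1-c}\right)+1}\ln\Gamma(t)\,dt\right\}\neq 1.$$ (ii) (Fermat-Wiles theorem) There are no $x,y,z,n\in\mathbb{N}$ with $n\ge3$ and $x^n+y^n=z^n$.
   Context: $\mathbb{N}$ is the set of positive integers, $\zeta$ is the Riemann zeta-function, $\Gamma$ is Euler's Gamma function, and $c$ is Euler's constant ($1-c\approx 0.42$). Jacob's ladder: $\varphi_1(T)=\frac12\varphi(T)$, where $x(T)=\varphi(T)$ (defined for all sufficiently large $T$, tending to infinity with $T$) is an arbitrary solution of the nonlinear integral equation $$\int_0^{\mu[x(T)]}\left|\zeta\left(\tfrac12+it\right)\right|^2e^{-\frac{2}{x(T)}t}\,dt=\int_0^T\left|\zeta\left(\tfrac12+it\right)\right|^2dt,$$ and $\mu$ is any admissible function, i.e. a smooth, increasing, unbounded function (for large arguments) with $\mu(y)\ge 7y\ln y$; each admissible $\mu$ generates a solution $\varphi(T)=\varphi(T;\mu)$. *)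

theory Defs
  imports "HOL-Complex_Analysis.Complex_Analysis"
begin

text \<open>The Riemann zeta-function: the unique holomorphic continuation of the Dirichlet series
  to the punctured plane. The value at the pole carries no meaning; it is fixed to 0 only
  to make the function unique.\<close>

definition is_zeta :: "(complex \<Rightarrow> complex) \<Rightarrow> bool" where
  "is_zeta f \<longleftrightarrow> f holomorphic_on - {1}
     \<and> (\<forall>s. Re s > 1 \<longrightarrow> (\<lambda>n. 1 / of_nat (Suc n) powr s) sums f s)
     \<and> f 1 = 0"

definition zeta :: "complex \<Rightarrow> complex" where
  "zeta = (THE f. is_zeta f)"

text \<open>All conditions concern large arguments only. Smooth means infinitely differentiable;
  increasing is meant weakly, so that strictly increasing functions are included.\<close>

definition admissible :: "(real \<Rightarrow> real) \<Rightarrow> bool" where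
  "admissible \<mu> \<longleftrightarrow> (\<exists>y0>0.
       (\<forall>k. \<forall>y>y0. (deriv ^^ k) \<mu> field_differentiable at y)
     \<and> mono_on {y0<..} \<mu>
     \<and> \<not> bdd_above (\<mu> ` {y0<..})
     \<and> (\<forall>y>y0. \<mu> y \<ge> 7 * y * ln y))"

text \<open>A solution need only be defined near infinity, so the equation is required eventually
  and the values of \<open>\<phi>\<close> elsewhere are irrelevant. No continuity of \<open>\<phi>\<close> is assumed.\<close>

definition ladder_solution :: "(real \<Rightarrow> real) \<Rightarrow> (real \<Rightarrow> real) \<Rightarrow> bool" where
  "ladder_solution \<mu> \<phi> \<longleftrightarrow>
     filterlim \<phi> at_top at_top
   \<and> (\<forall>\<^sub>F T in at_top.
        integral {0..\<mu> (\<phi> T)}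
          (\<lambda>t. (norm (zeta (1/2 + \<i> * of_real t)))\<^sup>2 * exp (- (2 / \<phi> T) * t))
        = integral {0..T} (\<lambda>t. (norm (zeta (1/2 + \<i> * of_real t)))\<^sup>2))"

definition jacobs_ladder :: "(real \<Rightarrow> real) \<Rightarrow> real \<Rightarrow> real" where
  "jacobs_ladder \<phi> T = \<phi> T / 2"

end

theory Submission
  imports Defs "HOL-Real_Asymp.Real_Asymp"
begin

text \<open>
  The heart of the matter is the mean square \<open>\<integral>\<^sub>0\<^sup>T |\<zeta>(1/2 + it)|\<^sup>2 dt = T ln T + A T + o(T)\<close>; the
  value of the constant \<open>A\<close> cancels in the end, so that an elementary argument suffices. On the
  critical line, \<open>\<zeta>(s) / s\<close> is minus the Fourier transform of \<open>p(u) = frac(e\<^sup>u) e\<^sup>-\<^sup>u\<^sup>/\<^sup>2\<close>, hence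
  \<open>|\<zeta>(1/2 + it)|\<^sup>2 / (1/4 + t\<^sup>2)\<close> is the Fourier transform of the autocorrelation of \<open>p\<close>. Counting the
  integers between \<open>y\<close> and \<open>e\<^sup>v y\<close> shows that this autocorrelation is
  \<open>c - v (ln (1/v) + C) / 2 + O(v\<^sup>3\<^sup>/\<^sup>2)\<close> for small \<open>v > 0\<close>. A combination of the exponential
  integral \<open>E\<^sub>2(|v|)\<close> with \<open>e\<^sup>-\<^sup>|\<^sup>v\<^sup>|\<close> and \<open>e\<^sup>-\<^sup>2\<^sup>|\<^sup>v\<^sup>|\<close> has the same expansion and an explicit Fourier
  transform. Testing the difference of the two transforms against \<open>1/4 + t\<^sup>2\<close> times a smooth cut-off
  at \<open>T\<close> yields the mean square.

  By Abel summation the integral of \<open>|\<zeta>|\<^sup>2 e\<^sup>-\<^sup>t\<^sup>/\<^sup>y\<close> is \<open>y ln y + (1 - \<gamma> + A) y + o(y)\<close>, and truncating it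
  at \<open>\<mu>(2 y) \<ge> 14 y ln (2 y)\<close> is harmless. With \<open>y = \<phi>\<^sub>1(T)\<close> the integral equation becomes
  \<open>T ln T + A T + o(T) = y ln y + (1 - \<gamma> + A) y + o(y)\<close>. Therefore \<open>y \<sim> T\<close> and
  \<open>(T ln T - T) - (y ln y - y) = (1 - \<gamma>) T + o(T)\<close>, which by Raabe's formula is the difference of the
  two integrals of \<open>ln \<Gamma>\<close>. The limit in (i) is thus \<open>(x\<^sup>n + y\<^sup>n) / z\<^sup>n\<close>.
\<close>

section \<open>Analytic continuation of the zeta function\<close>

text \<open>The zeta-function is given by a definite description, so nothing can be said about it
  before a continuation to the whole punctured plane has been constructed. The mean square is wanted
  up to o(T), and of the remainder E(v) of the autocorrelation only the size is known. A sharp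
  cut-off at T has a transform decaying like T^2/v, which would bound the contribution of E only by
  order T^2. Smoothing the cut-off over a length D improves this: E(v) = O(v^a) with 1 < a < 2
  contributes T^2 D^(-a). With a = 3/2 this is o(T) once D is well above T^(2/3), while D = o(T / ln
  T) leaves the main term intact; D = T^(9/10) meets both demands. Passing back to the sharp
  integral costs nothing more, because the square of the modulus of zeta is nonnegative and
  monotonicity in T brackets it. No regularity of \<phi> is available. The comparison of y with T
  rests on the integral equation alone and on both quantities tending to infinity.\<close>

definition cell_integral :: "(real \<Rightarrow> real) \<Rightarrow> complex \<Rightarrow> nat \<Rightarrow> complex" where
  "cell_integral b s n =
     integral {0..1} (\<lambda>u. complex_of_real (b u) * complex_of_real (real n + 1 + u) powr (-s))"

lemma cell_integrand_integrable:
  assumes "continuous_on {0..1} b"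
  shows "(\<lambda>u. complex_of_real (b u) * complex_of_real (real n + 1 + u) powr (-s)) integrable_on {0..1}"
  by (intro integrable_continuous_real continuous_intros assms)
     (auto simp: complex_nonpos_Reals_iff simp del: of_real_add)

lemma norm_cell_integral_le:
  assumes "continuous_on {0..1} b" "\<And>u. u \<in> {0..1} \<Longrightarrow> \<bar>b u\<bar> \<le> B" "Re s \<ge> 0"
  shows "norm (cell_integral b s n) \<le> B * (real n + 1) powr (- Re s)"
proof -
  have B: "B \<ge> 0" using assms(2)[of 0] by auto
  have "norm (cell_integral b s n) \<le> (B * (real n + 1) powr (- Re s)) * measure lborel (cbox 0 (1::real))"
    unfolding cell_integral_def box_real[symmetric]
  proof (rule integrable_bound)
    show "0 \<le> B * (real n + 1) powr (- Re s)" using B by simp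
    show "(\<lambda>u. complex_of_real (b u) * complex_of_real (real n + 1 + u) powr (-s)) integrable_on cbox 0 1"
      using cell_integrand_integrable[OF assms(1)] by simp
    fix u :: real assume u: "u \<in> cbox 0 1"
    have "norm (complex_of_real (b u) * complex_of_real (real n + 1 + u) powr (-s))
          = \<bar>b u\<bar> * (real n + 1 + u) powr (- Re s)"
      using u by (simp add: norm_mult norm_powr_real_powr del: of_real_add)
    also have "\<dots> \<le> B * (real n + 1) powr (- Re s)"
      using u assms B by (intro mult_mono powr_mono2') auto
    finally show "norm (complex_of_real (b u) * complex_of_real (real n + 1 + u) powr (-s))
                    \<le> B * (real n + 1) powr (- Re s)" .
  qed
  then show ?thesis by simp
qed

lemma cell_integral_holomorphic:
  assumes "continuous_on {0..1} b"
  shows "(\<lambda>s. cell_integral b s n) holomorphic_on UNIV"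
proof -
  have pos: "complex_of_real (real n + 1 + u) \<notin> \<real>\<^sub>\<le>\<^sub>0" if "u \<in> {0..1}" for u
    using that by (auto simp: complex_nonpos_Reals_iff simp del: of_real_add)
  have ne: "complex_of_real (real n + 1 + u) \<noteq> 0" if "u \<in> {0..1}" for u
    using pos[OF that] by auto
  show ?thesis
    unfolding cell_integral_def box_real[symmetric]
  proof (rule leibniz_rule_holomorphic)
    fix s :: complex and u :: real assume "u \<in> cbox 0 1"
    then show "((\<lambda>s. complex_of_real (b u) * complex_of_real (real n + 1 + u) powr (-s))
       has_field_derivative
       - complex_of_real (b u) * Ln (complex_of_real (real n + 1 + u)) *
         complex_of_real (real n + 1 + u) powr (-s)) (at s within UNIV)"
    proof -
      define w where "w = complex_of_real (real n + 1 + u)"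
      have w: "w \<noteq> 0" using \<open>u \<in> cbox 0 1\<close> ne[of u] by (simp add: w_def)
      have "((\<lambda>s. w powr (-s)) has_field_derivative Ln w * w powr (-s) * (-1)) (at s)"
        by (rule DERIV_chain2[OF has_field_derivative_powr_right[OF w] DERIV_minus[OF DERIV_ident]])
      from DERIV_cmult[OF this, of "complex_of_real (b u)"] show ?thesis
        by (simp add: w_def mult.assoc del: of_real_add)
    qed
  next
    have c: "continuous_on (UNIV \<times> cbox 0 1) (\<lambda>x::complex \<times> real. b (snd x))"
      by (rule continuous_on_compose2[OF assms]) (auto intro!: continuous_intros)
    show "continuous_on (UNIV \<times> cbox 0 1) (\<lambda>(s, u). - complex_of_real (b u) *
          Ln (complex_of_real (real n + 1 + u)) * complex_of_real (real n + 1 + u) powr (-s))"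
      unfolding case_prod_unfold
      by (intro continuous_intros c) (use pos in \<open>auto simp del: of_real_add\<close>)
  qed (use cell_integrand_integrable[OF assms] in auto)
qed

lemma summable_shifted_powr:
  assumes "a > 1"
  shows "summable (\<lambda>n. (real n + 1) powr (-a))"
proof -
  have "summable (\<lambda>n. real n powr (-a))" using assms by (subst summable_real_powr_iff) auto
  then have "summable (\<lambda>n. real (Suc n) powr (-a))" by (subst summable_Suc_iff)
  then show ?thesis by (simp add: add.commute)
qed

text \<open>Summed over n, the cell integrals make up the integral of
  \<open>b (frac x) * x powr (-s)\<close> over [1, oo). On each cell x >= n + 1 gives the summable
  majorant.\<close>

lemma summable_cell_integral:
  assumes "continuous_on {0..1} b" "Re s > 1"
  shows "summable (\<lambda>n. cell_integral b s n)"
proof -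
  have "bounded (b ` {0..1})" using assms compact_continuous_image compact_imp_bounded by blast
  then obtain B where B: "\<And>u. u \<in> {0..1} \<Longrightarrow> \<bar>b u\<bar> \<le> B"
    unfolding bounded_iff real_norm_def by blast
  show ?thesis
  proof (rule summable_comparison_test')
    show "summable (\<lambda>n. B * (real n + 1) powr (- Re s))"
      using assms by (intro summable_mult summable_shifted_powr)
    show "norm (cell_integral b s n) \<le> B * (real n + 1) powr (- Re s)" if "n \<ge> 0" for n
      using assms B by (intro norm_cell_integral_le) auto
  qed
qed

lemma suminf_cell_integral_holomorphic:
  assumes b: "continuous_on {0..1} b"
  shows "(\<lambda>s. \<Sum>n. cell_integral b s n) holomorphic_on {s. Re s > 1}"
proof -
  have "bounded (b ` {0..1})" using b compact_continuous_image compact_imp_bounded by blast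
  then obtain B where B: "\<And>u. u \<in> {0..1} \<Longrightarrow> \<bar>b u\<bar> \<le> B"
    unfolding bounded_iff real_norm_def by blast
  show ?thesis
  proof (rule holomorphic_uniform_sequence)
    show "open {s. Re s > 1}" by (simp add: open_halfspace_Re_gt)
    show "(\<lambda>s. \<Sum>n<N. cell_integral b s n) holomorphic_on {s. Re s > 1}" for N
      by (intro holomorphic_intros holomorphic_on_subset[OF cell_integral_holomorphic[OF b]]) auto
    fix s :: complex assume s: "s \<in> {s. Re s > 1}"
    define d where "d = (Re s - 1) / 2"
    have d: "d > 0" using s by (simp add: d_def)
    have re: "Re z \<ge> 1 + d" if "z \<in> cball s d" for z
    proof -
      have "Re s - Re z \<le> norm (s - z)" using complex_Re_le_cmod[of "s - z"] by simp
      also have "\<dots> \<le> d" using that by (simp add: dist_norm)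
      finally show ?thesis by (simp add: d_def field_simps)
    qed
    have "uniform_limit (cball s d) (\<lambda>N z. \<Sum>n<N. cell_integral b z n) (\<lambda>z. \<Sum>n. cell_integral b z n) sequentially"
    proof (rule Weierstrass_m_test)
      show "summable (\<lambda>n. B * (real n + 1) powr (- (1 + d)))"
        using d by (intro summable_mult summable_shifted_powr) auto
      fix n z assume z: "z \<in> cball s d"
      have B0: "B \<ge> 0" using B[of 0] by auto
      have "norm (cell_integral b z n) \<le> B * (real n + 1) powr (- Re z)"
        using b B re[OF z] d by (intro norm_cell_integral_le) auto
      also have "\<dots> \<le> B * (real n + 1) powr (- (1 + d))"
        using B0 re[OF z] by (intro mult_left_mono powr_mono) auto
      finally show "norm (cell_integral b z n) \<le> B * (real n + 1) powr (- (1 + d))" .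
    qed
    moreover have "cball s d \<subseteq> {s. Re s > 1}" using re d by force
    ultimately show "\<exists>d>0. cball s d \<subseteq> {s. 1 < Re s} \<and>
        uniform_limit (cball s d) (\<lambda>N z. \<Sum>n<N. cell_integral b z n) (\<lambda>z. \<Sum>n. cell_integral b z n) sequentially"
      using d by blast
  qed
qed

lemma shifted_powr_tendsto_0:
  assumes "Re s > 0"
  shows "(\<lambda>n. complex_of_real (real n + 1) powr (-s)) \<longlonglongrightarrow> 0"
proof (rule tendsto_norm_zero_cancel)
  have "norm (complex_of_real (real n + 1) powr (-s)) = (real n + 1) powr (- Re s)" for n
    by (subst norm_powr_real_powr) (auto)
  moreover have "(\<lambda>n. (real n + 1) powr (- Re s)) \<longlonglongrightarrow> 0"
    using assms by real_asymp
  ultimately show "(\<lambda>n. norm (complex_of_real (real n + 1) powr (-s))) \<longlonglongrightarrow> 0" by simp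
qed

text \<open>Because \<open>b\<close> has mean zero, its primitive takes the same value at both ends
  of the cell, so the boundary terms carry the single factor \<open>c 0\<close> and telescope when
  summed over n. Subtracting the mean makes \<open>c\<close> mean-zero again, so the step can be
  iterated. Starting from \<open>u - 1/2\<close> this produces the Bernoulli polynomials up to
  factors.\<close>

lemma cell_integral_by_parts:
  assumes b: "continuous_on {0..1} b" "integral {0..1} b = 0"
  defines "c \<equiv> (\<lambda>x. integral {0..x} b - integral {0..1} (\<lambda>x. integral {0..x} b))"
  shows "continuous_on {0..1} c" "integral {0..1} c = 0"
    and "cell_integral b s n = complex_of_real (c 0) * (complex_of_real (real (Suc n) + 1) powr (-s)
            - complex_of_real (real n + 1) powr (-s)) + s * cell_integral c (s + 1) n"
proof -
  have int: "b integrable_on {0..1}" using b by (intro integrable_continuous_real)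
  have cont: "continuous_on {0..1} (\<lambda>x. integral {0..x} b)"
    using int by (rule indefinite_integral_continuous_1)
  then show c: "continuous_on {0..1} c"
    unfolding c_def by (intro continuous_intros)
  show "integral {0..1} c = 0"
    unfolding c_def using cont by (subst integral_diff) (auto intro!: integrable_continuous_real)
  have c01: "c 1 = c 0" using b by (simp add: c_def)
  have der: "(c has_vector_derivative b u) (at u within {0..1})" if "u \<in> {0..1}" for u
    unfolding c_def using has_vector_derivative_diff_const[of "\<lambda>x. integral {0..x} b"] integral_has_vector_derivative[OF b(1) that]
    by auto
  have ne: "complex_of_real (real n + 1 + u) \<notin> \<real>\<^sub>\<le>\<^sub>0" if "u \<in> {0..1}" for u
    using that by (auto simp: complex_nonpos_Reals_iff simp del: of_real_add)
  have "((\<lambda>u. complex_of_real (b u) * complex_of_real (real n + 1 + u) powr (-s)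
           - s * (complex_of_real (c u) * complex_of_real (real n + 1 + u) powr (-(s+1))))
         has_integral complex_of_real (c 1) * complex_of_real (real n + 1 + 1) powr (-s)
            - complex_of_real (c 0) * complex_of_real (real n + 1 + 0) powr (-s)) {0..1}"
  proof (rule fundamental_theorem_of_calculus)
    fix u :: real assume u: "u \<in> {0..1}"
    have e: "- (s + 1) = - s - 1" by simp
    have 1: "((\<lambda>u. complex_of_real (c u)) has_vector_derivative complex_of_real (b u)) (at u within {0..1})"
      using der[OF u] unfolding has_real_derivative_iff_has_vector_derivative[symmetric]
      by (rule has_vector_derivative_of_real)
    have 2: "((\<lambda>u. complex_of_real (real n + 1 + u) powr (-s)) has_vector_derivative
           (- s * complex_of_real (real n + 1 + u) powr (-s-1))) (at u within {0..1})"
    proof -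
      have "((\<lambda>z. (of_nat n + 1 + z) powr (-s)) has_field_derivative
           (-s * (of_nat n + 1 + complex_of_real u) powr (-s-1))) (at (complex_of_real u))"
        using ne[OF u] by (auto intro!: derivative_eq_intros)
      from has_vector_derivative_real_field[OF this] show ?thesis by simp
    qed
    show "((\<lambda>u. complex_of_real (c u) * complex_of_real (real n + 1 + u) powr (-s)) has_vector_derivative
        complex_of_real (b u) * complex_of_real (real n + 1 + u) powr (-s)
           - s * (complex_of_real (c u) * complex_of_real (real n + 1 + u) powr (-(s+1)))) (at u within {0..1})"
      using has_vector_derivative_mult[OF 1 2] unfolding e by (simp add: algebra_simps)
  qed auto
  moreover have "((\<lambda>u. complex_of_real (b u) * complex_of_real (real n + 1 + u) powr (-s)
           - s * (complex_of_real (c u) * complex_of_real (real n + 1 + u) powr (-(s+1))))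
         has_integral cell_integral b s n - s * cell_integral c (s+1) n) {0..1}"
    unfolding cell_integral_def
    by (intro has_integral_diff has_integral_mult_right integrable_integral cell_integrand_integrable b c)
  ultimately have "cell_integral b s n - s * cell_integral c (s+1) n =
      complex_of_real (c 1) * complex_of_real (real n + 1 + 1) powr (-s)
            - complex_of_real (c 0) * complex_of_real (real n + 1 + 0) powr (-s)"
    by (rule has_integral_unique[rotated])
  then show "cell_integral b s n = complex_of_real (c 0) * (complex_of_real (real (Suc n) + 1) powr (-s)
            - complex_of_real (real n + 1) powr (-s)) + s * cell_integral c (s + 1) n"
    by (simp add: c01 algebra_simps)
qed

text \<open>Integrating by parts against the mean-zero primitive of \<open>b\<close> gains one unit of convergence.\<close>

lemma suminf_cell_integral_extends_halfplane:
  assumes "continuous_on {0..1} b" "integral {0..1} b = 0"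
  shows "\<exists>F. F holomorphic_on {s. Re s > 1 - real k} \<and>
             (\<forall>s. Re s > 1 \<longrightarrow> F s = (\<Sum>n. cell_integral b s n))"
  using assms
proof (induction k arbitrary: b)
  case 0
  then show ?case using suminf_cell_integral_holomorphic[OF 0(1)] by auto
next
  case (Suc k)
  define c where "c = (\<lambda>x. integral {0..x} b - integral {0..1} (\<lambda>x. integral {0..x} b))"
  have parts: "continuous_on {0..1} c" "integral {0..1} c = 0"
    "cell_integral b s n = complex_of_real (c 0) * (complex_of_real (real (Suc n) + 1) powr (-s)
            - complex_of_real (real n + 1) powr (-s)) + s * cell_integral c (s + 1) n" for s n
    unfolding c_def by (rule cell_integral_by_parts[OF Suc.prems])+
  obtain G where G: "G holomorphic_on {s. Re s > 1 - real k}"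
    "\<And>s. Re s > 1 \<Longrightarrow> G s = (\<Sum>n. cell_integral c s n)"
    using Suc.IH[OF parts(1,2)] by blast
  \<comment> \<open>The boundary terms telescope to -1, which explains \<open>- c 0\<close>.
    Evaluating \<open>G\<close> at s + 1 is what moves the half-plane one unit to the left.\<close>
  show ?case
  proof (intro exI[of _ "\<lambda>s. - complex_of_real (c 0) + s * G (s + 1)"] conjI allI impI)
    have "(G \<circ> (\<lambda>s. s + 1)) holomorphic_on {s. Re s > 1 - real (Suc k)}"
      by (rule holomorphic_on_compose_gen[OF _ G(1)]) (auto intro!: holomorphic_intros)
    then show "(\<lambda>s. - complex_of_real (c 0) + s * G (s + 1)) holomorphic_on {s. Re s > 1 - real (Suc k)}"
      by (auto intro!: holomorphic_intros simp: o_def)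
    fix s :: complex assume s: "Re s > 1"
    have "(\<lambda>n. complex_of_real (real (Suc n) + 1) powr (-s) - complex_of_real (real n + 1) powr (-s))
            sums (0 - complex_of_real (real 0 + 1) powr (-s))"
      by (rule telescope_sums) (use s in \<open>auto intro!: shifted_powr_tendsto_0 simp del: of_real_add\<close>)
    then have 1: "(\<lambda>n. complex_of_real (real (Suc n) + 1) powr (-s) - complex_of_real (real n + 1) powr (-s))
            sums (-1)" by simp
    have 2: "(\<lambda>n. cell_integral c (s+1) n) sums G (s + 1)"
      using s parts(1) by (subst G(2)) (auto intro!: summable_sums summable_cell_integral)
    have "(\<lambda>n. cell_integral b s n) sums (complex_of_real (c 0) * (-1) + s * G (s + 1))"
      unfolding parts(3) using sums_add[OF sums_mult[OF 1, of "complex_of_real (c 0)"] sums_mult[OF 2, of s]] by simp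
    then show "- complex_of_real (c 0) + s * G (s + 1) = (\<Sum>n. cell_integral b s n)"
      by (simp add: sums_iff)
  qed
qed

text \<open>The continuations to Re s > 1 - k agree on overlaps by the identity theorem, hence they
  glue: at each point every sufficiently large k gives the same value.\<close>

lemma suminf_cell_integral_extends_entire:
  assumes "continuous_on {0..1} b" "integral {0..1} b = 0"
  obtains F where "F holomorphic_on UNIV" "\<And>s. Re s > 1 \<Longrightarrow> F s = (\<Sum>n. cell_integral b s n)"
proof -
  have "\<forall>k. \<exists>F. F holomorphic_on {s. Re s > 1 - real k} \<and>
             (\<forall>s. Re s > 1 \<longrightarrow> F s = (\<Sum>n. cell_integral b s n))"
    using suminf_cell_integral_extends_halfplane[OF assms] by blast
  from choice[OF this] obtain G where "\<forall>k. G k holomorphic_on {s. Re s > 1 - real k} \<and>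
             (\<forall>s. Re s > 1 \<longrightarrow> G k s = (\<Sum>n. cell_integral b s n))" by blast
  then have G: "\<And>k. G k holomorphic_on {s. Re s > 1 - real k}"
     "\<And>k s. Re s > 1 \<Longrightarrow> G k s = (\<Sum>n. cell_integral b s n)" by blast+
  have agree: "G j s = G k s" if "j \<le> k" "Re s > 1 - real j" for j k s
  proof (rule analytic_continuation_open[of "{s. Re s > 1}" "{s. Re s > 1 - real j}" "G j" "G k"])
    show "{s. Re s > 1} \<noteq> {}" proof -
      have "2 \<in> {s. Re s > 1}" by simp
      then show ?thesis by blast
    qed
    show "G k holomorphic_on {s. Re s > 1 - real j}"
      by (rule holomorphic_on_subset[OF G(1)]) (use that in auto)
    show "open {s. Re s > 1}" "open {s. Re s > 1 - real j}" by (rule open_halfspace_Re_gt)+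
    show "connected {s. Re s > 1 - real j}" by (intro convex_connected convex_halfspace_Re_gt)
    show "{s. Re s > 1} \<subseteq> {s. Re s > 1 - real j}" by auto
    show "G j holomorphic_on {s. Re s > 1 - real j}" by (rule G(1))
    show "s \<in> {s. Re s > 1 - real j}" using that by simp
    show "G j z = G k z" if "z \<in> {s. Re s > 1}" for z using that by (simp add: G(2))
  qed
  \<comment> \<open>The ceiling alone would allow equality; the extra 1 makes Re s > 1 -
    \<open>K s\<close> strict.\<close>
  define K where "K s = nat \<lceil>1 - Re s\<rceil> + 1" for s
  have K: "Re s > 1 - real (K s)" for s
  proof -
    have "1 - Re s \<le> real_of_int \<lceil>1 - Re s\<rceil>" by (rule le_of_int_ceiling)
    also have "\<dots> \<le> real (nat \<lceil>1 - Re s\<rceil>)" by simp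
    finally show ?thesis by (simp add: K_def)
  qed
  define F where "F s = G (K s) s" for s
  have FG: "F s = G k s" if "Re s > 1 - real k" for s k
  proof (cases "k \<le> K s")
    case True
    then show ?thesis unfolding F_def using agree[OF True that, symmetric] by (simp only:)
  next
    case False
    then have "K s \<le> k" by simp
    then show ?thesis unfolding F_def using K[of s] by (rule agree)
  qed
  show ?thesis
  proof
    have "F holomorphic_on {s. Re s > 1 - real k}" for k
    proof -
      have "F s = G k s" if "s \<in> {s. Re s > 1 - real k}" for s using that FG[of k s] by simp
      then have "F holomorphic_on {s. Re s > 1 - real k} \<longleftrightarrow> G k holomorphic_on {s. Re s > 1 - real k}"
        by (rule holomorphic_cong[OF refl])
      then show ?thesis using G(1)[of k] by (rule iffD2)
    qed
    then have "F holomorphic_on (\<Union>k\<in>UNIV. {s. Re s > 1 - real k})"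
      by (intro holomorphic_on_UN_open open_halfspace_Re_gt)
    moreover have "s \<in> (\<Union>k\<in>UNIV. {s. Re s > 1 - real k})" for s
      using K[of s] by blast
    then have "(\<Union>k\<in>UNIV. {s. Re s > 1 - real k}) = (UNIV :: complex set)" by blast
    ultimately show "F holomorphic_on UNIV" by simp
    show "F s = (\<Sum>n. cell_integral b s n)" if "Re s > 1" for s
    proof -
      have "F s = G 0 s" by (rule FG) (use that in simp)
      then show ?thesis using G(2)[OF that, of 0] by simp
    qed
  qed
qed

text \<open>First-order Euler-Maclaurin summation on one cell: integration by parts isolates the
  Dirichlet term and leaves a difference that telescopes in n.\<close>

lemma cell_integral_sawtooth:
  assumes "s \<noteq> 1"
  shows "- s * cell_integral (\<lambda>u. u - 1/2) (s + 1) n =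
     complex_of_real (real n + 1) powr (-s)
     + ((complex_of_real (real (Suc n) + 1) powr (-s) / 2 + complex_of_real (real (Suc n) + 1) powr (1-s) / (s - 1))
      - (complex_of_real (real n + 1) powr (-s) / 2 + complex_of_real (real n + 1) powr (1-s) / (s - 1)))"
proof -
  have ne: "complex_of_real (real n + 1 + u) \<notin> \<real>\<^sub>\<le>\<^sub>0" if "u \<in> {0..1}" for u
    using that by (auto simp: complex_nonpos_Reals_iff simp del: of_real_add)
  have "((\<lambda>u. - s * (complex_of_real (u - 1/2) * complex_of_real (real n + 1 + u) powr (-(s+1))))
         has_integral ((complex_of_real 1 - 1/2) * (of_nat n + 1 + complex_of_real 1) powr (-s)
             + (of_nat n + 1 + complex_of_real 1) powr (1-s) / (s - 1))
            - ((complex_of_real 0 - 1/2) * (of_nat n + 1 + complex_of_real 0) powr (-s)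
             + (of_nat n + 1 + complex_of_real 0) powr (1-s) / (s - 1))) {0..1}"
  proof (rule fundamental_theorem_of_calculus)
    fix u :: real assume u: "u \<in> {0..1}"
    have "((\<lambda>z. (z - 1/2) * (of_nat n + 1 + z) powr (-s) + (of_nat n + 1 + z) powr (1-s) / (s - 1)) has_field_derivative
           (- s * (complex_of_real (u - 1/2) * complex_of_real (real n + 1 + u) powr (-(s+1))))) (at (complex_of_real u))"
    proof -
      define w where "w = of_nat n + 1 + complex_of_real u"
      have w: "w \<notin> \<real>\<^sub>\<le>\<^sub>0" "w \<noteq> 0" using ne[OF u] by (auto simp: w_def)
      have "((\<lambda>z. (z - 1/2) * (of_nat n + 1 + z) powr (-s) + (of_nat n + 1 + z) powr (1-s) / (s - 1)) has_field_derivative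
          w powr (-s) + (complex_of_real u - 1/2) * (- s * w powr (-s - 1)) + (1 - s) * w powr (1 - s - 1) / (s - 1)) (at (complex_of_real u))"
        using w assms unfolding w_def
        by (auto intro!: derivative_eq_intros simp del: of_real_add)
      also have "(1 - s) * w powr (1 - s - 1) / (s - 1) = - (w powr (-s))"
        using assms by (simp add: field_simps)
      also have "w powr (-s) + (complex_of_real u - 1/2) * (- s * w powr (-s - 1)) + - (w powr (-s))
          = - s * (complex_of_real (u - 1/2) * w powr (-(s+1)))"
      proof -
        have e: "- (s + 1) = - s - 1" by simp
        have "P + (c - 1/2) * (- s * X) + - P = - s * ((c - 1/2) * X)" for P c X :: complex
          by (simp add: algebra_simps)
        then show ?thesis unfolding e by simp
      qed
      finally show ?thesis by (simp add: w_def)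
    qed
    from has_vector_derivative_real_field[OF this]
    show "((\<lambda>u. (complex_of_real u - 1/2) * (of_nat n + 1 + complex_of_real u) powr (-s)
             + (of_nat n + 1 + complex_of_real u) powr (1-s) / (s - 1)) has_vector_derivative
        - s * (complex_of_real (u - 1/2) * complex_of_real (real n + 1 + u) powr (-(s+1)))) (at u within {0..1})"
      by simp
  qed auto
  moreover have "((\<lambda>u. - s * (complex_of_real (u - 1/2) * complex_of_real (real n + 1 + u) powr (-(s+1))))
         has_integral - s * cell_integral (\<lambda>u. u - 1/2) (s + 1) n) {0..1}"
    unfolding cell_integral_def
    by (intro has_integral_mult_right integrable_integral cell_integrand_integrable continuous_intros) auto
  ultimately have "- s * cell_integral (\<lambda>u. u - 1/2) (s + 1) n = ((complex_of_real 1 - 1/2) * (of_nat n + 1 + complex_of_real 1) powr (-s)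
             + (of_nat n + 1 + complex_of_real 1) powr (1-s) / (s - 1))
            - ((complex_of_real 0 - 1/2) * (of_nat n + 1 + complex_of_real 0) powr (-s)
             + (of_nat n + 1 + complex_of_real 0) powr (1-s) / (s - 1))"
    by (rule has_integral_unique[rotated])
  then show ?thesis by (simp add: algebra_simps)
qed

lemma is_zeta_unique:
  assumes "is_zeta f" "is_zeta g"
  shows "f = g"
proof
  fix s show "f s = g s"
  proof (cases "s = 1")
    case True then show ?thesis using assms by (simp add: is_zeta_def)
  next
    case False
    show ?thesis
    proof (rule analytic_continuation_open[of "{s. Re s > 1}" "- {1}" f g])
      show "{s. Re s > 1} \<noteq> {}" proof -
      have "2 \<in> {s. Re s > 1}" by simp
      then show ?thesis by blast
    qed
      show "connected (- {1::complex})" by (intro connected_punctured_universe) auto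
      show "f s = g s" if "s \<in> {s. Re s > 1}" for s
        using assms that unfolding is_zeta_def by (blast intro: sums_unique2)
        show "f holomorphic_on - {1}" "g holomorphic_on - {1}"
        using assms by (simp_all add: is_zeta_def)
      show "open {s. Re s > 1}" by (rule open_halfspace_Re_gt)
      show "{s. Re s > 1} \<subseteq> - {1}" by auto
    qed (use False in auto)
  qed
qed

text \<open>\<open>THE\<close> yields something usable only after existence and uniqueness, so the
  witness must be holomorphic on the whole punctured plane. The sawtooth formula is bundled in
  because it is read off this witness, which is local to the proof.\<close>

lemma is_zeta_zeta_and_eq_sawtooth:
  "is_zeta zeta \<and> (\<forall>s. Re s > 0 \<and> s \<noteq> 1 \<longrightarrow>
     zeta s = 1 / (s - 1) + 1/2 - s * (\<Sum>n. cell_integral (\<lambda>u. u - 1/2) (s + 1) n))"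
proof -
  have b: "continuous_on {0..1} (\<lambda>u::real. u - 1/2)" by (intro continuous_intros)
  have "((\<lambda>u::real. u - 1/2) has_integral ((1\<^sup>2 / 2 - 1/2) - (0\<^sup>2 / 2 - 0/2))) {0..1}"
    by (rule fundamental_theorem_of_calculus)
       (auto intro!: derivative_eq_intros simp: has_real_derivative_iff_has_vector_derivative[symmetric])
  then have i0: "integral {0..1} (\<lambda>u::real. u - 1/2) = 0" by (simp add: integral_unique)
  obtain G where G: "G holomorphic_on UNIV" "\<And>s. Re s > 1 \<Longrightarrow> G s = (\<Sum>n. cell_integral (\<lambda>u. u - 1/2) s n)"
    using suminf_cell_integral_extends_entire[OF b i0] by blast
  define f where "f s = (if s = 1 then 0 else 1 / (s - 1) + 1/2 - s * G (s + 1))" for s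
  have "is_zeta f"
    unfolding is_zeta_def
  proof (intro conjI allI impI)
    have "(G \<circ> (\<lambda>s. s + 1)) holomorphic_on - {1}"
      by (rule holomorphic_on_compose_gen[OF _ G(1)]) (auto intro!: holomorphic_intros)
    then have "(\<lambda>s. 1 / (s - 1) + 1/2 - s * G (s + 1)) holomorphic_on - {1}"
      by (auto intro!: holomorphic_intros simp: o_def)
    then show "f holomorphic_on - {1}"
      by (rule holomorphic_transform) (simp add: f_def)
    show "f 1 = 0" by (simp add: f_def)
    fix s :: complex assume s: "Re s > 1"
    \<comment> \<open>The telescoping part of the Euler-Maclaurin identity. It tends to 0 for Re s >
      1, and its initial value supplies 1/2 + 1/(s - 1).\<close>
    define Z where "Z n = complex_of_real (real n + 1) powr (-s) / 2 + complex_of_real (real n + 1) powr (1-s) / (s - 1)" for n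
    have s1: "s \<noteq> 1" using s by auto
    have "Z \<longlonglongrightarrow> 0 / 2 + 0 / (s - 1)"
      unfolding Z_def using s s1 shifted_powr_tendsto_0[of "s-1"]
      by (intro tendsto_intros shifted_powr_tendsto_0) auto
    then have "(\<lambda>n. Z (Suc n) - Z n) sums (0 - Z 0)" by (intro telescope_sums) auto
    then have 1: "(\<lambda>n. Z (Suc n) - Z n) sums (- 1/2 - 1 / (s - 1))" by (simp add: Z_def)
    have 2: "(\<lambda>n. - s * cell_integral (\<lambda>u. u - 1/2) (s+1) n) sums (- s * G (s + 1))"
      using s b by (subst G(2)) (auto intro!: sums_minus sums_mult summable_sums summable_cell_integral)
    have "(\<lambda>n. - s * cell_integral (\<lambda>u. u - 1/2) (s+1) n - (Z (Suc n) - Z n))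
            sums (- s * G (s + 1) - (- 1/2 - 1 / (s - 1)))"
      by (intro sums_diff 1 2)
    moreover have "(\<lambda>n. - s * cell_integral (\<lambda>u. u - 1/2) (s+1) n - (Z (Suc n) - Z n))
        = (\<lambda>n. 1 / of_nat (Suc n) powr s)"
    proof
      fix n
      have "complex_of_real (real n + 1) powr (-s) = 1 / of_nat (Suc n) powr s"
        unfolding powr_minus by (simp add: inverse_eq_divide add.commute)
      then show "- s * cell_integral (\<lambda>u. u - 1/2) (s+1) n - (Z (Suc n) - Z n) = 1 / of_nat (Suc n) powr s"
        unfolding cell_integral_sawtooth[OF s1] Z_def by (simp only: add_diff_cancel_right')
    qed
    moreover have "- s * G (s + 1) - (- 1/2 - 1 / (s - 1)) = f s" using s1 by (simp add: f_def)
    ultimately show "(\<lambda>n. 1 / of_nat (Suc n) powr s) sums f s" by (simp only:)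
  qed
  then have zf: "zeta = f"
    unfolding zeta_def by (intro the_equality[of is_zeta f]) (assumption, erule is_zeta_unique)
  have "zeta s = 1 / (s - 1) + 1/2 - s * (\<Sum>n. cell_integral (\<lambda>u. u - 1/2) (s + 1) n)"
    if "Re s > 0" "s \<noteq> 1" for s
  proof -
    have "G (s + 1) = (\<Sum>n. cell_integral (\<lambda>u. u - 1/2) (s + 1) n)" by (rule G(2)) (use that in simp)
    then show ?thesis using that(2) unfolding zf f_def by (simp only: if_False)
  qed
  then show ?thesis using \<open>is_zeta f\<close> zf by blast
qed

lemmas is_zeta_zeta = conjunct1[OF is_zeta_zeta_and_eq_sawtooth]

lemma zeta_eq_sawtooth:
  assumes "Re s > 0" "s \<noteq> 1"
  shows "zeta s = 1 / (s - 1) + 1/2 - s * (\<Sum>n. cell_integral (\<lambda>u. u - 1/2) (s + 1) n)"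
  using is_zeta_zeta_and_eq_sawtooth assms by blast

section \<open>Correlation of dilated sawtooth functions\<close>

lemma borel_measurable_frac [measurable]: "(frac :: real \<Rightarrow> real) \<in> borel_measurable borel"
  unfolding frac_def[abs_def] by measurable

lemma borel_measurable_dominated_absolutely_integrable:
  fixes f :: "real \<Rightarrow> 'a::euclidean_space" and g :: "real \<Rightarrow> real"
  assumes "f \<in> borel_measurable borel" "g integrable_on S" "\<And>x. x \<in> S \<Longrightarrow> norm (f x) \<le> g x" "S \<in> sets borel"
  shows "f absolutely_integrable_on S"
proof (rule measurable_bounded_by_integrable_imp_absolutely_integrable)
  show "f \<in> borel_measurable (lebesgue_on S)"
    using assms(1) by (simp add: measurable_completion measurable_restrict_space1)
qed (use assms in auto)

lemma borel_measurable_dominated_integrable: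
  fixes f g :: "real \<Rightarrow> real"
  assumes "f \<in> borel_measurable borel" "g integrable_on S" "\<And>x. x \<in> S \<Longrightarrow> \<bar>f x\<bar> \<le> g x" "S \<in> sets borel"
  shows "f integrable_on S"
  using borel_measurable_dominated_absolutely_integrable[of f g S] assms
  by (simp add: set_lebesgue_integral_eq_integral(1))

lemma integral_halfline_split:
  fixes f :: "real \<Rightarrow> real"
  assumes "a \<le> b" "f integrable_on {a..b}" "f integrable_on {b..}"
  shows "f integrable_on {a..}" "integral {a..} f = integral {a..b} f + integral {b..} f"
proof -
  have "{a..b} \<inter> {b..} = {b}" "{a..b} \<union> {b..} = {a..}" using assms by auto
  then show "f integrable_on {a..}" "integral {a..} f = integral {a..b} f + integral {b..} f"
    using integrable_Un[of "{a..b}" "{b..}" f] integral_Un[OF assms(2,3)] assms by auto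
qed

lemma integral_atLeast_tendsto:
  fixes f :: "real \<Rightarrow> 'a::euclidean_space"
  assumes f: "f absolutely_integrable_on {a..}"
  shows "((\<lambda>x. integral {a..x} f) \<longlongrightarrow> integral {a..} f) at_top"
proof -
  have "((\<lambda>x. set_lebesgue_integral lebesgue {a..x} f) \<longlongrightarrow> set_lebesgue_integral lebesgue {a..} f) at_top"
    by (intro tendsto_set_lebesgue_integral_at_top f) auto
  moreover have "set_lebesgue_integral lebesgue {a..x} f = integral {a..x} f" for x
    using set_integrable_subset[OF f, of "{a..x}"] by (intro set_lebesgue_integral_eq_integral) auto
  moreover have "set_lebesgue_integral lebesgue {a..} f = integral {a..} f"
    using f by (rule set_lebesgue_integral_eq_integral)
  ultimately show ?thesis by simp
qed

lemma integral_atLeast_scaled: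
  fixes F :: "real \<Rightarrow> real"
  assumes "F absolutely_integrable_on {c * a..}" "c > 0"
  shows "(\<lambda>x. c * F (c * x)) absolutely_integrable_on {a..}"
    "integral {a..} (\<lambda>x. c * F (c * x)) = integral {c * a..} F"
proof -
  have im: "(\<lambda>x. c * x) ` {a..} = {c * a..}"
  proof (intro equalityI subsetI)
    fix x assume "x \<in> {c * a..}"
    then have "x = c * (x / c)" "x / c \<in> {a..}" using assms(2) by (auto simp: pos_le_divide_eq mult.commute)
    then show "x \<in> (\<lambda>x. c * x) ` {a..}" by blast
  qed (use assms in auto)
  have der: "((\<lambda>x. c * x) has_real_derivative c) (at x within {a..})" for x
    by (auto intro!: derivative_eq_intros)
  show "(\<lambda>x. c * F (c * x)) absolutely_integrable_on {a..}"
    "integral {a..} (\<lambda>x. c * F (c * x)) = integral {c * a..} F"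
    using has_absolute_integral_change_of_variables_1'[of "{a..}" "\<lambda>x. c * x" "\<lambda>_. c" F "integral {c * a..} F"]
      der assms im by (auto simp: inj_on_def)
qed

lemma inverse_power_integrable_on:
  assumes "n \<ge> 2" "c > 0"
  shows "(\<lambda>a::real. 1 / a ^ n) absolutely_integrable_on {c..}" "(\<lambda>a::real. 1 / a ^ n) integrable_on {c..}"
proof -
  have "(\<lambda>x. x powr (- real n)) integrable_on {c..}"
    using has_integral_powr_to_inf[of "- real n" c] assms by (auto simp: integrable_on_def)
  then show "(\<lambda>a::real. 1 / a ^ n) integrable_on {c..}"
    by (rule integrable_eq) (use assms in \<open>auto simp: powr_minus powr_realpow inverse_eq_divide\<close>)
  then show "(\<lambda>a::real. 1 / a ^ n) absolutely_integrable_on {c..}"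
    using assms by (intro nonnegative_absolutely_integrable_1) auto
qed

section \<open>Integrals of the shifted sawtooth over a unit cell\<close>

lemma has_integral_frac_shift_unit:
  fixes h :: "real \<Rightarrow> real \<Rightarrow> real" and a :: int and x r :: real
  defines "r \<equiv> frac x"
  assumes 1: "((\<lambda>y. h y (y - a + r)) has_integral I) {real_of_int a..a + 1 - r}"
    and 2: "((\<lambda>y. h y (y - a + r - 1)) has_integral J) {a + 1 - r..real_of_int a + 1}"
  shows "((\<lambda>y. h y (frac (y + x))) has_integral (I + J)) {real_of_int a..real_of_int a + 1}"
\<comment> \<open>Inside the cell \<open>frac (y + x)\<close> jumps only at y = a + 1 - r and is
  affine on either side. At the jump the left formula would give 1 instead of 0, so that point is
  spiked out.\<close>
proof (rule has_integral_combine)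
  have r: "0 \<le> r" "r < 1" by (simp_all add: r_def frac_lt_1)
  show "real_of_int a \<le> a + 1 - r" "a + 1 - r \<le> real_of_int a + 1" using r by auto
  have x: "x = of_int \<lfloor>x\<rfloor> + r" by (simp add: r_def frac_def)
  show "((\<lambda>y. h y (frac (y + x))) has_integral I) {real_of_int a..a + 1 - r}"
  proof (rule has_integral_spike_finite[OF _ _ 1])
    fix y assume y: "y \<in> {real_of_int a..a + 1 - r} - {a + 1 - r}"
    have "frac (y + x) = y - a + r"
    proof (subst frac_unique_iff, intro conjI)
      have "y + x - (y - a + r) = of_int (\<lfloor>x\<rfloor> + a)" using x by simp
      then show "y + x - (y - a + r) \<in> \<int>" by (metis Ints_of_int)
    qed (use y r in auto)
    then show "h y (frac (y + x)) = h y (y - a + r)" by simp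
  qed auto
  show "((\<lambda>y. h y (frac (y + x))) has_integral J) {a + 1 - r..real_of_int a + 1}"
  proof (rule has_integral_spike_finite[OF _ _ 2])
    fix y assume y: "y \<in> {a + 1 - r..real_of_int a + 1} - {real_of_int a + 1}"
    have "frac (y + x) = y - a + r - 1"
    proof (subst frac_unique_iff, intro conjI)
      have "y + x - (y - a + r - 1) = of_int (\<lfloor>x\<rfloor> + a + 1)" using x by simp
      then show "y + x - (y - a + r - 1) \<in> \<int>" by (metis Ints_of_int)
    qed (use y r in auto)
    then show "h y (frac (y + x)) = h y (y - a + r - 1)" by simp
  qed auto
qed

text \<open>The variance of a Bernoulli variable: \<open>frac (y + x) - frac y\<close> equals r on a
  set of measure 1 - r and r - 1 on a set of measure r, where r = \<open>frac x\<close> and y runs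
  through a unit cell.\<close>

definition frac_var :: "real \<Rightarrow> real" where
  "frac_var x = frac x * (1 - frac x)"

lemma frac_var_nonneg: "frac_var x \<ge> 0"
  unfolding frac_var_def using frac_lt_1[of x] by (intro mult_nonneg_nonneg) auto

lemma frac_var_le_1: "frac_var x \<le> 1"
  unfolding frac_var_def using frac_lt_1[of x] by (intro mult_le_one) auto

lemma frac_var_le_self: "x \<ge> 0 \<Longrightarrow> frac_var x \<le> x"
proof -
  assume "x \<ge> 0"
  have "frac_var x \<le> frac x * 1"
    unfolding frac_var_def using frac_lt_1[of x] by (intro mult_left_mono) auto
  also have "\<dots> \<le> x" using \<open>x \<ge> 0\<close> by (simp add: frac_def)
  finally show ?thesis .
qed

lemma borel_measurable_frac_var [measurable]: "frac_var \<in> borel_measurable borel"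
  unfolding frac_var_def[abs_def] by measurable

lemma has_integral_frac_shift_unit_square:
  fixes a :: int
  shows "((\<lambda>y. (frac (y + x) - (y - a))\<^sup>2) has_integral frac_var x) {real_of_int a..real_of_int a + 1}"
proof -
  define r where "r = frac x"
  have r: "0 \<le> r" "r < 1" by (simp_all add: r_def frac_lt_1)
  have 1: "((\<lambda>y. (y - a + r - (y - a))\<^sup>2) has_integral (1 - r) * r\<^sup>2) {real_of_int a..a + 1 - r}"
    using has_integral_const_real[of "r\<^sup>2" "real_of_int a" "a + 1 - r"] r by simp
  have 2: "((\<lambda>y. (y - a + r - 1 - (y - a))\<^sup>2) has_integral r * (r - 1)\<^sup>2) {a + 1 - r..real_of_int a + 1}"
    using has_integral_const_real[of "(r - 1)\<^sup>2" "a + 1 - r" "real_of_int a + 1"] r by simp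
  have "((\<lambda>y. (frac (y + x) - (y - a))\<^sup>2) has_integral (1 - r) * r\<^sup>2 + r * (r - 1)\<^sup>2) {real_of_int a..real_of_int a + 1}"
    by (rule has_integral_frac_shift_unit[where h = "\<lambda>y z. (z - (y - a))\<^sup>2" and a = a and x = x, folded r_def, OF 1 2])
  moreover have "(1 - r) * r\<^sup>2 + r * (r - 1)\<^sup>2 = frac_var x"
    by (simp add: frac_var_def r_def[symmetric] power2_eq_square algebra_simps)
  ultimately show ?thesis by (simp only:)
qed

lemma has_integral_frac_shift_unit_deviation:
  fixes a :: int
  shows "((\<lambda>y. frac (y + x) - (y - a)) has_integral 0) {real_of_int a..real_of_int a + 1}"
proof -
  define r where "r = frac x"
  have r: "0 \<le> r" "r < 1" by (simp_all add: r_def frac_lt_1)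
  have 1: "((\<lambda>y. (y - a + r - (y - a))) has_integral (1 - r) * r) {real_of_int a..a + 1 - r}"
    using has_integral_const_real[of "r" "real_of_int a" "a + 1 - r"] r by simp
  have 2: "((\<lambda>y. (y - a + r - 1 - (y - a))) has_integral r * (r - 1)) {a + 1 - r..real_of_int a + 1}"
    using has_integral_const_real[of "(r - 1)" "a + 1 - r" "real_of_int a + 1"] r by simp
  have "((\<lambda>y. (frac (y + x) - (y - a))) has_integral (1 - r) * r + r * (r - 1)) {real_of_int a..real_of_int a + 1}"
    by (rule has_integral_frac_shift_unit[where h = "\<lambda>y z. (z - (y - a))" and a = a and x = x, folded r_def, OF 1 2])
  moreover have "(1 - r) * r + r * (r - 1) = 0" by (simp add: algebra_simps)
  ultimately show ?thesis by (simp only:)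
qed

text \<open>The integrand counts the integers crossed when the argument moves by d. Its integral is
  only d, so the places where a small change of the shift makes \<open>frac\<close> jump are
  harmless on average.\<close>

lemma has_integral_floor_increment_unit:
  fixes a :: int
  shows "((\<lambda>y. real_of_int \<lfloor>y + x + d\<rfloor> - real_of_int \<lfloor>y + x\<rfloor>) has_integral d) {real_of_int a..real_of_int a + 1}"
proof -
  have "((\<lambda>y. d - (frac (y + (x + d)) - (y - a)) + (frac (y + x) - (y - a))) has_integral
           d * (real_of_int a + 1 - a) - 0 + 0) {real_of_int a..real_of_int a + 1}"
    using has_integral_const_real[of d "real_of_int a" "real_of_int a + 1"]
    by (intro has_integral_add has_integral_diff has_integral_frac_shift_unit_deviation) simp_all
  moreover have "(\<lambda>y. d - (frac (y + (x + d)) - (y - a)) + (frac (y + x) - (y - a)))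
     = (\<lambda>y. real_of_int \<lfloor>y + x + d\<rfloor> - real_of_int \<lfloor>y + x\<rfloor>)"
    by (auto simp: frac_def add.assoc)
  ultimately show ?thesis by simp
qed

lemma abs_frac_diff_le:
  fixes a b :: real
  assumes "a \<le> b"
  shows "\<bar>frac b - frac a\<bar> \<le> (b - a) + (real_of_int \<lfloor>b\<rfloor> - real_of_int \<lfloor>a\<rfloor>)"
  using floor_mono[OF assms] assms unfolding frac_def by linarith

lemma mult_one_minus_lipschitz:
  assumes "0 \<le> a" "a \<le> 1" "0 \<le> b" "b \<le> (1::real)"
  shows "\<bar>a * (1 - a) - b * (1 - b)\<bar> \<le> \<bar>a - b\<bar>"
proof -
  have "a * (1 - a) - b * (1 - b) = (a - b) * (1 - (a + b))" by (simp add: algebra_simps)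
  also have "\<bar>\<dots>\<bar> \<le> \<bar>a - b\<bar> * 1" unfolding abs_mult using assms by (intro mult_left_mono) auto
  finally show ?thesis by simp
qed

text \<open>At an integer \<open>frac\<close> jumps but r (1 - r) does not, having equal values at 0
  and 1. When one integer lies between the arguments, the reflection of r to 1 - r reduces the claim
  to the case without a jump.\<close>

lemma frac_var_lipschitz: "\<bar>frac_var x - frac_var y\<bar> \<le> \<bar>x - y\<bar>"
proof -
  have main: "\<bar>frac_var x - frac_var y\<bar> \<le> y - x" if "x \<le> y" for x y
  proof (cases "y - x \<ge> 1")
    case True
    then show ?thesis using frac_var_nonneg[of x] frac_var_nonneg[of y] frac_var_le_1[of x] frac_var_le_1[of y]
      by linarith
  next
    case False
    then have "\<lfloor>y\<rfloor> = \<lfloor>x\<rfloor> \<or> \<lfloor>y\<rfloor> = \<lfloor>x\<rfloor> + 1" using that by linarith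
    then show ?thesis
    proof
      assume "\<lfloor>y\<rfloor> = \<lfloor>x\<rfloor>"
      then have "frac y - frac x = y - x" by (simp add: frac_def)
      then show ?thesis using mult_one_minus_lipschitz[of "frac x" "frac y"] frac_lt_1[of x] frac_lt_1[of y] that
        unfolding frac_var_def by simp
    next
      assume *: "\<lfloor>y\<rfloor> = \<lfloor>x\<rfloor> + 1"
      then have **: "frac y + (1 - frac x) = y - x" by (simp add: frac_def)
      have "\<bar>frac_var x - frac_var y\<bar> \<le> \<bar>(1 - frac x) - frac y\<bar>"
        using mult_one_minus_lipschitz[of "1 - frac x" "frac y"] frac_lt_1[of x] frac_lt_1[of y]
        unfolding frac_var_def by (simp add: mult.commute)
      also have "\<dots> \<le> y - x" using ** frac_lt_1[of x] frac_lt_1[of y] frac_ge_0[of x] frac_ge_0[of y] by linarith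
      finally show ?thesis .
    qed
  qed
  show ?thesis using main[of x y] main[of y x] by (cases "x \<le> y") auto
qed

section \<open>Mean square difference of a sawtooth and its dilate\<close>

definition saw_gap :: "real \<Rightarrow> real \<Rightarrow> real" where
  "saw_gap d y = (frac ((1 + d) * y) - frac y)\<^sup>2 / y\<^sup>2"

lemma borel_measurable_saw_gap [measurable]: "saw_gap d \<in> borel_measurable borel"
  unfolding saw_gap_def[abs_def] by measurable

lemma saw_gap_nonneg: "saw_gap d y \<ge> 0" by (simp add: saw_gap_def)

lemma frac_diff_square_le_1: "(frac x - frac y)\<^sup>2 \<le> (1::real)"
proof -
  have "\<bar>frac x - frac y\<bar> \<le> 1" using frac_lt_1[of x] frac_lt_1[of y] frac_ge_0[of x] frac_ge_0[of y] by linarith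
  then show ?thesis by (simp add: abs_square_le_1)
qed

lemma saw_gap_le_inverse_square: "saw_gap d y \<le> 1 / y\<^sup>2"
  unfolding saw_gap_def using frac_diff_square_le_1 by (intro divide_right_mono) auto

text \<open>Up to y = 1/(1 + d) both fractional parts are the identity, so the difference is d y and
  the quotient at most d^2. From there on 1/y^2 is at most (1 + d)^2. Hence the division by y^2
  creates no singularity at 0.\<close>

lemma saw_gap_bounded:
  assumes "d > 0" "y \<ge> 0"
  shows "saw_gap d y \<le> d\<^sup>2 + (1 + d)\<^sup>2"
proof (cases "(1 + d) * y < 1")
  case True
  have "y \<le> (1 + d) * y" using assms by (simp add: algebra_simps)
  then have "frac y = y" "frac ((1 + d) * y) = (1 + d) * y" using True assms by (auto simp: frac_eq)
  then have e: "frac ((1 + d) * y) - frac y = d * y" by (simp add: algebra_simps)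
  have "saw_gap d y \<le> d\<^sup>2"
    unfolding saw_gap_def e by (cases "y = 0") (simp_all add: power_mult_distrib)
  then show ?thesis by (rule order_trans) simp
next
  case False
  have y: "y > 0" using False assms by (cases "y = 0") auto
  have "saw_gap d y \<le> (1 / y)\<^sup>2" using saw_gap_le_inverse_square[of d y] by (simp add: power_divide)
  also have "1 / y \<le> 1 + d" using False y by (simp add: pos_divide_le_eq)
  then have "(1 / y)\<^sup>2 \<le> (1 + d)\<^sup>2" using y by (intro power_mono) auto
  finally show ?thesis by (rule order_trans) simp
qed

lemma saw_gap_integrable_compact:
  assumes "d > 0" "a \<ge> 0"
  shows "saw_gap d integrable_on {a..b}"
  by (rule borel_measurable_dominated_integrable[of _ "\<lambda>_. d\<^sup>2 + (1 + d)\<^sup>2"])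
     (use saw_gap_bounded[OF assms(1)] assms saw_gap_nonneg in \<open>auto simp: abs_of_nonneg\<close>)

lemma saw_gap_integrable_halfline:
  assumes "d > 0"
  shows "saw_gap d integrable_on {0..}"
proof (rule integral_halfline_split(1)[of 0 1])
  show "saw_gap d integrable_on {1..}"
    by (rule borel_measurable_dominated_integrable[OF _ inverse_power_integrable_on(2)[of 2]])
       (auto simp: saw_gap_nonneg saw_gap_le_inverse_square)
qed (use assms in \<open>auto intro: saw_gap_integrable_compact\<close>)

lemma frac_var_quotient_integrable_compact:
  assumes "a > 0"
  shows "(\<lambda>y. frac_var (d * y) / y\<^sup>2) integrable_on {a..b}"
proof (rule borel_measurable_dominated_integrable[of _ "\<lambda>_. 1 / a\<^sup>2"])
  fix y assume y: "y \<in> {a..b}"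
  have "frac_var (d * y) / y\<^sup>2 \<le> 1 / a\<^sup>2"
    using y assms frac_var_le_1 by (intro frac_le power_mono) auto
  then show "\<bar>frac_var (d * y) / y\<^sup>2\<bar> \<le> 1 / a\<^sup>2" using frac_var_nonneg by simp
qed auto

text \<open>On a unit cell the shift \<open>d * y\<close> is frozen at its value at the left end point; the two frozen
  functions then have exactly computable integrals.\<close>

lemma saw_gap_cell:
  fixes N :: nat
  assumes "0 < d" "N \<ge> 1"
  shows "\<bar>integral {real N..real N + 1} (\<lambda>y. saw_gap d y - frac_var (d * y) / y\<^sup>2)\<bar> \<le> 9 * d / (real N)\<^sup>2"
proof -
  define n where "n = real N"
  have n: "n \<ge> 1" using assms by (simp add: n_def)
  define v where "v = frac_var (d * n)"
  have v: "0 \<le> v" "v \<le> d * n" using n assms frac_var_nonneg frac_var_le_self[of "d * n"] by (auto simp: v_def)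
  define q where "q y = (frac (y + d * n) - (y - n))\<^sup>2" for y
  define J where "J y = real_of_int \<lfloor>y + d * n + d\<rfloor> - real_of_int \<lfloor>y + d * n\<rfloor>" for y
  have q: "(q has_integral v) {n..n+1}"
    using has_integral_frac_shift_unit_square[where a = "int N" and x = "d * n"] by (simp add: q_def[abs_def] v_def n_def)
  have J: "(J has_integral d) {n..n+1}"
    using has_integral_floor_increment_unit[where a = "int N" and x = "d * n" and d = d] by (simp add: J_def[abs_def] n_def)
  define f where "f y = saw_gap d y - frac_var (d * y) / y\<^sup>2" for y
  \<comment> \<open>The pointwise majorant, term by term: 2 d + 2 J for unfreezing the shift inside
    \<open>frac\<close>, (2/n) q and 2 d for exchanging 1/n^2 and 1/y^2 in front of \<open>q\<close>
    and \<open>v\<close>, and the last d for unfreezing \<open>frac_var\<close>. Its integral is at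
    most 9 d / n^2 because v <= d n.\<close>
  define g where "g y = (2 * d + 2 * J y + (2 / n) * q y + 2 * d + d) / n\<^sup>2" for y
  have fint: "f integrable_on {n..n+1}"
    unfolding f_def using assms n by (intro integrable_diff saw_gap_integrable_compact frac_var_quotient_integrable_compact) auto
  \<comment> \<open>\<open>q\<close> and the constant \<open>v\<close> have the same integral over
    the cell, so subtracting this term leaves the integral of \<open>f\<close> unchanged.\<close>
  have qv: "((\<lambda>y. (q y - v) / n\<^sup>2) has_integral (v - v * (n + 1 - n)) / n\<^sup>2) {n..n+1}"
    using has_integral_const_real[of v n "n+1"]
    by (intro has_integral_divide has_integral_diff q) (simp add: algebra_simps)
  have g: "(g has_integral (2 * d * (n + 1 - n) + 2 * d + (2 / n) * v + 2 * d * (n + 1 - n) + d * (n + 1 - n)) / n\<^sup>2) {n..n+1}"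
    unfolding g_def using has_integral_const_real[of "2 * d" n "n+1"] has_integral_const_real[of d n "n+1"]
    by (intro has_integral_divide has_integral_add has_integral_mult_right q J) (simp_all add: algebra_simps)
  have point: "\<bar>f y - (q y - v) / n\<^sup>2\<bar> \<le> g y" if y: "y \<in> {n..<n+1}" for y
  proof -
    have fy: "frac y = y - n"
      using y by (subst frac_unique_iff) (auto simp: n_def)
    have y0: "y > 0" using y n by auto
    define D where "D = (frac ((1 + d) * y) - frac y)\<^sup>2"
    have sq: "1 / n\<^sup>2 - 1 / y\<^sup>2 \<le> 2 / n ^ 3" "1 / y\<^sup>2 \<le> 1 / n\<^sup>2"
    proof -
      show "1 / y\<^sup>2 \<le> 1 / n\<^sup>2" using y n by (intro divide_left_mono power_mono mult_pos_pos) auto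
      have "(y\<^sup>2 - n\<^sup>2) * n = (y - n) * (y + n) * n" by (simp add: power2_eq_square algebra_simps)
      also have "\<dots> \<le> 1 * (2 * y) * y" using y n by (intro mult_mono) auto
      finally have "(y\<^sup>2 - n\<^sup>2) * n \<le> 2 * y\<^sup>2" by (simp add: power2_eq_square)
      have "1 / n\<^sup>2 - 1 / y\<^sup>2 = (y\<^sup>2 - n\<^sup>2) * n / (n ^ 3 * y\<^sup>2)"
        using n y0 by (simp add: field_simps power2_eq_square power3_eq_cube)
      also have "\<dots> \<le> 2 * y\<^sup>2 / (n ^ 3 * y\<^sup>2)"
        using \<open>(y\<^sup>2 - n\<^sup>2) * n \<le> 2 * y\<^sup>2\<close> n y0 by (intro divide_right_mono) auto
      also have "\<dots> = 2 / n ^ 3" using y0 by simp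
      finally show "1 / n\<^sup>2 - 1 / y\<^sup>2 \<le> 2 / n ^ 3" .
    qed
    have D1: "\<bar>D - q y\<bar> \<le> 2 * (d + J y)"
    proof -
      define a where "a = (1 + d) * y"
      define b where "b = y + d * n"
      have "d * (y - n) \<le> d * 1" "0 \<le> d * (y - n)" using y assms by (auto intro!: mult_left_mono)
      then have ab: "b \<le> a" "a \<le> b + d" unfolding a_def b_def by (auto simp: algebra_simps)
      have "\<bar>frac a - frac b\<bar> \<le> (a - b) + (real_of_int \<lfloor>a\<rfloor> - real_of_int \<lfloor>b\<rfloor>)"
        by (rule abs_frac_diff_le[OF ab(1)])
      also have "\<dots> \<le> d + J y"
        using floor_mono[OF ab(2)] ab unfolding J_def b_def[symmetric] by linarith
      finally have 1: "\<bar>frac a - frac b\<bar> \<le> d + J y" .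
      have "D - q y = (frac a - frac b) * ((frac a - frac y) + (frac b - frac y))"
        unfolding D_def q_def a_def[symmetric] b_def[symmetric] fy[symmetric] by (simp add: power2_eq_square algebra_simps)
      also have "\<bar>\<dots>\<bar> \<le> (d + J y) * 2"
        unfolding abs_mult
      proof (rule mult_mono)
        show "\<bar>frac a - frac y + (frac b - frac y)\<bar> \<le> 2"
          using frac_lt_1[of a] frac_lt_1[of b] frac_lt_1[of y] frac_ge_0[of a] frac_ge_0[of b] frac_ge_0[of y]
          by linarith
      qed (use 1 in auto)
      finally show ?thesis by simp
    qed
    have J0: "J y \<ge> 0" unfolding J_def using assms floor_mono[of "y + d * n" "y + d * n + d"] by simp
    have q0: "q y \<ge> 0" by (simp add: q_def)
    have dec: "f y - (q y - v) / n\<^sup>2 = (D - q y) * (1 / y\<^sup>2) - q y * (1 / n\<^sup>2 - 1 / y\<^sup>2)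
       + v * (1 / n\<^sup>2 - 1 / y\<^sup>2) + (v - frac_var (d * y)) * (1 / y\<^sup>2)"
      unfolding f_def saw_gap_def D_def[symmetric] by (simp add: algebra_simps diff_divide_distrib)
    have b1: "\<bar>(D - q y) * (1 / y\<^sup>2)\<bar> \<le> (2 * (d + J y)) * (1 / n\<^sup>2)"
      unfolding abs_mult using D1 sq assms J0 by (intro mult_mono) auto
    have b2: "\<bar>q y * (1 / n\<^sup>2 - 1 / y\<^sup>2)\<bar> \<le> q y * (2 / n ^ 3)"
      unfolding abs_mult using q0 sq by (intro mult_mono) auto
    have b3: "\<bar>v * (1 / n\<^sup>2 - 1 / y\<^sup>2)\<bar> \<le> (d * n) * (2 / n ^ 3)"
      unfolding abs_mult using v sq assms n by (intro mult_mono) auto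
    have b4: "\<bar>(v - frac_var (d * y)) * (1 / y\<^sup>2)\<bar> \<le> d * (1 / n\<^sup>2)"
    proof -
      have "\<bar>v - frac_var (d * y)\<bar> \<le> \<bar>d * n - d * y\<bar>" unfolding v_def by (rule frac_var_lipschitz)
      also have "\<dots> = d * (y - n)" using y assms by (simp add: algebra_simps abs_if)
      also have "\<dots> \<le> d * 1" using y assms by (intro mult_left_mono) auto
      finally show ?thesis unfolding abs_mult using sq assms by (intro mult_mono) auto
    qed
    have "g y = (2 * (d + J y)) * (1 / n\<^sup>2) + q y * (2 / n ^ 3) + (d * n) * (2 / n ^ 3) + d * (1 / n\<^sup>2)"
      unfolding g_def using n by (simp add: field_simps power2_eq_square power3_eq_cube)
    then show ?thesis unfolding dec using b1 b2 b3 b4 by linarith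
  qed
  have "((\<lambda>y. f y - (q y - v) / n\<^sup>2) has_integral (integral {n..n+1} f - (v - v * (n + 1 - n)) / n\<^sup>2)) {n..n+1}"
    by (intro has_integral_diff qv integrable_integral fint)
  then have F: "((\<lambda>y. f y - (q y - v) / n\<^sup>2) has_integral integral {n..n+1} f) {n..n+1}" by simp
  \<comment> \<open>At y = n + 1 \<open>frac y\<close> is 0 and not y - n, so the pointwise bound is
    available only on the half-open cell. \<open>G\<close> patches this one point.\<close>
  define G where "G y = (if y = n + 1 then \<bar>f y - (q y - v) / n\<^sup>2\<bar> else g y)" for y
  have G: "(G has_integral (2 * d * (n + 1 - n) + 2 * d + (2 / n) * v + 2 * d * (n + 1 - n) + d * (n + 1 - n)) / n\<^sup>2) {n..n+1}"
    by (rule has_integral_spike_finite[OF _ _ g, of "{n+1}"]) (auto simp: G_def)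
  have "norm (integral {n..n+1} (\<lambda>y. f y - (q y - v) / n\<^sup>2)) \<le> integral {n..n+1} G"
    using F G point by (intro integral_norm_bound_integral) (auto simp: integrable_on_def G_def)
  then have "\<bar>integral {n..n+1} f\<bar> \<le> (2 * d * (n + 1 - n) + 2 * d + (2 / n) * v + 2 * d * (n + 1 - n) + d * (n + 1 - n)) / n\<^sup>2"
    using integral_unique[OF F] integral_unique[OF G] by simp
  also have "\<dots> \<le> (9 * d) / n\<^sup>2"
  proof (rule divide_right_mono)
    have "(2 / n) * v \<le> (2 / n) * (d * n)" using v n by (intro mult_left_mono) auto
    also have "\<dots> = 2 * d" using n by simp
    finally show "2 * d * (n + 1 - n) + 2 * d + (2 / n) * v + 2 * d * (n + 1 - n) + d * (n + 1 - n) \<le> 9 * d" by simp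
  qed auto
  finally show ?thesis unfolding n_def f_def[abs_def] .
qed

text \<open>The cell errors 9 d / K^2 are dominated by the telescoping differences of 1/(K - 1), so
  the total stays O(d / M) uniformly in the upper limit.\<close>

lemma saw_gap_tail:
  fixes M K :: nat
  assumes "0 < d" "2 \<le> M" "M \<le> K"
  shows "\<bar>integral {real M..real K} (\<lambda>y. saw_gap d y - frac_var (d * y) / y\<^sup>2)\<bar>
           \<le> 9 * d * (1 / (real M - 1) - 1 / (real K - 1))"
  using assms(3)
proof (induction K rule: dec_induct)
  case base
  then show ?case by simp
next
  case (step K)
  let ?f = "\<lambda>y. saw_gap d y - frac_var (d * y) / y\<^sup>2"
  have K: "real K \<ge> 2" using step assms by simp
  have "?f integrable_on {real M..real K + 1}"
    using assms by (intro integrable_diff saw_gap_integrable_compact frac_var_quotient_integrable_compact) auto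
  then have "integral {real M..real K} ?f + integral {real K..real K + 1} ?f = integral {real M..real K + 1} ?f"
    using step by (intro Henstock_Kurzweil_Integration.integral_combine) auto
  moreover have "\<bar>integral {real K..real K + 1} ?f\<bar> \<le> 9 * d / (real K)\<^sup>2"
    using saw_gap_cell[of d K] assms step by simp
  moreover have "9 * d / (real K)\<^sup>2 \<le> 9 * d * (1 / (real K - 1) - 1 / real K)"
  proof -
    have "1 / (real K)\<^sup>2 \<le> 1 / ((real K - 1) * real K)"
      using K by (intro divide_left_mono) (auto simp: power2_eq_square)
    also have "\<dots> = 1 / (real K - 1) - 1 / real K" using K by (simp add: field_simps)
    finally have "9 * d * (1 / (real K)\<^sup>2) \<le> 9 * d * (1 / (real K - 1) - 1 / real K)"
      using assms by (intro mult_left_mono) auto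
    then show ?thesis by simp
  qed
  ultimately have "\<bar>integral {real M..real K + 1} ?f\<bar>
      \<le> 9 * d * (1 / (real M - 1) - 1 / (real K - 1)) + 9 * d * (1 / (real K - 1) - 1 / real K)"
    using step.IH by linarith
  also have "\<dots> = 9 * d * (1 / (real M - 1) - 1 / real K)" by (simp add: algebra_simps)
  finally show ?case by (simp add: add.commute)
qed

text \<open>While d (m + 1) <= 1, the dilated sawtooth has one jump inside the cell, at c = (m +
  1)/(1 + d). The difference is d y before it and d y - 1 after it, so the integral is elementary
  and exact.\<close>

lemma saw_gap_initial_cell:
  fixes m :: nat
  assumes "0 < d" "d * (real m + 1) \<le> 1"
  shows "(saw_gap d has_integral (d\<^sup>2 - 2 * d * ln (1 + d) + d / (real m + 1))) {real m..real m + 1}"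
proof -
  define l where "l = 1 + d"
  define n where "n = real m + 1"
  define c where "c = n / l"
  have l: "l > 1" using assms by (simp add: l_def)
  have n: "n > 0" by (simp add: n_def)
  have c: "c > 0" "c < n" "real m \<le> c" "l * c = n"
  proof -
    show "c > 0" "c < n" "l * c = n" using l n by (auto simp: c_def field_simps)
    have "real m * l \<le> n" using assms by (simp add: l_def n_def algebra_simps)
    then show "real m \<le> c" using l by (simp add: c_def pos_le_divide_eq)
  qed
  have flo: "saw_gap d y = d\<^sup>2" if "y \<in> {real m..c} - {real m, c}" for y
  proof -
    have y: "real m < y" "y < c" using that by auto
    have y2: "y < n" "0 < y" using y c by linarith+
    have "l * y < n" using y c l by (metis mult_strict_left_mono less_trans zero_less_one)
    moreover have "1 * y \<le> l * y" by (rule mult_right_mono) (use l y2 in auto)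
    then have "y \<le> l * y" by (simp only: mult_1_left)
    then have "real m \<le> l * y" using y by linarith
    ultimately have "frac (l * y) = l * y - m"
      using y by (subst frac_unique_iff) (auto simp: n_def)
    moreover have "frac y = y - m"
      using y y2 by (subst frac_unique_iff) (auto simp: n_def)
    ultimately have e: "frac ((1 + d) * y) - frac y = d * y" by (simp add: l_def algebra_simps)
    show ?thesis unfolding saw_gap_def e using y2 by (simp add: power_mult_distrib)
  qed
  have fhi: "saw_gap d y = d\<^sup>2 - 2 * d / y + 1 / y\<^sup>2" if "y \<in> {c..n} - {c, n}" for y
  proof -
    have y: "c < y" "y < n" using that by auto
    have y2: "real m < y" "0 < y" using y c by linarith+
    have "n < l * y" using y c l by (metis mult_strict_left_mono less_trans zero_less_one)
    moreover have "l * y < l * n" using y l by simp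
    moreover have "l * n \<le> n + 1" using assms by (simp add: l_def n_def algebra_simps)
    ultimately have "frac (l * y) = l * y - n"
      by (subst frac_unique_iff) (auto simp: n_def)
    moreover have "frac y = y - m"
      using y y2 by (subst frac_unique_iff) (auto simp: n_def)
    ultimately have e: "frac ((1 + d) * y) - frac y = d * y - 1" by (simp add: l_def n_def algebra_simps)
    show ?thesis unfolding saw_gap_def e using y2 by (simp add: field_simps power2_eq_square)
  qed
  have 1: "(saw_gap d has_integral d\<^sup>2 * (c - m)) {real m..c}"
    by (rule has_integral_spike_finite[of "{real m, c}" _ _ "\<lambda>_. d\<^sup>2"])
       (use flo has_integral_const_real[of "d\<^sup>2" "real m" c] c in \<open>auto simp: algebra_simps\<close>)
  have "((\<lambda>y. d\<^sup>2 - 2 * d / y + 1 / y\<^sup>2) has_integral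
      (d\<^sup>2 * n - 2 * d * ln n - 1 / n) - (d\<^sup>2 * c - 2 * d * ln c - 1 / c)) {c..n}"
  proof (rule fundamental_theorem_of_calculus)
    fix y assume y: "y \<in> {c..n}"
    then show "((\<lambda>y. d\<^sup>2 * y - 2 * d * ln y - 1 / y) has_vector_derivative d\<^sup>2 - 2 * d / y + 1 / y\<^sup>2) (at y within {c..n})"
      using c unfolding has_real_derivative_iff_has_vector_derivative[symmetric]
      by (auto intro!: derivative_eq_intros simp: power2_eq_square)
  qed (use c in auto)
  then have 2: "(saw_gap d has_integral
      (d\<^sup>2 * n - 2 * d * ln n - 1 / n) - (d\<^sup>2 * c - 2 * d * ln c - 1 / c)) {c..n}"
    by (rule has_integral_spike_finite[of "{c, n}", rotated -1]) (use fhi in auto)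
  have lnc: "ln c = ln n - ln l" using n l by (simp add: c_def ln_div)
  have ic: "1 / c = (1 + d) / n" by (simp add: c_def l_def)
  have "(saw_gap d has_integral (d\<^sup>2 * (c - m) + ((d\<^sup>2 * n - 2 * d * ln n - 1 / n) - (d\<^sup>2 * c - 2 * d * ln c - 1 / c)))) {real m..n}"
    using c by (intro has_integral_combine[OF _ _ 1 2]) auto
  also have "d\<^sup>2 * (c - m) + ((d\<^sup>2 * n - 2 * d * ln n - 1 / n) - (d\<^sup>2 * c - 2 * d * ln c - 1 / c))
     = d\<^sup>2 - 2 * d * ln (1 + d) + d / (real m + 1)"
    unfolding lnc ic by (simp add: n_def l_def algebra_simps add_divide_distrib)
  finally show ?thesis by (simp add: n_def)
qed

text \<open>The contributions d / (m + 1) of the cells add up to a harmonic number, through which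
  Euler's constant enters the expansion.\<close>

lemma saw_gap_initial:
  fixes M :: nat
  assumes "0 < d" "d * real M \<le> 1"
  shows "integral {0..real M} (saw_gap d) = d\<^sup>2 * real M - 2 * d * ln (1 + d) * real M + d * harm M"
  using assms(2)
proof (induction M)
  case 0
  then show ?case by (simp add: harm_def)
next
  case (Suc M)
  have le: "d * real M \<le> 1" using Suc.prems assms(1) by (simp add: algebra_simps)
  have "integral {0..real M + 1} (saw_gap d) = integral {0..real M} (saw_gap d) + integral {real M..real M + 1} (saw_gap d)"
    using assms by (intro Henstock_Kurzweil_Integration.integral_combine[symmetric] saw_gap_integrable_compact) auto
  also have "integral {real M..real M + 1} (saw_gap d) = d\<^sup>2 - 2 * d * ln (1 + d) + d / (real M + 1)"
    using assms le Suc.prems by (intro integral_unique saw_gap_initial_cell) (auto simp: add.commute)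
  finally show ?case using Suc.IH[OF le] by (simp add: harm_Suc algebra_simps inverse_eq_divide)
qed

section \<open>Small-dilation expansion of the correlation\<close>

definition saw_corr :: "real \<Rightarrow> real" where
  "saw_corr d = integral {0..} (saw_gap d)"

definition frac_var_const :: real where
  "frac_var_const = integral {1..} (\<lambda>y. frac_var y / y\<^sup>2)"

lemma frac_var_quotient_integrable_halfline:
  assumes "a > 0"
  shows "(\<lambda>y. frac_var (d * y) / y\<^sup>2) integrable_on {a..}"
proof (rule borel_measurable_dominated_integrable)
  show "(\<lambda>y. 1 / y ^ 2) integrable_on {a..}" by (rule inverse_power_integrable_on) (use assms in auto)
  show "\<bar>frac_var (d * y) / y\<^sup>2\<bar> \<le> 1 / y ^ 2" for y
    using frac_var_nonneg frac_var_le_1 by (auto intro!: divide_right_mono)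
qed auto

text \<open>Rescaling moves the dependence on d into the lower limit e = d a. Since e <= 1, the
  stretch [e, 1] has the elementary integrand 1/y - 1; this is where ln (1 / d) originates.\<close>

lemma frac_var_quotient_scaled:
  assumes "d > 0" "a > 0" "d * a \<le> 1"
  shows "integral {a..} (\<lambda>y. frac_var (d * y) / y\<^sup>2) = d * (frac_var_const - ln (d * a) - 1 + d * a)"
proof -
  define F where "F y = frac_var y / y\<^sup>2" for y
  define e where "e = d * a"
  have e: "0 < e" "e \<le> 1" using assms by (auto simp: e_def)
  have Fint: "F integrable_on {b..}" if "b > 0" for b
    using frac_var_quotient_integrable_halfline[OF that, of 1] by (simp add: F_def[abs_def])
  then have "F absolutely_integrable_on {d * a..}"
    using e frac_var_nonneg by (intro nonnegative_absolutely_integrable_1) (auto simp: F_def e_def)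
  then have "integral {e..} F = integral {a..} (\<lambda>x. d * F (d * x))"
    unfolding e_def by (rule integral_atLeast_scaled(2)[symmetric]) (use assms in auto)
  also have "(\<lambda>x. d * F (d * x)) = (\<lambda>x. (1 / d) * (frac_var (d * x) / x\<^sup>2))"
    using assms by (auto simp: F_def power_mult_distrib power2_eq_square)
  also have "integral {a..} \<dots> = (1 / d) * integral {a..} (\<lambda>y. frac_var (d * y) / y\<^sup>2)"
    by (rule integral_mult_right)
  finally have 1: "integral {a..} (\<lambda>y. frac_var (d * y) / y\<^sup>2) = d * integral {e..} F"
    using assms by (simp add: field_simps)
  have "integral {e..} F = integral {e..1} F + integral {1..} F"
    using e by (intro integral_halfline_split(2) Fint integrable_on_subinterval[OF Fint[of e]]) auto
  moreover have "(F has_integral (ln 1 - 1) - (ln e - e)) {e..1}"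
  proof (rule has_integral_spike_finite[of "{1}" _ _ "\<lambda>y. 1 / y - 1"])
    show "((\<lambda>y. 1 / y - 1) has_integral (ln 1 - 1) - (ln e - e)) {e..1}"
    proof (rule fundamental_theorem_of_calculus)
      fix y assume "y \<in> {e..1}"
      then show "((\<lambda>y. ln y - y) has_vector_derivative 1 / y - 1) (at y within {e..1})"
        using e unfolding has_real_derivative_iff_has_vector_derivative[symmetric]
        by (auto intro!: derivative_eq_intros)
    qed (use e in auto)
    fix y assume y: "y \<in> {e..1} - {1}"
    then have "frac y = y" using e by (auto simp: frac_eq)
    then show "F y = 1 / y - 1" using y e by (auto simp: F_def frac_var_def field_simps power2_eq_square)
  qed auto
  ultimately have "integral {e..} F = - 1 - ln e + e + frac_var_const"
    using integral_unique[of F] by (simp add: frac_var_const_def F_def[abs_def])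
  then have "integral {e..} F = frac_var_const - ln (d * a) - 1 + d * a" by (simp add: e_def)
  then show ?thesis unfolding 1 by simp
qed

lemma integral_atLeast_LIMSEQ:
  fixes f :: "real \<Rightarrow> real"
  assumes "f integrable_on {a..}" "\<And>y. y \<ge> a \<Longrightarrow> f y \<ge> 0"
  shows "(\<lambda>K. integral {a..real K} f) \<longlonglongrightarrow> integral {a..} f"
proof -
  have "f absolutely_integrable_on {a..}"
    using assms by (intro nonnegative_absolutely_integrable_1) auto
  from filterlim_compose[OF integral_atLeast_tendsto[OF this] filterlim_real_sequentially]
  show ?thesis .
qed

text \<open>Exact head on [0, M] plus frozen tail. The tail comparison holds for finite K with a
  bound uniform in K, and then K tends to infinity.\<close>

lemma saw_corr_approx:
  fixes M :: nat
  assumes "0 < d" "2 \<le> M" "d * real M \<le> 1"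
  shows "\<bar>saw_corr d - (d\<^sup>2 * real M - 2 * d * ln (1 + d) * real M + d * harm M)
           - d * (frac_var_const - ln (d * real M) - 1 + d * real M)\<bar> \<le> 9 * d / (real M - 1)"
proof -
  let ?g = "\<lambda>y. frac_var (d * y) / y\<^sup>2"
  define L where "L = d\<^sup>2 * real M - 2 * d * ln (1 + d) * real M + d * harm M"
  have M: "real M \<ge> 2" using assms by simp
  have 1: "(\<lambda>K. integral {0..real K} (saw_gap d)) \<longlonglongrightarrow> saw_corr d"
    unfolding saw_corr_def using assms
    by (intro integral_atLeast_LIMSEQ saw_gap_integrable_halfline saw_gap_nonneg) auto
  have 2: "(\<lambda>K. integral {real M..real K} ?g) \<longlonglongrightarrow> d * (frac_var_const - ln (d * real M) - 1 + d * real M)"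
    using assms integral_atLeast_LIMSEQ[OF frac_var_quotient_integrable_halfline, of "real M" d]
      frac_var_quotient_scaled[of d "real M"] frac_var_nonneg by simp
  have lim: "(\<lambda>K. \<bar>integral {0..real K} (saw_gap d) - L - integral {real M..real K} ?g\<bar>)
     \<longlonglongrightarrow> \<bar>saw_corr d - L - d * (frac_var_const - ln (d * real M) - 1 + d * real M)\<bar>"
    by (intro tendsto_intros 1 2)
  have "\<bar>saw_corr d - L - d * (frac_var_const - ln (d * real M) - 1 + d * real M)\<bar> \<le> 9 * d / (real M - 1)"
  proof (rule tendsto_upperbound[OF lim])
    show "\<forall>\<^sub>F K in sequentially. \<bar>integral {0..real K} (saw_gap d) - L - integral {real M..real K} ?g\<bar> \<le> 9 * d / (real M - 1)"
      using eventually_ge_at_top[of M]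
    proof eventually_elim
      case (elim K)
      have "integral {0..real K} (saw_gap d) = integral {0..real M} (saw_gap d) + integral {real M..real K} (saw_gap d)"
        using assms elim by (intro Henstock_Kurzweil_Integration.integral_combine[symmetric] saw_gap_integrable_compact) auto
      then have "integral {0..real K} (saw_gap d) - L - integral {real M..real K} ?g
         = integral {real M..real K} (saw_gap d) - integral {real M..real K} ?g"
        using saw_gap_initial[of d M] assms by (simp add: L_def)
      also have "\<dots> = integral {real M..real K} (\<lambda>y. saw_gap d y - ?g y)"
        using assms by (intro integral_diff[symmetric] saw_gap_integrable_compact frac_var_quotient_integrable_compact) auto
      also have "\<bar>\<dots>\<bar> \<le> 9 * d * (1 / (real M - 1) - 1 / (real K - 1))"
        by (rule saw_gap_tail) (use assms elim in auto)
      also have "\<dots> \<le> 9 * d * (1 / (real M - 1))"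
        using assms elim by (intro mult_left_mono) auto
      finally show ?case by simp
    qed
  qed auto
  then show ?thesis by (simp add: L_def)
qed

text \<open>\<open>harm n - ln n\<close> decreases and \<open>harm n - ln n - 1/n\<close> increases,
  both towards Euler's constant.\<close>

lemma harm_minus_ln_bounds:
  assumes "M \<ge> 1"
  shows "\<bar>harm M - ln (real M) - euler_mascheroni\<bar> \<le> 1 / real M"
proof -
  have 1: "(\<lambda>n. harm n - ln (real n)) \<longlonglongrightarrow> (euler_mascheroni :: real)" by (rule euler_mascheroni_LIMSEQ)
  have "(euler_mascheroni :: real) \<le> harm M - ln (real M)"
    by (rule tendsto_upperbound[OF 1 eventually_sequentiallyI[of M]])
       (use assms euler_mascheroni_sequence_decreasing[of M] in auto)
  moreover have "harm M - ln (real M) - 1 / real M \<le> (euler_mascheroni :: real)"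
  proof (rule tendsto_lowerbound[OF 1 eventually_sequentiallyI[of M]])
    fix n assume "M \<le> n"
    then have "harm M - ln (real M) - 1 / real M \<le> harm n - ln (real n) - (1 / real n :: real)"
    proof (induction n rule: dec_induct)
      case (step n)
      have n: "real n > 0" using step assms by simp
      have "ln ((real n + 1) / real n) \<le> (real n + 1) / real n - 1"
        by (rule ln_le_minus_one) (use n in auto)
      then have "ln (real n + 1) - ln (real n) \<le> 1 / real n" using n by (simp add: ln_div field_simps)
      then show ?case using step by (simp add: harm_Suc inverse_eq_divide add.commute)
    qed simp
    also have "\<dots> \<le> harm n - ln (real n)" by simp
    finally show "harm M - ln (real M) - 1 / real M \<le> harm n - ln (real n)" .
  qed auto
  ultimately show ?thesis by linarith
qed

definition saw_const :: real where
  "saw_const = euler_mascheroni + frac_var_const - 1"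

lemma saw_corr_asymptotics:
  "(\<lambda>d. saw_corr d - d * (ln (1 / d) + saw_const)) \<in> O[at_right 0](\<lambda>d. d powr (3/2))"
proof (rule bigoI)
  have "eventually (\<lambda>d::real. d \<in> {0<..<1/16}) (at_right 0)"
    by (intro eventually_at_right_real) auto
  then show "\<forall>\<^sub>F d in at_right 0. norm (saw_corr d - d * (ln (1 / d) + saw_const)) \<le> 20 * norm (d powr (3/2))"
  proof eventually_elim
    case (elim d)
    define r where "r = sqrt d"
    have d: "0 < d" "d < 1/16" using elim by auto
    have r0: "r > 0" using d by (simp add: r_def)
    have rr: "r * r = d" using d by (simp add: r_def)
    have r: "r < 1/4"
    proof -
      have "sqrt d < sqrt ((1/4)\<^sup>2)" using d by (intro real_sqrt_less_mono) (simp add: power2_eq_square)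
      then show ?thesis by (simp add: r_def)
    qed
    \<comment> \<open>The tail costs d / M and the head d^2 M; taking M about d^(-1/2) balances both
      at d^(3/2). The added 1 gives 1/(M - 1) <= r, and d < 1/16 ensures d M <= 1.\<close>
    define M where "M = nat \<lceil>1 / r\<rceil> + 1"
    have Mlo: "real M \<ge> 1 / r + 1" and Mhi: "real M \<le> 1 / r + 2"
    proof -
      have "real (nat \<lceil>1 / r\<rceil>) = real_of_int \<lceil>1 / r\<rceil>" using r0 by simp
      then show "real M \<ge> 1 / r + 1" "real M \<le> 1 / r + 2"
        unfolding M_def of_nat_add using ceiling_correct[of "1 / r"] by linarith+
    qed
    have "4 \<le> 1 / r" using r r0 by (simp add: field_simps)
    then have "real M \<ge> 2" using Mlo by linarith
    then have M2: "M \<ge> 2" by simp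
    have dM: "d * real M \<le> r + 2 * d"
    proof -
      have "d * real M \<le> d * (1 / r + 2)" using Mhi d by (intro mult_left_mono) auto
      also have "\<dots> = r + 2 * d" using rr r0 by (simp add: field_simps)
      finally show ?thesis .
    qed
    have dM2: "d * real M \<le> (3/2) * r"
    proof -
      have "r * r \<le> r * (1/4)" using r r0 by (intro mult_left_mono) auto
      then show ?thesis using dM rr by linarith
    qed
    have dM1: "d * real M \<le> 1" using dM2 r by linarith
    have iM: "1 / (real M - 1) \<le> r" "1 / real M \<le> r"
    proof -
      have p: "0 < 1 / r" using r0 by simp
      have "1 / (real M - 1) \<le> 1 / (1 / r)"
        using Mlo p by (intro divide_left_mono mult_pos_pos) linarith+
      then show "1 / (real M - 1) \<le> r" by simp
      have "1 / real M \<le> 1 / (1 / r)"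
        using Mlo p by (intro divide_left_mono mult_pos_pos) linarith+
      then show "1 / real M \<le> r" by simp
    qed
    have ln1: "0 \<le> ln (1 + d)" "ln (1 + d) \<le> d" using d ln_add_one_self_le_self[of d] by auto
    have lnM: "ln (d * real M) = ln d + ln (real M)" using d M2 by (simp add: ln_mult)
    define H where "H = harm M - ln (real M) - euler_mascheroni"
    define R where "R = saw_corr d - (d\<^sup>2 * real M - 2 * d * ln (1 + d) * real M + d * harm M)
           - d * (frac_var_const - ln (d * real M) - 1 + d * real M)"
    have R: "\<bar>R\<bar> \<le> 9 * d * r"
    proof -
      have "\<bar>R\<bar> \<le> 9 * d / (real M - 1)" unfolding R_def by (rule saw_corr_approx[OF d(1) M2 dM1])
      also have "\<dots> = 9 * d * (1 / (real M - 1))" by simp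
      also have "\<dots> \<le> 9 * d * r" using iM d by (intro mult_left_mono) auto
      finally show ?thesis .
    qed
    have H: "\<bar>d * H\<bar> \<le> d * r"
    proof -
      have "\<bar>H\<bar> \<le> r" using harm_minus_ln_bounds[of M] M2 iM unfolding H_def by linarith
      then show ?thesis using d by (simp add: abs_mult)
    qed
    have e2: "\<bar>2 * d * ln (1 + d) * real M\<bar> \<le> 3 * d * r"
    proof -
      have "2 * d * (ln (1 + d) * real M) \<le> 2 * d * (d * real M)"
        using ln1 d by (intro mult_left_mono mult_right_mono) auto
      also have "\<dots> \<le> 2 * d * ((3/2) * r)" using dM2 d by (intro mult_left_mono) auto
      finally show ?thesis using d ln1 by (simp add: abs_mult mult.assoc)
    qed
    have e3: "\<bar>d\<^sup>2 * real M\<bar> \<le> (3/2) * d * r"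
    proof -
      have "d * (d * real M) \<le> d * ((3/2) * r)" using dM2 d by (intro mult_left_mono) auto
      then show ?thesis using d by (simp add: abs_mult power2_eq_square mult.assoc)
    qed
    \<comment> \<open>The ln M contained in \<open>harm M\<close> cancels the one from
      \<open>ln (d * real M)\<close> and leaves ln (1 / d). The error coefficients 9, 1, 3 and 2 *
      3/2 add up to 16.\<close>
    have "saw_corr d - d * (ln (1 / d) + saw_const) = R + d * H - 2 * d * ln (1 + d) * real M + 2 * (d\<^sup>2 * real M)"
      unfolding R_def H_def saw_const_def lnM using d by (simp add: ln_div algebra_simps power2_eq_square)
    then have "\<bar>saw_corr d - d * (ln (1 / d) + saw_const)\<bar> \<le> 16 * d * r"
      using R H e2 e3 by linarith
    also have "\<dots> \<le> 20 * (d * r)" using d r0 by simp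
    also have "d * r = d powr (3/2)"
    proof -
      have "d powr (3/2) = d powr 1 * d powr (1/2)" by (subst powr_add[symmetric]) simp
      then show ?thesis using d by (simp add: r_def powr_half_sqrt)
    qed
    finally show ?case by simp
  qed
qed

section \<open>The zeta function on the critical line as a Fourier transform\<close>

lemma absolutely_integrable_on_lborel:
  fixes f :: "real \<Rightarrow> 'a::euclidean_space"
  assumes "integrable lborel f"
  shows "f absolutely_integrable_on UNIV"
  using assms by (simp add: set_integrable_def integrable_completion)

text \<open>The change x = e^u turns a Mellin integral over the positive half-line into a Fourier
  integral over the whole line. The point 0, which \<open>exp\<close> misses, is negligible.\<close>

lemma exp_substitution:
  fixes F :: "real \<Rightarrow> 'a::euclidean_space"
  assumes "integrable lborel (\<lambda>u. exp u *\<^sub>R F (exp u))"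
  shows "F absolutely_integrable_on {0..}" "integral {0..} F = (\<integral>u. exp u *\<^sub>R F (exp u) \<partial>lborel)"
proof -
  have "(\<lambda>u. \<bar>exp u\<bar> *\<^sub>R F (exp u)) absolutely_integrable_on UNIV"
    using absolutely_integrable_on_lborel[OF assms] by simp
  moreover have "integral UNIV (\<lambda>u. \<bar>exp u\<bar> *\<^sub>R F (exp u)) = (\<integral>u. exp u *\<^sub>R F (exp u) \<partial>lborel)"
    using integral_lborel[OF assms] by simp
  ultimately have *: "F absolutely_integrable_on exp ` UNIV \<and>
      integral (exp ` UNIV) F = (\<integral>u. exp u *\<^sub>R F (exp u) \<partial>lborel)"
    using has_absolute_integral_change_of_variables_real[of UNIV exp exp F "\<integral>u. exp u *\<^sub>R F (exp u) \<partial>lborel"]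
    by (auto intro!: derivative_eq_intros inj_onI)
  have e: "exp ` UNIV = {0::real<..}" by (auto simp: image_iff) (metis exp_ln)
  have n: "negligible {x \<in> {0..} - {0<..}. F x \<noteq> 0}" "negligible {x \<in> {0<..} - {0..}. F x \<noteq> 0}"
    by (rule negligible_subset[of "{0}"]; auto)+
  have "integral {0..} F = integral {0<..} F" by (rule integral_spike_set[OF n])
  then show "integral {0..} F = (\<integral>u. exp u *\<^sub>R F (exp u) \<partial>lborel)"
    using * unfolding e by simp
  show "F absolutely_integrable_on {0..}"
    using * unfolding e absolutely_integrable_spike_set_eq[OF n] by simp
qed

lemma integrable_mult_bounded:
  fixes f g :: "'a \<Rightarrow> real"
  assumes "integrable M f" "g \<in> borel_measurable M" "\<And>x. \<bar>g x\<bar> \<le> 1"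
  shows "integrable M (\<lambda>x. f x * g x)"
  using assms(1)
  by (rule Bochner_Integration.integrable_bound)
     (use assms in \<open>auto simp: abs_mult intro!: mult_left_le\<close>)

lemma integrable_mult_cos:
  fixes f :: "real \<Rightarrow> real"
  assumes "integrable lborel f"
  shows "integrable lborel (\<lambda>x. f x * cos (t * x))"
  by (rule integrable_mult_bounded[OF assms]) auto

lemma integrable_exp_minus_abs:
  assumes "a > 0"
  shows "integrable lborel (\<lambda>u::real. exp (- a * \<bar>u\<bar>))"
proof -
  have 1: "set_integrable lborel {0..} (\<lambda>u::real. exp (- a * u))"
  proof -
    have "(\<lambda>u. exp (- a * u)) absolutely_integrable_on {0..}"
      using integrable_on_exp_minus_to_infinity[OF assms, of 0]
      by (intro nonnegative_absolutely_integrable_1) auto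
    then show ?thesis unfolding set_integrable_def by (simp add: integrable_completion)
  qed
  have 2: "set_integrable lborel {..0} (\<lambda>u::real. exp (a * u))"
    using lborel_integrable_real_affine[OF 1[unfolded set_integrable_def], of "-1" 0]
    unfolding set_integrable_def by (auto simp: indicator_def cong: if_cong)
  have "integrable lborel (\<lambda>u. indicator {0..} u *\<^sub>R exp (- a * u) + indicator {..0} u *\<^sub>R exp (a * u))"
    using 1 2 unfolding set_integrable_def by (rule Bochner_Integration.integrable_add)
  then show ?thesis
    by (rule Bochner_Integration.integrable_bound) (auto simp: indicator_def)
qed

section \<open>The sawtooth in logarithmic coordinates\<close>

definition saw_exp :: "real \<Rightarrow> real" where
  "saw_exp u = frac (exp u) * exp (- u / 2)"

lemma borel_measurable_saw_exp [measurable]: "saw_exp \<in> borel_measurable borel"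
  unfolding saw_exp_def[abs_def] by measurable

lemma saw_exp_nonneg: "saw_exp u \<ge> 0" by (simp add: saw_exp_def)

text \<open>Decay on the right comes from the factor e^(-u/2), decay on the left from
  \<open>frac x\<close> being at most x for x >= 0.\<close>

lemma saw_exp_le: "saw_exp u \<le> exp (- (1/2) * \<bar>u\<bar>)"
proof (cases "u \<ge> 0")
  case True
  have "saw_exp u \<le> 1 * exp (- u / 2)"
    unfolding saw_exp_def using frac_lt_1[of "exp u"] by (intro mult_right_mono) auto
  then show ?thesis using True by simp
next
  case False
  have "frac (exp u) \<le> exp u" by (simp add: frac_def)
  then have "saw_exp u \<le> exp u * exp (- u / 2)" unfolding saw_exp_def by (intro mult_right_mono) auto
  also have "\<dots> = exp (u / 2)" by (simp add: exp_add[symmetric])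
  finally show ?thesis using False by simp
qed

lemma saw_exp_le_1: "saw_exp u \<le> 1"
  by (rule order_trans[OF saw_exp_le]) simp

lemma integrable_saw_exp: "integrable lborel saw_exp"
  using integrable_exp_minus_abs[of "1/2"]
  by (rule Bochner_Integration.integrable_bound) (use saw_exp_nonneg saw_exp_le in auto)

lemma integrable_saw_exp_cis: "integrable lborel (\<lambda>u. complex_of_real (saw_exp u) * cis (- t * u))"
proof -
  have [measurable]: "(\<lambda>u. cis (- t * u)) \<in> borel_measurable borel"
    by (intro borel_measurable_continuous_onI continuous_intros)
  show ?thesis
    using integrable_saw_exp
      proof (rule Bochner_Integration.integrable_bound)
    show "(\<lambda>u. complex_of_real (saw_exp u) * cis (- t * u)) \<in> borel_measurable lborel" by measurable
  qed (simp add: norm_mult saw_exp_nonneg)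
qed

text \<open>The integrand may be singular at 0, so the fundamental theorem is used in the form that
  asks for a derivative only in the interior. The primitive is continuous at 0 because Re (1 - s) >
  0 and \<open>0 powr (1 - s)\<close> is 0.\<close>

lemma integral_powr_unit_interval:
  assumes "Re s < 1"
  shows "((\<lambda>x. complex_of_real x powr (-s)) has_integral 1 / (1 - s)) {0..1}"
proof -
  have ne: "1 - s \<noteq> 0" using assms by auto
  have "((\<lambda>x. complex_of_real x powr (-s)) has_integral
     complex_of_real 1 powr (1 - s) / (1 - s) - complex_of_real 0 powr (1 - s) / (1 - s)) {0..1}"
  proof (rule fundamental_theorem_of_calculus_interior)
    show "continuous_on {0..1} (\<lambda>x. complex_of_real x powr (1 - s) / (1 - s))"
      unfolding continuous_on_eq_continuous_within
    proof
      fix x :: real assume x: "x \<in> {0..1}"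
      show "continuous (at x within {0..1}) (\<lambda>x. complex_of_real x powr (1 - s) / (1 - s))"
      proof (cases "x = 0")
        case False
        then have "complex_of_real x \<notin> \<real>\<^sub>\<le>\<^sub>0" using x by (auto simp: complex_nonpos_Reals_iff)
        then have "((\<lambda>z. z powr (1 - s)) has_field_derivative (1 - s) * complex_of_real x powr (1 - s - 1)) (at (complex_of_real x))"
          by (rule has_field_derivative_powr)
        then have 1: "isCont (\<lambda>z. z powr (1 - s)) (complex_of_real x)" by (rule DERIV_isCont)
        have "isCont (\<lambda>x. complex_of_real x powr (1 - s)) x"
          using isCont_o2[of x complex_of_real "\<lambda>z. z powr (1 - s)"] 1 by (simp add: continuous_intros)
        then have "isCont (\<lambda>x. complex_of_real x powr (1 - s) / (1 - s)) x"
          using isCont_divide[of x _ "\<lambda>_. 1 - s"] ne by (simp add: continuous_intros)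
        then show ?thesis by (rule continuous_at_imp_continuous_at_within)
      next
        case True
        have "((\<lambda>x. norm (complex_of_real x powr (1 - s))) \<longlongrightarrow> 0) (at_right 0)"
        proof -
          define a where "a = Re (1 - s)"
          have "a > 0" using assms by (simp add: a_def)
          then have "((\<lambda>x::real. x powr a) \<longlongrightarrow> 0) (at_right 0)" by real_asymp
          then have "((\<lambda>x. x powr Re (1 - s)) \<longlongrightarrow> 0) (at_right 0)" by (simp only: a_def)
          moreover have "\<forall>\<^sub>F x in at_right 0. x powr Re (1 - s) = norm (complex_of_real x powr (1 - s))"
            using eventually_at_right_less[of 0] by eventually_elim (simp add: norm_powr_real_powr)
          ultimately show ?thesis by (rule Lim_transform_eventually)
        qed
        then have "((\<lambda>x. complex_of_real x powr (1 - s)) \<longlongrightarrow> 0) (at_right 0)"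
          by (rule tendsto_norm_zero_cancel)
        then have "((\<lambda>x. complex_of_real x powr (1 - s) / (1 - s)) \<longlongrightarrow> 0 / (1 - s)) (at_right 0)"
          by (rule tendsto_divide[OF _ tendsto_const ne])
        then have "((\<lambda>x. complex_of_real x powr (1 - s) / (1 - s)) \<longlongrightarrow> 0) (at 0 within {0..1})"
          by (simp add: at_within_Icc_at_right)
        then show ?thesis unfolding True continuous_within by simp
      qed
    qed
    fix x :: real assume x: "x \<in> {0<..<1}"
    then have nn: "complex_of_real x \<notin> \<real>\<^sub>\<le>\<^sub>0" by (auto simp: complex_nonpos_Reals_iff)
    then have "((\<lambda>z. z powr (1 - s)) has_field_derivative (1 - s) * complex_of_real x powr (1 - s - 1)) (at (complex_of_real x))"
      by (rule has_field_derivative_powr)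
    then have "((\<lambda>z. z powr (1 - s) / (1 - s)) has_field_derivative ((1 - s) * complex_of_real x powr (1 - s - 1)) / (1 - s)) (at (complex_of_real x))"
      by (rule DERIV_cdivide)
    then have "((\<lambda>z. z powr (1 - s) / (1 - s)) has_field_derivative (complex_of_real x powr (-s))) (at (complex_of_real x))"
      using ne by simp
    from has_vector_derivative_real_field[OF this]
    show "((\<lambda>x. complex_of_real x powr (1 - s) / (1 - s)) has_vector_derivative complex_of_real x powr (-s)) (at x)"
      by simp
  qed auto
  then show ?thesis by simp
qed

lemma cell_integral_one:
  assumes "s \<noteq> 0"
  shows "cell_integral (\<lambda>_. 1) (s + 1) n
    = - (complex_of_real (real (Suc n) + 1) powr (-s) / s - complex_of_real (real n + 1) powr (-s) / s)"
proof -
  have ne: "complex_of_real (real n + 1 + u) \<notin> \<real>\<^sub>\<le>\<^sub>0" if "u \<in> {0..1}" for u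
    using that by (auto simp: complex_nonpos_Reals_iff simp del: of_real_add)
  have "((\<lambda>u. complex_of_real 1 * complex_of_real (real n + 1 + u) powr (-(s+1)))
         has_integral - ((of_nat n + 1 + complex_of_real 1) powr (-s) / s)
            - - ((of_nat n + 1 + complex_of_real 0) powr (-s) / s)) {0..1}"
  proof (rule fundamental_theorem_of_calculus)
    fix u :: real assume u: "u \<in> {0..1}"
    define w where "w = of_nat n + 1 + complex_of_real u"
    have w: "w \<notin> \<real>\<^sub>\<le>\<^sub>0" "w \<noteq> 0" using ne[OF u] by (auto simp: w_def)
    have "((\<lambda>z. - ((of_nat n + 1 + z) powr (-s) / s)) has_field_derivative - ((-s) * w powr (-s - 1) / s)) (at (complex_of_real u))"
      using w assms unfolding w_def by (auto intro!: derivative_eq_intros)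
    also have "- ((-s) * w powr (-s - 1) / s) = w powr (-(s+1))"
    proof -
      have e: "- (s + 1) = - s - 1" by simp
      show ?thesis unfolding e using assms by simp
    qed
    finally have "((\<lambda>z. - ((of_nat n + 1 + z) powr (-s) / s)) has_field_derivative w powr (-(s+1))) (at (complex_of_real u))" .
    from has_vector_derivative_real_field[OF this]
    show "((\<lambda>u. - ((of_nat n + 1 + complex_of_real u) powr (-s) / s)) has_vector_derivative
        complex_of_real 1 * complex_of_real (real n + 1 + u) powr (-(s+1))) (at u within {0..1})"
      by (simp add: w_def)
  qed auto
  then have "cell_integral (\<lambda>_. 1) (s + 1) n = - ((of_nat n + 1 + complex_of_real 1) powr (-s) / s)
            - - ((of_nat n + 1 + complex_of_real 0) powr (-s) / s)"
    unfolding cell_integral_def by (rule integral_unique)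
  then show ?thesis by (simp add: add.commute)
qed

lemma integral_frac_powr_cell:
  shows "integral {real n + 1..real n + 2} (\<lambda>x. complex_of_real (frac x) * complex_of_real x powr (-(s+1)))
     = cell_integral (\<lambda>u. u - 1/2) (s + 1) n + cell_integral (\<lambda>_. 1) (s + 1) n / 2"
proof -
  let ?F = "\<lambda>x. complex_of_real (frac x) * complex_of_real x powr (-(s+1))"
  have "integral {real n + 1..real n + 2} ?F = integral {0 + (real n + 1)..1 + (real n + 1)} ?F" by (simp add: add.commute)
  also have "\<dots> = integral {0..1} (?F \<circ> ((+) (real n + 1)))" by (rule integral_shift_Icc_real[symmetric])
  also have "\<dots> = integral {0..1} (\<lambda>u. complex_of_real u * complex_of_real (real n + 1 + u) powr (-(s+1)))"
  proof (rule integral_spike[of "{1}"])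
    fix u :: real assume u: "u \<in> {0..1} - {1}"
    have "frac (real n + 1 + u) = u"
      using u by (subst frac_unique_iff) auto
    then show "complex_of_real u * complex_of_real (real n + 1 + u) powr (-(s+1)) = (?F \<circ> ((+) (real n + 1))) u"
      by (simp add: o_def)
  qed auto
  also have "\<dots> = integral {0..1} (\<lambda>u. complex_of_real (u - 1/2) * complex_of_real (real n + 1 + u) powr (-(s+1))
        + complex_of_real 1 * complex_of_real (real n + 1 + u) powr (-(s+1)) / 2)"
    by (rule arg_cong[where f = "integral _"]) (auto simp: algebra_simps)
  also have "\<dots> = cell_integral (\<lambda>u. u - 1/2) (s + 1) n + cell_integral (\<lambda>_. 1) (s + 1) n / 2"
    unfolding cell_integral_def
    by (intro integral_unique has_integral_add has_integral_divide integrable_integral cell_integrand_integrable continuous_intros) auto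
  finally show ?thesis .
qed

text \<open>The Mellin formula, which expresses zeta(s) as -s times the integral of frac x *
  x^(-s-1) over (0, oo) in the strip 0 < Re s < 1, written in the variable u = ln x. The interval
  [0, 1] contributes 1/(1 - s) and thereby absorbs the pole term, since -s/(1 - s) = 1 + 1/(s -
  1).\<close>

lemma zeta_eq_fourier_saw_exp:
  "zeta (1/2 + \<i> * of_real t) =
     - (1/2 + \<i> * of_real t) * (\<integral>u. complex_of_real (saw_exp u) * cis (- t * u) \<partial>lborel)"
proof -
  define s where "s = 1/2 + \<i> * of_real t"
  have s: "Re s = 1/2" "s \<noteq> 0" "s \<noteq> 1" by (auto simp: s_def complex_eq_iff)
  define F where "F x = complex_of_real (frac x) * complex_of_real x powr (-(s+1))" for x
  have Fexp: "exp u *\<^sub>R F (exp u) = complex_of_real (saw_exp u) * cis (- t * u)" for u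
  proof -
    have "complex_of_real (exp u) powr (-(s+1)) = exp (-(s+1) * of_real u)"
    proof -
      have "Ln (complex_of_real (exp u)) = of_real u" by (subst Ln_of_real) auto
      then show ?thesis unfolding powr_def by (simp only: of_real_eq_0_iff exp_not_eq_zero if_False)
    qed
    also have "\<dots> = exp (of_real (- (3/2) * u) + \<i> * of_real (- t * u))"
      by (simp add: s_def algebra_simps)
    also have "\<dots> = of_real (exp (- (3/2) * u)) * cis (- t * u)"
      by (simp only: exp_add exp_of_real cis_conv_exp)
    finally have "exp u *\<^sub>R F (exp u) = of_real (exp u * frac (exp u) * exp (- (3/2) * u)) * cis (- t * u)"
      by (simp add: F_def scaleR_conv_of_real)
    also have "exp u * frac (exp u) * exp (- (3/2) * u) = saw_exp u"
    proof -
      have "exp u * exp (- (3/2) * u) = exp (- u / 2)" by (simp add: exp_add[symmetric])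
      then show ?thesis by (simp add: saw_exp_def mult.commute mult.left_commute)
    qed
    finally show ?thesis .
  qed
  have int: "integrable lborel (\<lambda>u. exp u *\<^sub>R F (exp u))" unfolding Fexp by (rule integrable_saw_exp_cis)
  have Fabs: "F absolutely_integrable_on {0..}"
    and Fval: "integral {0..} F = (\<integral>u. complex_of_real (saw_exp u) * cis (- t * u) \<partial>lborel)"
    using exp_substitution[OF int] unfolding Fexp by auto
  have Fint: "F integrable_on {0..}" using Fabs by (rule set_lebesgue_integral_eq_integral(1))
  have Fsub: "F integrable_on {a..b}" if "a \<ge> 0" for a b
    by (rule integrable_on_subinterval[OF Fint]) (use that in auto)
  have F01: "integral {0..1} F = 1 / (1 - s)"
  proof -
    have "integral {0..1} F = integral {0..1} (\<lambda>x. complex_of_real x powr (-s))"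
    proof (rule integral_spike[of "{0,1}"])
      fix x :: real assume x: "x \<in> {0..1} - {0, 1}"
      then have "frac x = x" by (auto simp: frac_eq)
      moreover have "complex_of_real x * complex_of_real x powr (-(s+1)) = complex_of_real x powr (1 + (-(s+1)))"
        using x by (subst powr_add) auto
      ultimately show "complex_of_real x powr (-s) = F x" by (simp add: F_def)
    qed auto
    then show ?thesis using integral_powr_unit_interval[of s] s by (simp add: integral_unique)
  qed
  have part: "integral {0..real N + 1} F = 1 / (1 - s) +
     (\<Sum>n<N. cell_integral (\<lambda>u. u - 1/2) (s + 1) n + cell_integral (\<lambda>_. 1) (s + 1) n / 2)" for N
  proof (induction N)
    case 0 then show ?case using F01 by simp
  next
    case (Suc N)
    have "integral {0..real N + 1} F + integral {real N + 1..real N + 2} F = integral {0..real N + 2} F"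
      by (rule Henstock_Kurzweil_Integration.integral_combine) (auto intro: Fsub)
    moreover have "integral {real N + 1..real N + 2} F =
        cell_integral (\<lambda>u. u - 1/2) (s + 1) N + cell_integral (\<lambda>_. 1) (s + 1) N / 2"
      unfolding F_def by (rule integral_frac_powr_cell)
    ultimately show ?case using Suc.IH by (simp add: add.commute add.left_commute)
  qed
  have lim1: "(\<lambda>N. integral {0..real N + 1} F) \<longlonglongrightarrow> integral {0..} F"
    by (rule filterlim_compose[OF integral_atLeast_tendsto[OF Fabs]]) real_asymp
  have sum1: "(\<lambda>n. cell_integral (\<lambda>u. u - 1/2) (s + 1) n) sums (\<Sum>n. cell_integral (\<lambda>u. u - 1/2) (s + 1) n)"
    using s by (intro summable_sums summable_cell_integral continuous_intros) auto
  have sum2: "(\<lambda>n. cell_integral (\<lambda>_. 1) (s + 1) n) sums (1 / s)"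
  proof -
    define Z where "Z n = complex_of_real (real n + 1) powr (-s) / s" for n
    have "(\<lambda>n. Z (Suc n) - Z n) sums (0 / s - Z 0)"
      unfolding Z_def using s by (intro telescope_sums tendsto_divide shifted_powr_tendsto_0) auto
    then have "(\<lambda>n. - (Z (Suc n) - Z n)) sums - (0 / s - Z 0)" by (rule sums_minus)
    then have "(\<lambda>n. - (Z (Suc n) - Z n)) sums (1 / s)" by (simp add: Z_def)
    then show ?thesis unfolding cell_integral_one[OF s(2)] Z_def by (simp only:)
  qed
  have "(\<lambda>N. 1 / (1 - s) + (\<Sum>n<N. cell_integral (\<lambda>u. u - 1/2) (s + 1) n + cell_integral (\<lambda>_. 1) (s + 1) n / 2))
     \<longlonglongrightarrow> 1 / (1 - s) + ((\<Sum>n. cell_integral (\<lambda>u. u - 1/2) (s + 1) n) + (1 / s) / 2)"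
    using sums_add[OF sum1 sums_divide[OF sum2, of 2]] unfolding sums_def by (intro tendsto_add tendsto_const)
  then have "(\<lambda>N. integral {0..real N + 1} F) \<longlonglongrightarrow> 1 / (1 - s) + ((\<Sum>n. cell_integral (\<lambda>u. u - 1/2) (s + 1) n) + (1 / s) / 2)"
    by (simp only: part)
  then have "integral {0..} F = 1 / (1 - s) + ((\<Sum>n. cell_integral (\<lambda>u. u - 1/2) (s + 1) n) + (1 / s) / 2)"
    by (rule LIMSEQ_unique[OF lim1])
  then have "- s * integral {0..} F = - s / (1 - s) - s * (\<Sum>n. cell_integral (\<lambda>u. u - 1/2) (s + 1) n) - 1/2"
    using s by (simp add: algebra_simps)
  also have "- s / (1 - s) = 1 + 1 / (s - 1)" using s by (simp add: field_simps)
  finally have "- s * integral {0..} F = zeta s" using zeta_eq_sawtooth[of s] s by simp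
  then show ?thesis unfolding Fval s_def by simp
qed

section \<open>Autocorrelation and its cosine transform\<close>

definition saw_autocorr :: "real \<Rightarrow> real" where
  "saw_autocorr v = (\<integral>u. saw_exp u * saw_exp (u + v) \<partial>lborel)"

lemma integrable_saw_exp_shift: "integrable lborel (\<lambda>u. saw_exp (u + v))"
  using lborel_integrable_real_affine[OF integrable_saw_exp, of 1 v] by (simp add: add.commute)

lemma integral_saw_exp_shift: "(\<integral>v. saw_exp (u + v) \<partial>lborel) = (\<integral>v. saw_exp v \<partial>lborel)"
  using lborel_integral_real_affine[of 1 saw_exp u] by simp

lemma integrable_saw_exp_prod: "integrable (lborel \<Otimes>\<^sub>M lborel) (\<lambda>(u, v). saw_exp u * saw_exp (u + v))"
proof (rule lborel_pair.Fubini_integrable)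
  show "(\<lambda>(u, v). saw_exp u * saw_exp (u + v)) \<in> borel_measurable (lborel \<Otimes>\<^sub>M lborel)" by measurable
  have "integrable lborel (\<lambda>u. saw_exp u * (\<integral>v. saw_exp v \<partial>lborel))"
    using integrable_saw_exp by simp
  then show "integrable lborel (\<lambda>u. \<integral>v. norm (case (u, v) of (u, v) \<Rightarrow> saw_exp u * saw_exp (u + v)) \<partial>lborel)"
    by (simp add: abs_mult saw_exp_nonneg integral_saw_exp_shift)
  show "AE u in lborel. integrable lborel (\<lambda>v. case (u, v) of (u, v) \<Rightarrow> saw_exp u * saw_exp (u + v))"
    using integrable_saw_exp_shift by (auto simp: add.commute)
qed

lemma integrable_saw_exp_prod_cos:
  "integrable (lborel \<Otimes>\<^sub>M lborel) (\<lambda>(u, v). saw_exp u * saw_exp (u + v) * cos (t * v))"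
  using integrable_mult_bounded[OF integrable_saw_exp_prod, of "\<lambda>(u, v). cos (t * v)"]
  by (simp add: case_prod_unfold)

lemma integrable_saw_autocorr: "integrable lborel saw_autocorr"
  using lborel_pair.integrable_snd[OF integrable_saw_exp_prod] by (simp add: saw_autocorr_def[abs_def])

lemma integrable_saw_autocorr_prod: "integrable lborel (\<lambda>u. saw_exp u * saw_exp (u + v))"
  by (rule integrable_mult_bounded[OF integrable_saw_exp]) (auto simp: saw_exp_nonneg saw_exp_le_1)

lemma saw_autocorr_nonneg: "saw_autocorr v \<ge> 0"
  unfolding saw_autocorr_def by (intro Bochner_Integration.integral_nonneg) (simp add: saw_exp_nonneg)

lemma saw_autocorr_le: "saw_autocorr v \<le> (\<integral>u. saw_exp u \<partial>lborel)"
  unfolding saw_autocorr_def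
  by (intro integral_mono integrable_saw_autocorr_prod integrable_saw_exp)
     (auto intro!: mult_left_le saw_exp_le_1 saw_exp_nonneg)

lemma saw_autocorr_minus: "saw_autocorr (- v) = saw_autocorr v"
  unfolding saw_autocorr_def
  using lborel_integral_real_affine[of 1 "\<lambda>u. saw_exp u * saw_exp (u + - v)" v]
  by (simp add: mult.commute add.commute)

definition zeta_density :: "real \<Rightarrow> real" where
  "zeta_density t = (\<integral>v. saw_autocorr v * cos (t * v) \<partial>lborel)"

text \<open>The Wiener-Khinchin identity in real form. The squares of the cosine and sine parts
  combine by the addition theorem into a double integral with kernel cos (t (w - u)), and w = u + v
  brings out the autocorrelation.\<close>

lemma norm_fourier_saw_exp_square:
  "(norm (\<integral>u. complex_of_real (saw_exp u) * cis (- t * u) \<partial>lborel))\<^sup>2 = zeta_density t"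
proof -
  define C where "C = (\<integral>u. saw_exp u * cos (t * u) \<partial>lborel)"
  define S where "S = (\<integral>u. saw_exp u * sin (t * u) \<partial>lborel)"
  have ic: "integrable lborel (\<lambda>u. saw_exp u * cos (t * u))"
    by (rule integrable_mult_cos[OF integrable_saw_exp])
  have is': "integrable lborel (\<lambda>u. saw_exp u * sin (t * u))"
    by (rule integrable_mult_bounded[OF integrable_saw_exp]) auto
  let ?I = "\<integral>u. complex_of_real (saw_exp u) * cis (- t * u) \<partial>lborel"
  have Re: "Re ?I = C"
    unfolding C_def using integral_Re[OF integrable_saw_exp_cis[of t]] by simp
  have Im: "Im ?I = - S"
    unfolding S_def using integral_Im[OF integrable_saw_exp_cis[of t]] by simp
  have "(norm ?I)\<^sup>2 = C\<^sup>2 + S\<^sup>2" unfolding cmod_power2 Re Im by simp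
  also have "\<dots> = (\<integral>u. saw_exp u * cos (t * u) * C + saw_exp u * sin (t * u) * S \<partial>lborel)"
    using ic is' by (simp add: C_def S_def power2_eq_square)
  also have "\<dots> = (\<integral>u. (\<integral>v. saw_exp u * saw_exp (u + v) * cos (t * v) \<partial>lborel) \<partial>lborel)"
  proof (rule Bochner_Integration.integral_cong[OF refl])
    fix u
    have "saw_exp u * cos (t * u) * C + saw_exp u * sin (t * u) * S
       = (\<integral>w. saw_exp u * cos (t * u) * (saw_exp w * cos (t * w)) + saw_exp u * sin (t * u) * (saw_exp w * sin (t * w)) \<partial>lborel)"
      using ic is' by (simp add: C_def S_def)
    also have "\<dots> = (\<integral>w. saw_exp u * saw_exp w * cos (t * (w - u)) \<partial>lborel)"
      by (rule Bochner_Integration.integral_cong[OF refl]) (simp add: cos_diff right_diff_distrib algebra_simps)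
    also have "\<dots> = (\<integral>v. saw_exp u * saw_exp (u + v) * cos (t * v) \<partial>lborel)"
      using lborel_integral_real_affine[of 1 "\<lambda>w. saw_exp u * saw_exp w * cos (t * (w - u))" u] by simp
    finally show "saw_exp u * cos (t * u) * C + saw_exp u * sin (t * u) * S
       = (\<integral>v. saw_exp u * saw_exp (u + v) * cos (t * v) \<partial>lborel)" .
  qed
  also have "\<dots> = (\<integral>v. (\<integral>u. saw_exp u * saw_exp (u + v) * cos (t * v) \<partial>lborel) \<partial>lborel)"
    by (rule lborel_pair.Fubini_integral[symmetric]) (use integrable_saw_exp_prod_cos in simp)
  also have "\<dots> = (\<integral>v. saw_autocorr v * cos (t * v) \<partial>lborel)"
    by (simp add: saw_autocorr_def)
  finally show ?thesis by (simp add: zeta_density_def)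
qed

lemma norm_zeta_square: "(norm (zeta (1/2 + \<i> * of_real t)))\<^sup>2 = (1/4 + t\<^sup>2) * zeta_density t"
proof -
  have "(norm (- (1/2 + \<i> * complex_of_real t)))\<^sup>2 = 1/4 + t\<^sup>2"
    unfolding norm_minus_cancel cmod_power2 by (simp add: power2_eq_square)
  then show ?thesis
    unfolding zeta_eq_fourier_saw_exp norm_mult power_mult_distrib norm_fourier_saw_exp_square by simp
qed

section \<open>Small-shift expansion of the autocorrelation\<close>

definition saw_square :: real where
  "saw_square = (\<integral>u. (frac (exp u))\<^sup>2 * exp (- u) \<partial>lborel)"

text \<open>Polarization: twice the product of two fractional parts is the sum of their squares
  minus the square of their difference. The squares are translates of one function up to a factor
  and give the cosh term; the difference becomes \<open>saw_corr\<close> under y = e^u, with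
  dilation 1 + d = e^v.\<close>

lemma saw_autocorr_eq:
  assumes "v > 0"
  shows "saw_autocorr v = cosh (v / 2) * saw_square - exp (- v / 2) * saw_corr (exp v - 1) / 2"
proof -
  define a where "a u = (frac (exp u))\<^sup>2 * exp (- u)" for u :: real
  have a: "a u = saw_exp u * saw_exp u" for u
  proof -
    have "exp (- u) = exp (- u / 2) * exp (- u / 2)" by (simp add: exp_add[symmetric])
    then show ?thesis by (simp add: a_def saw_exp_def power2_eq_square)
  qed
  have ia: "integrable lborel a" unfolding a[abs_def] using integrable_saw_autocorr_prod[of 0] by simp
  have ia': "integrable lborel (\<lambda>u. a (u + v))"
    using lborel_integrable_real_affine[OF ia, of 1 v] by (simp add: add.commute)
  have la': "(\<integral>u. a (u + v) \<partial>lborel) = saw_square"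
    using lborel_integral_real_affine[of 1 a v] by (simp add: saw_square_def a_def add.commute)
  define d where "d = exp v - 1"
  have d: "d > 0" using assms by (simp add: d_def)
  define g where "g u = exp u *\<^sub>R saw_gap d (exp u)" for u
  have g: "g u = (frac (exp (u + v)) - frac (exp u))\<^sup>2 * exp (- u)" for u
  proof -
    have "(1 + d) * exp u = exp (u + v)" by (simp add: d_def exp_add)
    moreover have "exp u / (exp u)\<^sup>2 = exp (- u)" by (simp add: power2_eq_square exp_minus inverse_eq_divide)
    ultimately show ?thesis by (simp add: g_def saw_gap_def field_simps)
  qed
  have prod: "saw_exp u * saw_exp (u + v) = exp (- v / 2) * (a u + exp v * a (u + v) - g u) / 2" for u
  proof -
    have e1: "exp (- u / 2) * exp (- (u + v) / 2) = exp (- v / 2) * exp (- u)"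
      by (simp add: exp_add[symmetric] field_simps)
    have e2: "exp v * exp (- (u + v)) = exp (- u)" by (simp add: exp_add[symmetric])
    have "saw_exp u * saw_exp (u + v) = frac (exp u) * frac (exp (u + v)) * (exp (- u / 2) * exp (- (u + v) / 2))"
      by (simp add: saw_exp_def)
    also have "\<dots> = exp (- v / 2) * ((frac (exp u))\<^sup>2 * exp (- u) + (frac (exp (u + v)))\<^sup>2 * exp (- u) - g u) / 2"
      unfolding e1 g by (simp add: power2_eq_square algebra_simps)
    also have "(frac (exp (u + v)))\<^sup>2 * exp (- u) = exp v * a (u + v)"
      unfolding a_def using e2 by (metis mult.commute mult.left_commute)
    finally show ?thesis by (simp add: a_def)
  qed
  have ig: "integrable lborel g"
  proof (rule Bochner_Integration.integrable_bound)
    show "integrable lborel (\<lambda>u. 2 * a u + 2 * (exp v * a (u + v)))" using ia ia' by simp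
    show "g \<in> borel_measurable lborel" unfolding g[abs_def] by measurable
    have "\<bar>g u\<bar> \<le> \<bar>2 * a u + 2 * (exp v * a (u + v))\<bar>" for u
    proof -
      have g0: "g u \<ge> 0" by (simp add: g)
      have "a u \<ge> 0" "a (u + v) \<ge> 0" by (auto simp: a_def)
      moreover have "g u = a u + exp v * a (u + v) - 2 * exp (v / 2) * (saw_exp u * saw_exp (u + v))"
      proof -
        have "exp (v / 2) * exp (- v / 2) = 1" by (simp add: exp_add[symmetric])
        moreover have "2 * exp (v / 2) * (saw_exp u * saw_exp (u + v)) =
            (exp (v / 2) * exp (- v / 2)) * (a u + exp v * a (u + v) - g u)"
          unfolding prod by simp
        ultimately show ?thesis by simp
      qed
      moreover have "2 * exp (v / 2) * (saw_exp u * saw_exp (u + v)) \<ge> 0" using saw_exp_nonneg by simp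
      ultimately have "g u \<le> 2 * a u + 2 * (exp v * a (u + v))"
        by (smt (verit, best) exp_gt_zero mult_nonneg_nonneg)
      then show ?thesis using g0 by linarith
    qed
    then show "AE u in lborel. norm (g u) \<le> norm (2 * a u + 2 * (exp v * a (u + v)))" by simp
  qed
  have lg: "(\<integral>u. g u \<partial>lborel) = saw_corr d"
    unfolding saw_corr_def using exp_substitution(2)[of "saw_gap d"] ig unfolding g_def[abs_def] by simp
  have "saw_autocorr v = exp (- v / 2) * (saw_square + exp v * saw_square - saw_corr d) / 2"
    unfolding saw_autocorr_def prod using ia ia' ig la' lg by (simp add: saw_square_def a_def[abs_def])
  also have "\<dots> = (exp (- v / 2) + exp (- v / 2) * exp v) / 2 * saw_square - exp (- v / 2) * saw_corr d / 2"
    by (simp add: algebra_simps diff_divide_distrib add_divide_distrib)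
  also have "exp (- v / 2) * exp v = exp (v / 2)" by (simp add: exp_add[symmetric])
  finally show ?thesis by (simp add: d_def cosh_def add.commute)
qed

text \<open>Substitute d = e^v - 1 in the expansion of \<open>saw_corr\<close>. Replacing d by v,
  and the factors cosh (v/2) and e^(-v/2) by 1, costs no more than the error v^(3/2) that is already
  present.\<close>

lemma saw_autocorr_asymptotics:
  "(\<lambda>v. saw_autocorr v - (saw_square - v * (ln (1 / v) + saw_const) / 2)) \<in> O[at_right 0](\<lambda>v. v powr (3/2))"
proof -
  define K where "K = saw_const"
  define R where "R d = saw_corr d - d * (ln (1 / d) + K)" for d
  have R: "R \<in> O[at_right 0](\<lambda>d. d powr (3/2))"
    using saw_corr_asymptotics by (simp add: R_def[abs_def] K_def)
  have fl: "filterlim (\<lambda>v::real. exp v - 1) (at_right 0) (at_right 0)" by real_asymp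
  have 1: "(\<lambda>v. R (exp v - 1)) \<in> O[at_right 0](\<lambda>v. (exp v - 1) powr (3/2))"
    using landau_o.big.compose[OF R fl] by simp
  also have "(\<lambda>v::real. (exp v - 1) powr (3/2)) \<in> O[at_right 0](\<lambda>v. v powr (3/2))" by real_asymp
  finally have "(\<lambda>v. exp (- v / 2) * R (exp v - 1)) \<in> O[at_right 0](\<lambda>v. 1 * v powr (3/2))"
    by (rule landau_o.big.mult[rotated]) real_asymp
  moreover have "(\<lambda>v. (cosh (v / 2) - 1) * saw_square) \<in> O[at_right 0](\<lambda>v. v powr (3/2))"
  proof -
    have "(\<lambda>v::real. cosh (v / 2) - 1) \<in> O[at_right 0](\<lambda>v. v powr (3/2))"
    proof -
      have "(\<lambda>v::real. (exp (v / 2) + exp (- (v / 2))) / 2 - 1) \<in> O[at_right 0](\<lambda>v. v powr (3/2))" by real_asymp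
      then show ?thesis by (simp add: cosh_field_def)
    qed
    then show ?thesis by (cases "saw_square = 0") auto
  qed
  moreover have "(\<lambda>v. exp (- v / 2) * ((exp v - 1) * (ln (1 / (exp v - 1)) + K)) - v * (ln (1 / v) + K))
      \<in> O[at_right 0](\<lambda>v. v powr (3/2))"
    by real_asymp
  ultimately have "(\<lambda>v. (cosh (v / 2) - 1) * saw_square - (1/2) * (exp (- v / 2) * R (exp v - 1))
      - (1/2) * (exp (- v / 2) * ((exp v - 1) * (ln (1 / (exp v - 1)) + K)) - v * (ln (1 / v) + K)))
      \<in> O[at_right 0](\<lambda>v. v powr (3/2))"
    by (intro sum_in_bigo) auto
  moreover have "\<forall>\<^sub>F v in at_right 0. saw_autocorr v - (saw_square - v * (ln (1 / v) + saw_const) / 2)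
      = (cosh (v / 2) - 1) * saw_square - (1/2) * (exp (- v / 2) * R (exp v - 1))
      - (1/2) * (exp (- v / 2) * ((exp v - 1) * (ln (1 / (exp v - 1)) + K)) - v * (ln (1 / v) + K))"
    using eventually_at_right_less[of 0]
  proof eventually_elim
    case (elim v)
    then show ?case by (simp add: saw_autocorr_eq R_def K_def algebra_simps)
  qed
  ultimately show ?thesis by (subst landau_o.big.in_cong)
qed

section \<open>A comparison density with explicit transform\<close>

lemma set_lborel_integral_eq_integral:
  fixes f :: "real \<Rightarrow> real"
  assumes "f \<in> borel_measurable borel" "f absolutely_integrable_on S" "S \<in> sets borel"
  shows "integrable lborel (\<lambda>x. indicator S x * f x)"
    "(\<integral>x. indicator S x * f x \<partial>lborel) = integral S f"
proof -
  note [measurable] = assms(1,3)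
  have i: "integrable lebesgue (\<lambda>x. indicator S x *\<^sub>R f x)"
    using assms(2) by (simp add: set_integrable_def)
  then show i': "integrable lborel (\<lambda>x. indicator S x * f x)"
    by (subst (asm) integrable_completion) auto
  have "integral S f = set_lebesgue_integral lebesgue S f"
    using assms(2) by (rule set_lebesgue_integral_eq_integral(2)[symmetric])
  also have "\<dots> = (\<integral>x. indicator S x * f x \<partial>lborel)"
    unfolding set_lebesgue_integral_def by (subst integral_completion) auto
  finally show "(\<integral>x. indicator S x * f x \<partial>lborel) = integral S f" by simp
qed

lemma integral_exp_minus_abs_cos:
  fixes a t :: real
  assumes a: "a > 0"
  shows "(\<integral>v. exp (- a * \<bar>v\<bar>) * cos (t * v) \<partial>lborel) = 2 * a / (a\<^sup>2 + t\<^sup>2)"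
proof -
  define f where "f v = exp (- a * v) * cos (t * v)" for v
  define F where "F v = exp (- a * v) * (t * sin (t * v) - a * cos (t * v)) / (a\<^sup>2 + t\<^sup>2)" for v
  have p: "a\<^sup>2 + t\<^sup>2 > 0" using a by (simp add: add_pos_nonneg)
  have [measurable]: "f \<in> borel_measurable borel" unfolding f_def[abs_def] by measurable
  have ifull: "integrable lborel (\<lambda>v. exp (- a * \<bar>v\<bar>) * cos (t * v))"
    by (rule integrable_mult_cos[OF integrable_exp_minus_abs[OF a]])
  have f: "f absolutely_integrable_on {0..}"
  proof -
    have "(\<lambda>v. exp (- a * \<bar>v\<bar>) * cos (t * v)) absolutely_integrable_on {0..}"
      using absolutely_integrable_on_lborel[OF ifull] by (rule set_integrable_subset) auto
    then show ?thesis by (rule set_integrable_cong[THEN iffD1, rotated -1]) (auto simp: f_def)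
  qed
  have ftc: "(f has_integral F x - F 0) {0..x}" if "x \<ge> 0" for x
  proof (rule fundamental_theorem_of_calculus[OF that])
    fix v
    have "((\<lambda>v. exp (- a * v) * (t * sin (t * v) - a * cos (t * v))) has_real_derivative
         (- a * exp (- a * v)) * (t * sin (t * v) - a * cos (t * v))
       + exp (- a * v) * (t * (cos (t * v) * t) - a * (- sin (t * v) * t))) (at v within {0..x})"
      by (auto intro!: derivative_eq_intros simp: algebra_simps)
    from DERIV_cdivide[OF this, of "a\<^sup>2 + t\<^sup>2"]
    have "(F has_real_derivative ((- a * exp (- a * v)) * (t * sin (t * v) - a * cos (t * v))
       + exp (- a * v) * (t * (cos (t * v) * t) - a * (- sin (t * v) * t))) / (a\<^sup>2 + t\<^sup>2)) (at v within {0..x})"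
      unfolding F_def[abs_def] .
    also have "((- a * exp (- a * v)) * (t * sin (t * v) - a * cos (t * v))
       + exp (- a * v) * (t * (cos (t * v) * t) - a * (- sin (t * v) * t))) = f v * (a\<^sup>2 + t\<^sup>2)"
      by (simp add: f_def algebra_simps power2_eq_square)
    also have "\<dots> / (a\<^sup>2 + t\<^sup>2) = f v" by (rule nonzero_mult_div_cancel_right) (use p in linarith)
    finally show "(F has_vector_derivative f v) (at v within {0..x})"
      by (simp add: has_real_derivative_iff_has_vector_derivative)
  qed
  have "((\<lambda>x. F x - F 0) \<longlongrightarrow> 0 - F 0) at_top"
  proof (intro tendsto_diff tendsto_const)
    have "((\<lambda>x. exp (- a * x) * ((\<bar>t\<bar> + a) / (a\<^sup>2 + t\<^sup>2))) \<longlongrightarrow> 0) at_top"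
      using a by (cases "(\<bar>t\<bar> + a) / (a\<^sup>2 + t\<^sup>2) = 0") real_asymp+
    then show "(F \<longlongrightarrow> 0) at_top"
    proof (rule Lim_null_comparison[rotated], intro always_eventually allI)
      fix v
      have "\<bar>t * sin (t * v) - a * cos (t * v)\<bar> \<le> \<bar>t * sin (t * v)\<bar> + \<bar>a * cos (t * v)\<bar>" by (rule abs_triangle_ineq4)
      also have "\<dots> \<le> \<bar>t\<bar> + a" using a by (intro add_mono) (auto simp: abs_mult intro!: mult_left_le)
      finally have "exp (- a * v) * \<bar>t * sin (t * v) - a * cos (t * v)\<bar> / (a\<^sup>2 + t\<^sup>2) \<le> exp (- a * v) * (\<bar>t\<bar> + a) / (a\<^sup>2 + t\<^sup>2)"
        using p by (intro divide_right_mono mult_left_mono) auto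
      then show "norm (F v) \<le> exp (- a * v) * ((\<bar>t\<bar> + a) / (a\<^sup>2 + t\<^sup>2))"
        using p by (simp add: F_def abs_mult)
    qed
  qed
  moreover have "\<forall>\<^sub>F x in at_top. F x - F 0 = integral {0..x} f"
    using eventually_ge_at_top[of 0] by eventually_elim (use ftc integral_unique in force)
  ultimately have "((\<lambda>x. integral {0..x} f) \<longlongrightarrow> 0 - F 0) at_top"
    by (rule Lim_transform_eventually)
  then have half: "integral {0..} f = a / (a\<^sup>2 + t\<^sup>2)"
    using tendsto_unique[OF _ integral_atLeast_tendsto[OF f]] by (force simp: F_def)
  have i1: "integrable lborel (\<lambda>v. indicator {0..} v * f v)" and
    l1: "(\<integral>v. indicator {0..} v * f v \<partial>lborel) = a / (a\<^sup>2 + t\<^sup>2)"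
    using set_lborel_integral_eq_integral[OF _ f] half by auto
  have i2: "integrable lborel (\<lambda>v. indicator {0..} (- v) * f (- v))"
    using lborel_integrable_real_affine[OF i1, of "-1" 0] by simp
  have l2: "(\<integral>v. indicator {0..} (- v) * f (- v) \<partial>lborel) = a / (a\<^sup>2 + t\<^sup>2)"
    using lborel_integral_real_affine[of "-1" "\<lambda>v. indicator {0..} v * f v" 0] l1 by simp
  have "(\<integral>v. exp (- a * \<bar>v\<bar>) * cos (t * v) \<partial>lborel)
     = (\<integral>v. indicator {0..} v * f v + indicator {0..} (- v) * f (- v) \<partial>lborel)"
  proof (rule integral_cong_AE)
    \<comment> \<open>At v = 0 both half-line pieces contribute, so the decomposition holds only
      almost everywhere.\<close>
    have "AE v in lborel. v \<noteq> (0::real)" by (rule AE_lborel_singleton)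
    then show "AE v in lborel. exp (- a * \<bar>v\<bar>) * cos (t * v) = indicator {0..} v * f v + indicator {0..} (- v) * f (- v)"
      by eventually_elim (auto simp: f_def indicator_def)
  qed auto
  also have "\<dots> = a / (a\<^sup>2 + t\<^sup>2) + a / (a\<^sup>2 + t\<^sup>2)" using i1 i2 l1 l2 by simp
  finally show ?thesis by simp
qed

lemma integral_exp_minus_abs:
  fixes a :: real
  assumes "a > 0"
  shows "(\<integral>v. exp (- a * \<bar>v\<bar>) \<partial>lborel) = 2 / a"
  using integral_exp_minus_abs_cos[OF assms, of 0] assms by (simp add: power2_eq_square)

text \<open>The exponential integral \<open>E\<^sub>2(|v|)\<close>; its cosine transform has a closed form, and its singularity at
  \<open>0\<close> is the one of the autocorrelation.\<close>

definition expint2_kernel :: "real \<Rightarrow> real \<Rightarrow> real" where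
  "expint2_kernel a v = indicator {1..} a * (exp (- a * \<bar>v\<bar>) / a\<^sup>2)"

definition expint2 :: "real \<Rightarrow> real" where
  "expint2 v = (\<integral>a. expint2_kernel a v \<partial>lborel)"

lemma borel_measurable_expint2_kernel [measurable]:
  "(\<lambda>(a, v). expint2_kernel a v) \<in> borel_measurable (lborel \<Otimes>\<^sub>M lborel)"
  unfolding expint2_kernel_def by measurable

lemma borel_measurable_expint2_kernel_slice [measurable]:
  "(\<lambda>a. expint2_kernel a v) \<in> borel_measurable borel" "expint2_kernel a \<in> borel_measurable borel"
  unfolding expint2_kernel_def[abs_def] by measurable

lemma expint2_prod_integrable:
  "integrable (lborel \<Otimes>\<^sub>M lborel) (\<lambda>(a, v). expint2_kernel a v)"
proof (rule lborel_pair.Fubini_integrable)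
  have e: "(\<integral>v. norm (expint2_kernel a v) \<partial>lborel) = 2 * (indicator {1..} a * (1 / a ^ 3))" for a :: real
  proof (cases "a \<ge> 1")
    case True
    then have "(\<integral>v. exp (- a * \<bar>v\<bar>) / a\<^sup>2 \<partial>lborel) = (2 / a) / a\<^sup>2"
      using integral_exp_minus_abs[of a] by simp
    then show ?thesis using True by (simp add: expint2_kernel_def power2_eq_square power3_eq_cube)
  qed (simp add: expint2_kernel_def)
  have "integrable lborel (\<lambda>a::real. indicator {1..} a * (1 / a ^ 3))"
    by (rule set_lborel_integral_eq_integral(1)) (auto intro!: inverse_power_integrable_on)
  then show "integrable lborel (\<lambda>a. \<integral>v. norm (case (a, v) of (a, v) \<Rightarrow> expint2_kernel a v) \<partial>lborel)"
    by (simp only: prod.case e integrable_mult_right)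
  have "integrable lborel (expint2_kernel a)" for a :: real
    unfolding expint2_kernel_def[abs_def] using integrable_exp_minus_abs[of a] by (cases "a \<ge> 1") auto
  then show "AE a in lborel. integrable lborel (\<lambda>v. case (a, v) of (a, v) \<Rightarrow> expint2_kernel a v)"
    by simp
qed measurable

lemma integrable_expint2: "integrable lborel expint2"
  using lborel_pair.integrable_snd[OF expint2_prod_integrable] by (simp add: expint2_def[abs_def])

lemma expint2_slice_integrable: "integrable lborel (\<lambda>a. expint2_kernel a v)"
proof (rule Bochner_Integration.integrable_bound)
  show "integrable lborel (\<lambda>a::real. indicator {1..} a * (1 / a ^ 2))"
    by (rule set_lborel_integral_eq_integral(1)) (auto intro!: inverse_power_integrable_on)
  show "AE a in lborel. norm (expint2_kernel a v) \<le> norm (indicator {1..} a * (1 / a ^ 2) :: real)"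
    by (auto simp: expint2_kernel_def indicator_def intro!: divide_right_mono)
qed auto

lemma expint2_nonneg: "expint2 v \<ge> 0"
  unfolding expint2_def by (intro Bochner_Integration.integral_nonneg) (auto simp: expint2_kernel_def)

lemma expint2_le: "expint2 v \<le> expint2 0"
  unfolding expint2_def
  by (intro integral_mono expint2_slice_integrable)
     (auto simp: expint2_kernel_def indicator_def intro!: divide_right_mono)

text \<open>Fubini over the parameter of the kernel leaves the integral of 2 / (a (a^2 + t^2)) over
  a >= 1, which partial fractions evaluate. These involve a division by t^2.\<close>

lemma integral_expint2_cos:
  fixes t :: real
  assumes t: "t \<noteq> 0"
  shows "(\<integral>v. expint2 v * cos (t * v) \<partial>lborel) = ln (1 + t\<^sup>2) / t\<^sup>2"
proof -
  have t2: "t\<^sup>2 > 0" using t by simp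
  have ip: "integrable (lborel \<Otimes>\<^sub>M lborel) (\<lambda>(a, v). expint2_kernel a v * cos (t * v))"
    using integrable_mult_bounded[OF expint2_prod_integrable, of "\<lambda>(a, v). cos (t * v)"]
    by (simp add: case_prod_unfold)
  define h where "h a = 2 / (a * (a\<^sup>2 + t\<^sup>2))" for a :: real
  define H where "H a = (ln (a\<^sup>2) - ln (a\<^sup>2 + t\<^sup>2)) / t\<^sup>2" for a :: real
  have hm: "h \<in> borel_measurable borel" unfolding h_def[abs_def] by measurable
  have habs: "h absolutely_integrable_on {1..}"
  proof (rule borel_measurable_dominated_absolutely_integrable[OF hm])
    show "(\<lambda>a::real. 2 * (1 / a ^ 3)) integrable_on {1..}"
      by (intro integrable_on_mult_right inverse_power_integrable_on) auto
    fix a :: real assume a: "a \<in> {1..}"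
    have "2 / (a * (a\<^sup>2 + t\<^sup>2)) \<le> 2 / (a * a\<^sup>2)"
      using a by (intro divide_left_mono mult_left_mono mult_pos_pos) (auto simp: add_pos_nonneg)
    then show "norm (h a) \<le> 2 * (1 / a ^ 3)" using a by (simp add: h_def power2_eq_square power3_eq_cube)
  qed auto
  have "(\<integral>v. expint2 v * cos (t * v) \<partial>lborel)
     = (\<integral>v. (\<integral>a. expint2_kernel a v * cos (t * v) \<partial>lborel) \<partial>lborel)"
    by (simp add: expint2_def)
  also have "\<dots> = (\<integral>a. (\<integral>v. expint2_kernel a v * cos (t * v) \<partial>lborel) \<partial>lborel)"
    by (rule lborel_pair.Fubini_integral) (use ip in simp)
  also have "\<dots> = (\<integral>a. indicator {1..} a * h a \<partial>lborel)"
  proof (rule Bochner_Integration.integral_cong[OF refl])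
    fix a :: real
    show "(\<integral>v. expint2_kernel a v * cos (t * v) \<partial>lborel) = indicator {1..} a * h a"
    proof (cases "a \<ge> 1")
      case True
      have "(\<integral>v. exp (- a * \<bar>v\<bar>) / a\<^sup>2 * cos (t * v) \<partial>lborel) = (\<integral>v. exp (- a * \<bar>v\<bar>) * cos (t * v) \<partial>lborel) / a\<^sup>2"
        by simp
      also have "\<dots> = h a" using True integral_exp_minus_abs_cos[of a t] by (simp add: h_def power2_eq_square)
      finally show ?thesis using True by (simp add: expint2_kernel_def)
    qed (simp add: expint2_kernel_def)
  qed
  also have "\<dots> = integral {1..} h"
    by (rule set_lborel_integral_eq_integral(2)[OF hm habs]) simp
  also have "integral {1..} h = 0 - H 1"
  proof -
    have ftc: "(h has_integral H x - H 1) {1..x}" if "x \<ge> 1" for x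
    proof (rule fundamental_theorem_of_calculus[OF that])
      fix a assume a: "a \<in> {1..x}"
      then have a0: "a > 0" "a\<^sup>2 + t\<^sup>2 > 0" by (auto simp: add_pos_nonneg)
      have "((\<lambda>a. ln (a\<^sup>2) - ln (a\<^sup>2 + t\<^sup>2)) has_real_derivative 2 * a / a\<^sup>2 - 2 * a / (a\<^sup>2 + t\<^sup>2)) (at a within {1..x})"
        using a0 by (auto intro!: derivative_eq_intros)
      from DERIV_cdivide[OF this, of "t\<^sup>2"]
      have "(H has_real_derivative (2 * a / a\<^sup>2 - 2 * a / (a\<^sup>2 + t\<^sup>2)) / t\<^sup>2) (at a within {1..x})"
        unfolding H_def[abs_def] .
      also have "2 * a / a\<^sup>2 - 2 * a / (a\<^sup>2 + t\<^sup>2) = h a * t\<^sup>2"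
      proof -
        have "2 * a / a\<^sup>2 = 2 / a" using a0 by (simp add: power2_eq_square)
        then have "2 * a / a\<^sup>2 - 2 * a / (a\<^sup>2 + t\<^sup>2) = (2 * (a\<^sup>2 + t\<^sup>2) - 2 * a * a) / (a * (a\<^sup>2 + t\<^sup>2))"
          using a0 by (simp add: diff_frac_eq)
        also have "\<dots> = h a * t\<^sup>2" by (simp add: h_def power2_eq_square)
        finally show ?thesis .
      qed
      also have "h a * t\<^sup>2 / t\<^sup>2 = h a" using t2 by simp
      finally show "(H has_vector_derivative h a) (at a within {1..x})"
        by (simp add: has_real_derivative_iff_has_vector_derivative)
    qed
    define u where "u = t\<^sup>2"
    have "u > 0" using t2 by (simp add: u_def)
    then have "((\<lambda>x. (ln (x\<^sup>2) - ln (x\<^sup>2 + u)) / u) \<longlongrightarrow> 0) at_top" by real_asymp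
    then have "((\<lambda>x. H x - H 1) \<longlongrightarrow> 0 - H 1) at_top"
      by (intro tendsto_diff tendsto_const) (simp add: H_def[abs_def] u_def)
    moreover have "\<forall>\<^sub>F x in at_top. H x - H 1 = integral {1..x} h"
      using eventually_ge_at_top[of 1] by eventually_elim (use ftc integral_unique in force)
    ultimately have "((\<lambda>x. integral {1..x} h) \<longlongrightarrow> 0 - H 1) at_top"
      by (rule Lim_transform_eventually)
    then show ?thesis
      by (rule tendsto_unique[OF trivial_limit_at_top_linorder integral_atLeast_tendsto[OF habs]])
  qed
  finally show ?thesis by (simp add: H_def)
qed

text \<open>The substitution b = a v puts the dependence on v into a prefactor and the lower limit,
  so that the singular behaviour at 0 can be split off by subtracting powers of b.\<close>

lemma expint2_eq_scaled:
  assumes "v > 0"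
  shows "expint2 v = v * integral {v..} (\<lambda>b. exp (- b) / b\<^sup>2)"
proof -
  define F where "F b = exp (- b) / b\<^sup>2" for b :: real
  have "F absolutely_integrable_on {v * 1..}"
  proof (rule borel_measurable_dominated_absolutely_integrable)
    show "F \<in> borel_measurable borel" unfolding F_def[abs_def] by measurable
    show "(\<lambda>b. 1 / b ^ 2) integrable_on {v * 1..}" by (rule inverse_power_integrable_on) (use assms in auto)
    show "norm (F b) \<le> 1 / b ^ 2" if "b \<in> {v * 1..}" for b
      using that assms by (auto simp: F_def intro!: divide_right_mono)
  qed auto
  from integral_atLeast_scaled[OF this assms]
  have "(\<lambda>a. v * F (v * a)) absolutely_integrable_on {1..} \<and> integral {1..} (\<lambda>a. v * F (v * a)) = integral {v..} F"
    by simp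
  moreover have "(\<lambda>a. v * F (v * a)) = (\<lambda>a. (1 / v) * (exp (- a * \<bar>v\<bar>) / a\<^sup>2))"
    using assms by (auto simp: F_def power_mult_distrib power2_eq_square mult.commute)
  ultimately have 1: "(\<lambda>a. (1 / v) * (exp (- a * \<bar>v\<bar>) / a\<^sup>2)) absolutely_integrable_on {1..}"
    "integral {1..} (\<lambda>a. (1 / v) * (exp (- a * \<bar>v\<bar>) / a\<^sup>2)) = integral {v..} F" by simp_all
  have "integral {v..} F = (\<integral>a. indicator {1..} a * ((1 / v) * (exp (- a * \<bar>v\<bar>) / a\<^sup>2)) \<partial>lborel)"
    using set_lborel_integral_eq_integral(2)[OF _ 1(1)] 1(2) by simp
  also have "\<dots> = (\<integral>a. (1 / v) * expint2_kernel a v \<partial>lborel)"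
    by (simp add: expint2_kernel_def mult.left_commute)
  also have "\<dots> = (1 / v) * expint2 v" by (simp add: expint2_def)
  finally show ?thesis using assms by (simp add: F_def[abs_def])
qed

text \<open>Removing the singular part 1/b^2 - 1/b from e^(-b)/b^2 leaves the function
  \<open>g\<close>, which lies between 0 and 1 by 1 - b <= e^(-b) <= 1/(1 + b) <= 1 - b + b^2. The
  error is therefore v times the integral of \<open>g\<close> over [0, v], hence at most
  v^2.\<close>

lemma expint2_asymptotics:
  obtains k where "(\<lambda>v. expint2 v - (1 - v * ln (1 / v) + k * v)) \<in> O[at_right 0](\<lambda>v. v powr (3/2))"
proof -
  define F where "F b = exp (- b) / b\<^sup>2" for b :: real
  define g where "g b = (exp (- b) - 1 + b) / b\<^sup>2" for b :: real
  have g: "0 \<le> g b" "g b \<le> 1" if "b \<ge> 0" for b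
  proof -
    have "1 - b \<le> exp (- b)" using exp_ge_add_one_self[of "- b"] by simp
    then show "0 \<le> g b" by (simp add: g_def)
    have "exp (- b) \<le> 1 / (1 + b)"
      using exp_ge_add_one_self[of b] that unfolding exp_minus inverse_eq_divide by (intro divide_left_mono) auto
    also have "\<dots> \<le> 1 - b + b\<^sup>2"
    proof -
      have "1 \<le> (1 - b + b\<^sup>2) * (1 + b)" using that by (simp add: algebra_simps power2_eq_square)
      then show ?thesis using that by (simp add: pos_divide_le_eq)
    qed
    finally show "g b \<le> 1" unfolding g_def by (cases "b = 0") (auto simp: divide_le_eq_1)
  qed
  have gm: "g \<in> borel_measurable borel" unfolding g_def[abs_def] by measurable
  have gi: "g integrable_on {a..b}" if "a \<ge> 0" for a b
    by (rule borel_measurable_dominated_integrable[OF gm, of "\<lambda>_. 1"]) (use g that in \<open>auto simp: abs_of_nonneg\<close>)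
  have Fi: "F integrable_on {c..}" if "c > 0" for c
  proof (rule borel_measurable_dominated_integrable)
    show "F \<in> borel_measurable borel" unfolding F_def[abs_def] by measurable
    show "(\<lambda>a. 1 / a ^ 2) integrable_on {c..}" by (rule inverse_power_integrable_on) (use that in auto)
    show "\<bar>F b\<bar> \<le> 1 / b ^ 2" if "b \<in> {c..}" for b
      using that \<open>c > 0\<close> by (auto simp: F_def intro!: divide_right_mono)
  qed auto
  \<comment> \<open>Everything of order v that remains once 1/b^2 - 1/b is integrated over [v, 1];
    the -1 is the value of its primitive at 1.\<close>
  define k where "k = integral {0..1} g + integral {1..} F - 1"
  show ?thesis
  proof (rule that[of k], rule bigoI)
    have "eventually (\<lambda>v::real. v \<in> {0<..<1}) (at_right 0)" by (intro eventually_at_right_real) auto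
    then show "\<forall>\<^sub>F v in at_right 0. norm (expint2 v - (1 - v * ln (1 / v) + k * v)) \<le> 1 * norm (v powr (3/2))"
    proof eventually_elim
      case (elim v)
      then have v: "0 < v" "v < 1" by auto
      have 1: "integral {v..} F = integral {v..1} F + integral {1..} F"
        using v by (intro integral_halfline_split(2) Fi integrable_on_subinterval[OF Fi[of v]]) auto
      have 2: "integral {0..1} g = integral {0..v} g + integral {v..1} g"
        using v gi by (intro Henstock_Kurzweil_Integration.integral_combine[symmetric]) auto
      have "((\<lambda>b. 1 / b\<^sup>2 - 1 / b) has_integral (- 1 / 1 - ln 1) - (- 1 / v - ln v)) {v..1}"
      proof (rule fundamental_theorem_of_calculus)
        fix b assume "b \<in> {v..1}"
        then show "((\<lambda>b. - 1 / b - ln b) has_vector_derivative 1 / b\<^sup>2 - 1 / b) (at b within {v..1})"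
          using v unfolding has_real_derivative_iff_has_vector_derivative[symmetric]
          by (auto intro!: derivative_eq_intros simp: power2_eq_square)
      qed (use v in auto)
      then have "((\<lambda>b. g b + (1 / b\<^sup>2 - 1 / b)) has_integral integral {v..1} g + ((- 1 / 1 - ln 1) - (- 1 / v - ln v))) {v..1}"
        using v by (intro has_integral_add integrable_integral gi) auto
      then have "(F has_integral integral {v..1} g + ((- 1 / 1 - ln 1) - (- 1 / v - ln v))) {v..1}"
        by (rule has_integral_eq[rotated])
           (use v in \<open>auto simp: g_def F_def power2_eq_square add_divide_distrib diff_divide_distrib\<close>)
      then have 3: "integral {v..1} F = integral {v..1} g + (- 1 + 1 / v + ln v)"
        by (simp add: integral_unique)
      have "expint2 v - (1 - v * ln (1 / v) + k * v) = - v * integral {0..v} g"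
        unfolding expint2_eq_scaled[OF v(1), folded F_def] 1 3 k_def 2 using v
        by (simp add: ln_div algebra_simps)
      moreover have "0 \<le> integral {0..v} g" "integral {0..v} g \<le> v"
      proof -
        show "0 \<le> integral {0..v} g" by (rule Henstock_Kurzweil_Integration.integral_nonneg[OF gi]) (use g in auto)
        have "integral {0..v} g \<le> integral {0..v} (\<lambda>_. 1)" by (rule integral_le[OF gi]) (use g in auto)
        then show "integral {0..v} g \<le> v" using v by simp
      qed
      ultimately have "\<bar>expint2 v - (1 - v * ln (1 / v) + k * v)\<bar> \<le> v * v"
        using v by (simp add: abs_mult)
      also have "v * v = v powr 2" using v by (simp add: powr_numeral power2_eq_square)
      also have "\<dots> \<le> v powr (3/2)" using v by (intro powr_mono') auto
      finally show ?case by simp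
    qed
  qed
qed

section \<open>Matching the autocorrelation with explicit kernels\<close>

lemma zeta_density_comparison:
  obtains \<alpha> \<beta> K and E :: "real \<Rightarrow> real"
  where "integrable lborel E" "\<And>v. v \<noteq> 0 \<Longrightarrow> \<bar>E v\<bar> \<le> K * \<bar>v\<bar> powr (3/2)"
    "\<And>t. t \<noteq> 0 \<Longrightarrow> zeta_density t =
        ln (1 + t\<^sup>2) / t\<^sup>2 / 2 + 2 * \<alpha> / (1 + t\<^sup>2) + 4 * \<beta> / (4 + t\<^sup>2) + (\<integral>v. E v * cos (t * v) \<partial>lborel)"
proof -
  obtain k where k: "(\<lambda>v. expint2 v - (1 - v * ln (1 / v) + k * v)) \<in> O[at_right 0](\<lambda>v. v powr (3/2))"
    by (rule expint2_asymptotics)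
  \<comment> \<open>The factor 1/2 in front of \<open>expint2\<close> already matches the
    logarithmic terms. The constant terms require 1/2 + \<alpha> + \<beta> =
    \<open>saw_square\<close>, the linear terms 2 \<alpha> + 4 \<beta> - k =
    \<open>saw_const\<close>. Two exponentials with different rates make this system
    solvable.\<close>
  define \<beta> where "\<beta> = (k + saw_const) / 2 - (saw_square - 1/2)"
  define \<alpha> where "\<alpha> = saw_square - 1/2 - \<beta>"
  define A where "A v = expint2 v / 2 + \<alpha> * exp (- 1 * \<bar>v\<bar>) + \<beta> * exp (- 2 * \<bar>v\<bar>)" for v
  define E where "E v = saw_autocorr v - A v" for v
  have iA: "integrable lborel A"
    unfolding A_def[abs_def]
    by (intro Bochner_Integration.integrable_add integrable_mult_right integrable_divide integrable_expint2 integrable_exp_minus_abs) auto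
  then have iE: "integrable lborel E"
    unfolding E_def[abs_def] using integrable_saw_autocorr by simp
  have Eb: "\<bar>E v\<bar> \<le> (\<integral>u. saw_exp u \<partial>lborel) + expint2 0 + \<bar>\<alpha>\<bar> + \<bar>\<beta>\<bar>" for v
  proof -
    have "\<bar>\<alpha> * exp (- 1 * \<bar>v\<bar>)\<bar> \<le> \<bar>\<alpha>\<bar>" "\<bar>\<beta> * exp (- 2 * \<bar>v\<bar>)\<bar> \<le> \<bar>\<beta>\<bar>"
      by (auto simp: abs_mult intro!: mult_left_le)
    then show ?thesis
      unfolding E_def A_def using saw_autocorr_nonneg[of v] saw_autocorr_le[of v] expint2_nonneg[of v] expint2_le[of v]
      by linarith
  qed
  \<comment> \<open>The expansions are one-sided at 0; evenness carries the bound over to negative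
    v.\<close>
  have Em: "E (- v) = E v" for v
    by (simp add: E_def A_def saw_autocorr_minus expint2_def expint2_kernel_def)
  define P where "P v = saw_autocorr v - (saw_square - v * (ln (1 / v) + saw_const) / 2)" for v
  define Q where "Q v = (1/2) * (expint2 v - (1 - v * ln (1 / v) + k * v))" for v
  define R where "R v = \<alpha> * (exp (- 1 * v) - 1 + v)" for v
  define S where "S v = \<beta> * (exp (- 2 * v) - 1 + 2 * v)" for v
  have P: "P \<in> O[at_right 0](\<lambda>v. v powr (3/2))"
    unfolding P_def[abs_def] by (rule saw_autocorr_asymptotics)
  have Q: "Q \<in> O[at_right 0](\<lambda>v. v powr (3/2))"
    unfolding Q_def[abs_def] using k by simp
  have "(\<lambda>v::real. exp (- 1 * v) - 1 + v) \<in> O[at_right 0](\<lambda>v. v powr (3/2))" by real_asymp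
  then have R: "R \<in> O[at_right 0](\<lambda>v. v powr (3/2))"
    unfolding R_def[abs_def] by (cases "\<alpha> = 0") auto
  have "(\<lambda>v::real. exp (- 2 * v) - 1 + 2 * v) \<in> O[at_right 0](\<lambda>v. v powr (3/2))" by real_asymp
  then have S: "S \<in> O[at_right 0](\<lambda>v. v powr (3/2))"
    unfolding S_def[abs_def] by (cases "\<beta> = 0") auto
  have "(\<lambda>v. P v - Q v - R v - S v) \<in> O[at_right 0](\<lambda>v. v powr (3/2))"
    by (rule sum_in_bigo(2)[OF sum_in_bigo(2)[OF sum_in_bigo(2)[OF P Q] R] S])
  moreover have "\<forall>\<^sub>F v in at_right 0. P v - Q v - R v - S v = E v"
    using eventually_at_right_less[of 0]
  proof eventually_elim
    case (elim v)
    have 1: "E v = saw_autocorr v - expint2 v / 2 - \<alpha> * exp (- 1 * v) - \<beta> * exp (- 2 * v)"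
      using elim by (simp add: E_def A_def)
    have 2: "saw_square = \<alpha> + \<beta> + 1/2" by (simp add: \<alpha>_def)
    have 3: "saw_const = 2 * \<alpha> + 4 * \<beta> - k" by (simp add: \<alpha>_def \<beta>_def field_simps)
    show ?case unfolding P_def Q_def R_def S_def 1 2 3 by (simp add: field_simps)
  qed
  then have "(\<lambda>v. P v - Q v - R v - S v) \<in> O[at_right 0](\<lambda>v. v powr (3/2)) \<longleftrightarrow> E \<in> O[at_right 0](\<lambda>v. v powr (3/2))"
    by (rule landau_o.big.in_cong)
  ultimately have "E \<in> O[at_right 0](\<lambda>v. v powr (3/2))" by blast
  then obtain c where c: "c > 0" "\<forall>\<^sub>F v in at_right 0. norm (E v) \<le> c * norm (v powr (3/2))"
    by (rule landau_o.bigE)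
  then obtain r where r: "r > 0" "\<And>v. 0 < v \<Longrightarrow> v < r \<Longrightarrow> \<bar>E v\<bar> \<le> c * v powr (3/2)"
    unfolding eventually_at_right_field by auto
  define B where "B = (\<integral>u. saw_exp u \<partial>lborel) + expint2 0 + \<bar>\<alpha>\<bar> + \<bar>\<beta>\<bar>"
  \<comment> \<open>The Landau bound reaches only up to r. Beyond r the function is bounded by B,
    and B <= B (v / r)^(3/2) there, so a single constant serves all v.\<close>
  define K where "K = c + B / r powr (3/2)"
  have B0: "B \<ge> 0" using Eb[of 0] by (simp add: B_def)
  have EK: "\<bar>E v\<bar> \<le> K * v powr (3/2)" if "v > 0" for v
  proof (cases "v < r")
    case True
    then have "\<bar>E v\<bar> \<le> c * v powr (3/2)" using r that by auto
    also have "\<dots> \<le> K * v powr (3/2)" unfolding K_def using B0 by (intro mult_right_mono) auto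
    finally show ?thesis .
  next
    case False
    have "\<bar>E v\<bar> \<le> B" using Eb[of v] by (simp add: B_def)
    also have "\<dots> = B / r powr (3/2) * r powr (3/2)" using r by simp
    also have "\<dots> \<le> K * v powr (3/2)"
      using False r c B0 unfolding K_def by (intro mult_mono powr_mono2) auto
    finally show ?thesis .
  qed
  show ?thesis
  proof (rule that[OF iE])
    show "\<bar>E v\<bar> \<le> K * \<bar>v\<bar> powr (3/2)" if "v \<noteq> 0" for v
      using EK[of v] EK[of "- v"] Em[of v] that by (cases "v > 0") auto
    fix t :: real assume t: "t \<noteq> 0"
    note ic = integrable_mult_cos[of _ t]
    have "zeta_density t = (\<integral>v. expint2 v * cos (t * v) / 2 + \<alpha> * (exp (- 1 * \<bar>v\<bar>) * cos (t * v))
        + \<beta> * (exp (- 2 * \<bar>v\<bar>) * cos (t * v)) + E v * cos (t * v) \<partial>lborel)"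
      unfolding zeta_density_def by (rule Bochner_Integration.integral_cong[OF refl]) (simp add: E_def A_def algebra_simps)
    also have "\<dots> = (\<integral>v. expint2 v * cos (t * v) \<partial>lborel) / 2 + \<alpha> * (\<integral>v. exp (- 1 * \<bar>v\<bar>) * cos (t * v) \<partial>lborel)
        + \<beta> * (\<integral>v. exp (- 2 * \<bar>v\<bar>) * cos (t * v) \<partial>lborel) + (\<integral>v. E v * cos (t * v) \<partial>lborel)"
      using ic[OF integrable_expint2] ic[OF integrable_exp_minus_abs[of 1]] ic[OF integrable_exp_minus_abs[of 2]] ic[OF iE]
      by simp
    also have "\<dots> = ln (1 + t\<^sup>2) / t\<^sup>2 / 2 + 2 * \<alpha> / (1 + t\<^sup>2) + 4 * \<beta> / (4 + t\<^sup>2) + (\<integral>v. E v * cos (t * v) \<partial>lborel)"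
      using integral_exp_minus_abs_cos[of 1 t] integral_exp_minus_abs_cos[of 2 t] integral_expint2_cos[OF t] by (simp add: mult.commute)
    finally show "zeta_density t = ln (1 + t\<^sup>2) / t\<^sup>2 / 2 + 2 * \<alpha> / (1 + t\<^sup>2) + 4 * \<beta> / (4 + t\<^sup>2) + (\<integral>v. E v * cos (t * v) \<partial>lborel)" .
  qed
qed

section \<open>The mean square on the critical line\<close>

text \<open>The cubic Hermite step, with vanishing slope at T and at T + D. It is not continued by 0
  beyond T + D; all integrals against it stop there.\<close>

definition smooth_step :: "real \<Rightarrow> real \<Rightarrow> real \<Rightarrow> real" where
  "smooth_step T D t = (if t \<le> T then 1 else (1 - (t - T) / D)\<^sup>2 * (1 + 2 * ((t - T) / D)))"

lemma smooth_step_bounds: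
  assumes "D > 0" "t \<le> T + D"
  shows "0 \<le> smooth_step T D t" "smooth_step T D t \<le> 1"
proof -
  define r where "r = (t - T) / D"
  have "0 \<le> smooth_step T D t \<and> smooth_step T D t \<le> 1"
  proof (cases "t \<le> T")
    case False
    then have r: "0 \<le> r" "r \<le> 1" using assms by (auto simp: r_def field_simps)
    have "(1 - r)\<^sup>2 * (1 + 2 * r) = 1 - r\<^sup>2 * (3 - 2 * r)" by (simp add: power2_eq_square algebra_simps)
    moreover have "0 \<le> r\<^sup>2 * (3 - 2 * r)" "0 \<le> (1 - r)\<^sup>2 * (1 + 2 * r)"
      using r by (intro mult_nonneg_nonneg; simp)+
    moreover have "smooth_step T D t = (1 - r)\<^sup>2 * (1 + 2 * r)" using False by (simp add: smooth_step_def r_def)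
    ultimately show ?thesis by linarith
  qed (simp add: smooth_step_def)
  then show "0 \<le> smooth_step T D t" "smooth_step T D t \<le> 1" by auto
qed

lemma borel_measurable_smooth_step [measurable]: "smooth_step T D \<in> borel_measurable borel"
  unfolding smooth_step_def[abs_def] by measurable

text \<open>First- and third-order integration by parts. Both are kept as exact integrals, with the
  boundary terms explicit, so that those of adjacent intervals can cancel before anything is
  estimated.\<close>

lemma cos_transform_by_parts:
  fixes g g1 g2 g3 :: "real \<Rightarrow> real"
  assumes "a \<le> b" "v \<noteq> 0"
    and "\<And>t. t \<in> {a..b} \<Longrightarrow> (g has_real_derivative g1 t) (at t within {a..b})"
    and "\<And>t. t \<in> {a..b} \<Longrightarrow> (g1 has_real_derivative g2 t) (at t within {a..b})"
    and "\<And>t. t \<in> {a..b} \<Longrightarrow> (g2 has_real_derivative g3 t) (at t within {a..b})"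
  shows "((\<lambda>t. g t * cos (t * v) + g1 t * sin (t * v) / v) has_integral
           (g b * sin (b * v) / v) - (g a * sin (a * v) / v)) {a..b}"
    and "((\<lambda>t. g t * cos (t * v) - g3 t * sin (t * v) / v ^ 3) has_integral
           (g b * sin (b * v) / v + g1 b * cos (b * v) / v\<^sup>2 - g2 b * sin (b * v) / v ^ 3)
         - (g a * sin (a * v) / v + g1 a * cos (a * v) / v\<^sup>2 - g2 a * sin (a * v) / v ^ 3)) {a..b}"
proof -
  have s: "((\<lambda>t. sin (t * v)) has_real_derivative cos (t * v) * v) (at t within {a..b})" for t
    by (auto intro!: derivative_eq_intros)
  have c: "((\<lambda>t. cos (t * v)) has_real_derivative - sin (t * v) * v) (at t within {a..b})" for t
    by (auto intro!: derivative_eq_intros)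
  show "((\<lambda>t. g t * cos (t * v) + g1 t * sin (t * v) / v) has_integral
           (g b * sin (b * v) / v) - (g a * sin (a * v) / v)) {a..b}"
  proof (rule fundamental_theorem_of_calculus[OF assms(1)])
    fix t assume t: "t \<in> {a..b}"
    have "((\<lambda>t. g t * sin (t * v) / v) has_real_derivative (g1 t * sin (t * v) + cos (t * v) * v * g t) / v) (at t within {a..b})"
      by (rule DERIV_cdivide[OF DERIV_mult[OF assms(3)[OF t] s]])
    then show "((\<lambda>t. g t * sin (t * v) / v) has_vector_derivative g t * cos (t * v) + g1 t * sin (t * v) / v) (at t within {a..b})"
      unfolding has_real_derivative_iff_has_vector_derivative[symmetric]
      by (rule DERIV_cong) (use assms(2) in \<open>simp add: add_divide_distrib\<close>)
  qed
  show "((\<lambda>t. g t * cos (t * v) - g3 t * sin (t * v) / v ^ 3) has_integral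
           (g b * sin (b * v) / v + g1 b * cos (b * v) / v\<^sup>2 - g2 b * sin (b * v) / v ^ 3)
         - (g a * sin (a * v) / v + g1 a * cos (a * v) / v\<^sup>2 - g2 a * sin (a * v) / v ^ 3)) {a..b}"
  proof (rule fundamental_theorem_of_calculus[OF assms(1)])
    fix t assume t: "t \<in> {a..b}"
    have "((\<lambda>t. g t * sin (t * v) / v + g1 t * cos (t * v) / v\<^sup>2 - g2 t * sin (t * v) / v ^ 3) has_real_derivative
       (g1 t * sin (t * v) + cos (t * v) * v * g t) / v + (g2 t * cos (t * v) + - sin (t * v) * v * g1 t) / v\<^sup>2
        - (g3 t * sin (t * v) + cos (t * v) * v * g2 t) / v ^ 3) (at t within {a..b})"
      by (intro DERIV_diff DERIV_add DERIV_cdivide DERIV_mult assms(3-5) t s c)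
    then show "((\<lambda>t. g t * sin (t * v) / v + g1 t * cos (t * v) / v\<^sup>2 - g2 t * sin (t * v) / v ^ 3) has_vector_derivative
       g t * cos (t * v) - g3 t * sin (t * v) / v ^ 3) (at t within {a..b})"
      unfolding has_real_derivative_iff_has_vector_derivative[symmetric]
      by (rule DERIV_cong) (use assms(2) in \<open>simp add: field_simps power2_eq_square power3_eq_cube\<close>)
  qed
qed

definition smooth_weight :: "real \<Rightarrow> real \<Rightarrow> real \<Rightarrow> real" where
  "smooth_weight T D t = (1/4 + t\<^sup>2) * smooth_step T D t"

lemma smooth_weight_integrable_cos:
  assumes "0 \<le> T" "0 < D"
  shows "(\<lambda>t. smooth_weight T D t * cos (t * v)) integrable_on {0..T + D}"
proof (rule borel_measurable_dominated_integrable[of _ "\<lambda>_. 1/4 + (T + D)\<^sup>2"])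
  show "(\<lambda>t. smooth_weight T D t * cos (t * v)) \<in> borel_measurable borel"
    unfolding smooth_weight_def[abs_def] by measurable
  fix t assume t: "t \<in> {0..T + D}"
  have "\<bar>smooth_weight T D t * cos (t * v)\<bar> = (1/4 + t\<^sup>2) * smooth_step T D t * \<bar>cos (t * v)\<bar>"
    using smooth_step_bounds[of D t T] assms t unfolding smooth_weight_def abs_mult by (simp add: add_pos_nonneg)
  also have "\<dots> \<le> (1/4 + (T + D)\<^sup>2) * 1 * 1"
    using smooth_step_bounds[of D t T] assms t
    by (intro mult_mono add_mono power_mono mult_nonneg_nonneg add_nonneg_nonneg) auto
  finally show "\<bar>smooth_weight T D t * cos (t * v)\<bar> \<le> 1/4 + (T + D)\<^sup>2" by simp
qed auto

text \<open>Third-order integration by parts. The boundary terms of order \<open>1/v\<close> and \<open>1/v\<^sup>2\<close> cancel at \<open>T\<close> since the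
  weight is continuously differentiable.\<close>

lemma smooth_weight_cos_transform:
  assumes T: "1 \<le> T" and D: "1 \<le> D" "D \<le> T" and v: "v > 0"
  shows "\<bar>integral {0..T + D} (\<lambda>t. smooth_weight T D t * cos (t * v))\<bar> \<le> 16 * T\<^sup>2 / v"
    and "\<bar>integral {0..T + D} (\<lambda>t. smooth_weight T D t * cos (t * v))\<bar> \<le> 250 * T\<^sup>2 / (D\<^sup>2 * v ^ 3)" (is ?th2)
proof -
  define b where "b = T + D"
  define r where "r t = (t - T) / D" for t
  define h where "h t = (1 - r t)\<^sup>2 * (1 + 2 * r t)" for t
  define h1 where "h1 t = - 6 * (r t * (1 - r t)) / D" for t
  define h2 where "h2 t = (12 * r t - 6) / D\<^sup>2" for t
  define h3 where "h3 t = 12 / D ^ 3" for t :: real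
  define g where "g t = (1/4 + t\<^sup>2) * h t" for t
  define g1 where "g1 t = 2 * t * h t + (1/4 + t\<^sup>2) * h1 t" for t
  define g2 where "g2 t = 2 * h t + 4 * t * h1 t + (1/4 + t\<^sup>2) * h2 t" for t
  define g3 where "g3 t = 6 * h1 t + 6 * t * h2 t + (1/4 + t\<^sup>2) * h3 t" for t
  have D0: "D > 0" using D by simp
  have r': "(r has_real_derivative 1 / D) (at t within S)" for t S
    unfolding r_def[abs_def] using D0 by (auto intro!: derivative_eq_intros)
  have h': "(h has_real_derivative h1 t) (at t within S)" for t S
    unfolding h_def[abs_def]
    by (rule DERIV_cong[OF DERIV_mult[OF DERIV_power[OF DERIV_diff[OF DERIV_const r']] DERIV_add[OF DERIV_const DERIV_cmult[OF r']]]])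
       (simp add: h1_def algebra_simps power2_eq_square add_divide_distrib diff_divide_distrib)
  have h1': "(h1 has_real_derivative h2 t) (at t within S)" for t S
    unfolding h1_def[abs_def]
    by (rule DERIV_cong[OF DERIV_cdivide[OF DERIV_cmult[OF DERIV_mult[OF r' DERIV_diff[OF DERIV_const r']]]]])
       (use D0 in \<open>simp add: h2_def field_simps power2_eq_square\<close>)
  have h2': "(h2 has_real_derivative h3 t) (at t within S)" for t S
    unfolding h2_def[abs_def]
    by (rule DERIV_cong[OF DERIV_cdivide[OF DERIV_diff[OF DERIV_cmult[OF r'] DERIV_const]]])
       (use D0 in \<open>simp add: h3_def power2_eq_square power3_eq_cube\<close>)
  have q': "((\<lambda>t. 1/4 + t\<^sup>2) has_real_derivative 2 * t) (at t within S)" for t :: real and S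
    by (auto intro!: derivative_eq_intros)
  have g': "(g has_real_derivative g1 t) (at t within S)" for t S
    unfolding g_def[abs_def]
    by (rule DERIV_cong[OF DERIV_mult[OF q' h']]) (simp add: g1_def)
  have g1': "(g1 has_real_derivative g2 t) (at t within S)" for t S
    unfolding g1_def[abs_def]
    by (rule DERIV_cong[OF DERIV_add[OF DERIV_mult[OF DERIV_cmult[OF DERIV_ident] h'] DERIV_mult[OF q' h1']]]) (simp add: g2_def)
  have g2': "(g2 has_real_derivative g3 t) (at t within S)" for t S
    unfolding g2_def[abs_def]
    by (rule DERIV_cong[OF DERIV_add[OF DERIV_add[OF DERIV_cmult[OF h'] DERIV_mult[OF DERIV_cmult[OF DERIV_ident] h1']] DERIV_mult[OF q' h2']]])
       (simp add: g3_def)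
  have q1': "((\<lambda>t. 2 * t) has_real_derivative 2) (at t within S)" for t :: real and S
    by (auto intro!: derivative_eq_intros)
  have q2': "((\<lambda>t. 2) has_real_derivative 0) (at t within S)" for t :: real and S
    by (auto intro!: derivative_eq_intros)
  have rT: "r T = 0" "r b = 1" using D0 by (auto simp: r_def b_def)
  \<comment> \<open>At T the polynomial piece has the value and slope of 1/4 + t^2, and at b both
    vanish. Only second derivatives jump, and these carry the factor 1/v^3.\<close>
  have end_values: "g T = 1/4 + T\<^sup>2" "g1 T = 2 * T" "g b = 0" "g1 b = 0"
    by (simp_all add: g_def g1_def h_def h1_def rT)
  have eq1: "smooth_weight T D t = 1/4 + t\<^sup>2" if "t \<le> T" for t
    using that by (simp add: smooth_weight_def smooth_step_def)
  have eq2: "smooth_weight T D t = g t" if "t \<ge> T" for t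
    using that by (cases "t = T") (auto simp: smooth_weight_def smooth_step_def g_def h_def r_def)
  define J1 where "J1 = integral {0..T} (\<lambda>t. smooth_weight T D t * cos (t * v))"
  define J2 where "J2 = integral {T..b} (\<lambda>t. smooth_weight T D t * cos (t * v))"
  have J: "integral {0..T + D} (\<lambda>t. smooth_weight T D t * cos (t * v)) = J1 + J2"
    unfolding J1_def J2_def b_def using smooth_weight_integrable_cos[of T D v] T D
    by (intro Henstock_Kurzweil_Integration.integral_combine[symmetric]) auto
  have i1: "(\<lambda>t. smooth_weight T D t * cos (t * v)) integrable_on {0..T}"
    and i2: "(\<lambda>t. smooth_weight T D t * cos (t * v)) integrable_on {T..b}"
    using smooth_weight_integrable_cos[of T D v] T D integrable_on_subinterval
    by (auto simp: b_def intro!: integrable_on_subinterval[OF smooth_weight_integrable_cos[of T D v]])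
  have J1: "((\<lambda>t. (1/4 + t\<^sup>2) * cos (t * v)) has_integral J1) {0..T}"
    unfolding J1_def by (rule has_integral_eq[OF _ integrable_integral[OF i1]]) (auto simp: eq1)
  have J2: "((\<lambda>t. g t * cos (t * v)) has_integral J2) {T..b}"
    unfolding J2_def by (rule has_integral_eq[OF _ integrable_integral[OF i2]]) (auto simp: eq2)
  have v0: "v \<noteq> 0" using v by simp
  have Tb: "T \<le> b" "0 \<le> T" using T D by (auto simp: b_def)
  note A = cos_transform_by_parts[OF Tb(2) v0 q' q1' q2']
  note B = cos_transform_by_parts[OF Tb(1) v0 g' g1' g2']
  have hb: "\<bar>h t\<bar> \<le> 1" "\<bar>h1 t\<bar> \<le> 2 / D" "\<bar>h2 t\<bar> \<le> 6 / D\<^sup>2" "\<bar>t\<bar> \<le> 2 * T" "\<bar>1/4 + t\<^sup>2\<bar> \<le> 5 * T\<^sup>2"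
    if "t \<in> {T..b}" for t
  proof -
    have rt: "0 \<le> r t" "r t \<le> 1" using that D0 by (auto simp: r_def b_def field_simps)
    have "(1 - r t)\<^sup>2 * (1 + 2 * r t) = 1 - (r t)\<^sup>2 * (3 - 2 * r t)" by (simp add: power2_eq_square algebra_simps)
    moreover have "0 \<le> (r t)\<^sup>2 * (3 - 2 * r t)" using rt by (intro mult_nonneg_nonneg) auto
    moreover have "0 \<le> (1 - r t)\<^sup>2 * (1 + 2 * r t)" using rt by (intro mult_nonneg_nonneg) auto
    ultimately show "\<bar>h t\<bar> \<le> 1" by (simp add: h_def)
    have "0 \<le> (2 * r t - 1)\<^sup>2" by simp
    then have "r t * (1 - r t) \<le> 1/4" by (simp add: power2_eq_square algebra_simps)
    moreover have "0 \<le> r t * (1 - r t)" using rt by simp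
    ultimately have "\<bar>- 6 * (r t * (1 - r t))\<bar> \<le> 2" by linarith
    then show "\<bar>h1 t\<bar> \<le> 2 / D" unfolding h1_def using D0 by (simp only: abs_divide) (simp add: divide_right_mono)
    have "\<bar>12 * r t - 6\<bar> \<le> 6" using rt by linarith
    then show "\<bar>h2 t\<bar> \<le> 6 / D\<^sup>2" unfolding h2_def abs_divide using D0 by (simp add: divide_right_mono)
    show t2: "\<bar>t\<bar> \<le> 2 * T" using that T D by (auto simp: b_def)
    have "\<bar>t\<bar>\<^sup>2 \<le> (2 * T)\<^sup>2" using t2 by (intro power_mono) auto
    then have "t\<^sup>2 \<le> 4 * T\<^sup>2" by (simp add: power_mult_distrib)
    moreover have "1 \<le> T\<^sup>2" using T by simp
    ultimately show "\<bar>1/4 + t\<^sup>2\<bar> \<le> 5 * T\<^sup>2" by (simp add: abs_of_nonneg)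
  qed
  \<comment> \<open>D <= T gives Q >= 1, so every lower-order term in the derivative bounds can be
    absorbed into Q^2.\<close>
  define Q where "Q = T / D"
  have Q: "1 \<le> Q" using D D0 by (simp add: Q_def)
  then have Q2: "Q \<le> Q\<^sup>2" "1 \<le> Q\<^sup>2" by (simp_all add: self_le_power one_le_power)
  have TQ: "T = Q * D" using D0 by (simp add: Q_def)
  have g1b: "\<bar>g1 t\<bar> \<le> 14 * Q\<^sup>2 * D" if "t \<in> {T..b}" for t
  proof -
    have "\<bar>g1 t\<bar> \<le> 2 * \<bar>t\<bar> * \<bar>h t\<bar> + \<bar>1/4 + t\<^sup>2\<bar> * \<bar>h1 t\<bar>"
      unfolding g1_def using abs_triangle_ineq[of "2 * t * h t" "(1/4 + t\<^sup>2) * h1 t"] by (simp add: abs_mult)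
    also have "\<dots> \<le> 2 * (2 * T) * 1 + (5 * T\<^sup>2) * (2 / D)"
      using hb[OF that] D0 T by (intro add_mono mult_mono mult_nonneg_nonneg) auto
    also have "\<dots> = 4 * Q * D + 10 * Q\<^sup>2 * D" using D0 by (simp add: TQ power2_eq_square)
    also have "\<dots> \<le> 4 * Q\<^sup>2 * D + 10 * Q\<^sup>2 * D" using Q2 D0 by (intro add_mono mult_right_mono mult_left_mono) auto
    finally show ?thesis by (simp add: mult_ac)
  qed
  have g2b: "\<bar>g2 t\<bar> \<le> 48 * Q\<^sup>2" if "t \<in> {T..b}" for t
  proof -
    have "\<bar>g2 t\<bar> \<le> 2 * \<bar>h t\<bar> + 4 * \<bar>t\<bar> * \<bar>h1 t\<bar> + \<bar>1/4 + t\<^sup>2\<bar> * \<bar>h2 t\<bar>"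
    proof -
      have "\<bar>x + y + z\<bar> \<le> \<bar>x\<bar> + \<bar>y\<bar> + \<bar>z\<bar>" for x y z :: real by linarith
      from this[of "2 * h t" "4 * t * h1 t" "(1/4 + t\<^sup>2) * h2 t"] show ?thesis by (simp add: g2_def abs_mult)
    qed
    also have "\<dots> \<le> 2 * 1 + 4 * (2 * T) * (2 / D) + (5 * T\<^sup>2) * (6 / D\<^sup>2)"
      using hb[OF that] D0 T by (intro add_mono mult_mono mult_nonneg_nonneg) auto
    also have "\<dots> = 2 + 16 * Q + 30 * Q\<^sup>2" using D0 by (simp add: TQ power2_eq_square)
    also have "\<dots> \<le> 48 * Q\<^sup>2" using Q2 by linarith
    finally show ?thesis .
  qed
  have g3b: "\<bar>g3 t\<bar> \<le> 144 * Q\<^sup>2 / D" if "t \<in> {T..b}" for t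
  proof -
    have "\<bar>g3 t\<bar> \<le> 6 * \<bar>h1 t\<bar> + 6 * \<bar>t\<bar> * \<bar>h2 t\<bar> + \<bar>1/4 + t\<^sup>2\<bar> * \<bar>h3 t\<bar>"
    proof -
      have "\<bar>x + y + z\<bar> \<le> \<bar>x\<bar> + \<bar>y\<bar> + \<bar>z\<bar>" for x y z :: real by linarith
      from this[of "6 * h1 t" "6 * t * h2 t" "(1/4 + t\<^sup>2) * h3 t"] show ?thesis by (simp add: g3_def abs_mult)
    qed
    also have "\<dots> \<le> 6 * (2 / D) + 6 * (2 * T) * (6 / D\<^sup>2) + (5 * T\<^sup>2) * (12 / D ^ 3)"
      using hb[OF that] D0 T by (intro add_mono mult_mono mult_nonneg_nonneg) (auto simp: h3_def)
    also have "\<dots> = (12 + 72 * Q + 60 * Q\<^sup>2) / D" using D0 by (simp add: TQ field_simps power2_eq_square power3_eq_cube)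
    also have "\<dots> \<le> (144 * Q\<^sup>2) / D" using Q2 D0 by (intro divide_right_mono) auto
    finally show ?thesis .
  qed
  have int1: "((\<lambda>t. 2 * t * sin (t * v) / v) has_integral (1/4 + T\<^sup>2) * sin (T * v) / v - J1) {0..T}"
    using has_integral_diff[OF A(1) J1] by simp
  have "norm ((1/4 + T\<^sup>2) * sin (T * v) / v - J1) \<le> (2 * T / v) * measure lborel (cbox 0 T)"
  proof (rule has_integral_bound[OF _ int1[unfolded cbox_interval[symmetric]]])
    fix t assume t: "t \<in> cbox 0 T"
    have "2 * t * \<bar>sin (t * v)\<bar> \<le> 2 * T * 1" using t by (intro mult_mono) auto
    then show "norm (2 * t * sin (t * v) / v) \<le> 2 * T / v"
      using t v by (simp add: abs_mult divide_right_mono)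
  qed (use T v in auto)
  then have b1: "\<bar>(1/4 + T\<^sup>2) * sin (T * v) / v - J1\<bar> \<le> 2 * T\<^sup>2 / v" using T by (simp add: power2_eq_square)
  have int2: "((\<lambda>t. g1 t * sin (t * v) / v) has_integral - ((1/4 + T\<^sup>2) * sin (T * v) / v) - J2) {T..b}"
    using has_integral_diff[OF B(1) J2] by (simp add: end_values)
  have "norm (- ((1/4 + T\<^sup>2) * sin (T * v) / v) - J2) \<le> (14 * Q\<^sup>2 * D / v) * measure lborel (cbox T b)"
  proof (rule has_integral_bound[OF _ int2[unfolded cbox_interval[symmetric]]])
    fix t assume t: "t \<in> cbox T b"
    have "\<bar>g1 t\<bar> * \<bar>sin (t * v)\<bar> \<le> 14 * Q\<^sup>2 * D * 1" using t g1b[of t] D0 by (intro mult_mono) auto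
    then show "norm (g1 t * sin (t * v) / v) \<le> 14 * Q\<^sup>2 * D / v"
      using v by (simp add: abs_mult divide_right_mono)
  qed (use D0 v in auto)
  then have b2: "\<bar>- ((1/4 + T\<^sup>2) * sin (T * v) / v) - J2\<bar> \<le> 14 * T\<^sup>2 / v"
    using D0 by (simp add: TQ power2_eq_square b_def mult_ac)
  \<comment> \<open>The boundary term c at T enters the two pieces with opposite signs, and adding
    the pieces removes it.\<close>
  have "\<bar>x + y\<bar> \<le> p + q" if "\<bar>c - x\<bar> \<le> p" "\<bar>- c - y\<bar> \<le> q" for c x y p q :: real
    using that by linarith
  from this[OF b1 b2] have "\<bar>J1 + J2\<bar> \<le> 2 * T\<^sup>2 / v + 14 * T\<^sup>2 / v" .
  then show "\<bar>integral {0..T + D} (\<lambda>t. smooth_weight T D t * cos (t * v))\<bar> \<le> 16 * T\<^sup>2 / v"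
    unfolding J by (simp add: add_divide_distrib[symmetric])
  have "((\<lambda>t. (1/4 + t\<^sup>2) * cos (t * v)) has_integral
     ((1/4 + T\<^sup>2) * sin (T * v) / v + 2 * T * cos (T * v) / v\<^sup>2 - 2 * sin (T * v) / v ^ 3)) {0..T}"
    using A(2) by simp
  then have J1v: "J1 = (1/4 + T\<^sup>2) * sin (T * v) / v + 2 * T * cos (T * v) / v\<^sup>2 - 2 * sin (T * v) / v ^ 3"
    using J1 has_integral_unique by blast
  define B2 where "B2 = - (g2 b * sin (b * v) / v ^ 3) - ((1/4 + T\<^sup>2) * sin (T * v) / v + 2 * T * cos (T * v) / v\<^sup>2 - g2 T * sin (T * v) / v ^ 3)"
  have int3: "((\<lambda>t. g3 t * sin (t * v) / v ^ 3) has_integral J2 - B2) {T..b}"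
    using has_integral_diff[OF J2 B(2)] by (simp add: end_values B2_def)
  have "norm (J2 - B2) \<le> (144 * Q\<^sup>2 / D / v ^ 3) * measure lborel (cbox T b)"
  proof (rule has_integral_bound[OF _ int3[unfolded cbox_interval[symmetric]]])
    fix t assume t: "t \<in> cbox T b"
    have "\<bar>g3 t\<bar> * \<bar>sin (t * v)\<bar> \<le> 144 * Q\<^sup>2 / D * 1" using t g3b[of t] D0 by (intro mult_mono) auto
    then have "\<bar>g3 t\<bar> * \<bar>sin (t * v)\<bar> / v ^ 3 \<le> 144 * Q\<^sup>2 / D * 1 / v ^ 3"
      using v by (intro divide_right_mono) auto
    then show "norm (g3 t * sin (t * v) / v ^ 3) \<le> 144 * Q\<^sup>2 / D / v ^ 3"
      using v by (simp add: abs_mult)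
  qed (use D0 v in auto)
  then have b3: "\<bar>J2 - B2\<bar> \<le> 144 * Q\<^sup>2 / v ^ 3"
    using D0 by (simp add: b_def)
  have s: "\<bar>c * sin x / v ^ 3\<bar> \<le> C / v ^ 3" if "\<bar>c\<bar> \<le> C" for c C x
  proof -
    have "\<bar>c * sin x\<bar> \<le> C * 1" unfolding abs_mult using that by (intro mult_mono) auto
    then show ?thesis using v by (simp add: divide_right_mono)
  qed
  have "J1 + J2 = (J2 - B2) - 2 * sin (T * v) / v ^ 3 - g2 b * sin (b * v) / v ^ 3 + g2 T * sin (T * v) / v ^ 3"
    unfolding J1v B2_def by simp
  moreover have "\<bar>2 * sin (T * v) / v ^ 3\<bar> \<le> 2 * Q\<^sup>2 / v ^ 3" by (rule s) (use Q2 in auto)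
  moreover have "\<bar>g2 b * sin (b * v) / v ^ 3\<bar> \<le> 48 * Q\<^sup>2 / v ^ 3" by (rule s, rule g2b) (use Tb in auto)
  moreover have "\<bar>g2 T * sin (T * v) / v ^ 3\<bar> \<le> 48 * Q\<^sup>2 / v ^ 3" by (rule s, rule g2b) (use Tb in auto)
  ultimately have "\<bar>J1 + J2\<bar> \<le> 144 * Q\<^sup>2 / v ^ 3 + 2 * Q\<^sup>2 / v ^ 3 + 48 * Q\<^sup>2 / v ^ 3 + 48 * Q\<^sup>2 / v ^ 3"
    using b3 by linarith
  also have "\<dots> = 242 * Q\<^sup>2 / v ^ 3" by (simp add: add_divide_distrib[symmetric])
  also have "\<dots> \<le> 250 * Q\<^sup>2 / v ^ 3" using v by (intro divide_right_mono) auto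
  also have "\<dots> = 250 * T\<^sup>2 / (D\<^sup>2 * v ^ 3)" by (simp add: Q_def power_divide)
  finally show ?th2 unfolding J .
qed

section \<open>Contribution of the remainder density\<close>

definition decay_const :: real where
  "decay_const = (\<integral>x. \<bar>x\<bar> powr (1/2) / (1 + x\<^sup>2) \<partial>lborel)"

lemma decay_integrable: "integrable lborel (\<lambda>x::real. \<bar>x\<bar> powr (1/2) / (1 + x\<^sup>2))"
proof -
  define f where "f x = \<bar>x\<bar> powr (1/2) / (1 + x\<^sup>2)" for x :: real
  have [measurable]: "f \<in> borel_measurable borel" unfolding f_def[abs_def] by measurable
  have f0: "f x \<ge> 0" for x by (simp add: f_def)
  have "f integrable_on {0..1}"
  proof (rule borel_measurable_dominated_integrable[of _ "\<lambda>_. 1"])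
    fix x :: real assume x: "x \<in> {0..1}"
    have "\<bar>x\<bar> powr (1/2) \<le> 1 powr (1/2)" using x by (intro powr_mono2) auto
    then have "f x \<le> 1 / 1" unfolding f_def by (intro frac_le) (auto simp: add_pos_nonneg)
    then show "\<bar>f x\<bar> \<le> 1" using f0[of x] by simp
  qed auto
  moreover have "f integrable_on {1..}"
  proof (rule borel_measurable_dominated_integrable[of _ "\<lambda>x. x powr (-3/2)"])
    show "(\<lambda>x::real. x powr (-3/2)) integrable_on {1..}"
      using has_integral_powr_to_inf[of "-3/2" 1] by (auto simp: integrable_on_def)
    fix x :: real assume x: "x \<in> {1..}"
    have "f x \<le> x powr (1/2) / x\<^sup>2" unfolding f_def using x by (intro frac_le) auto
    also have "\<dots> = x powr (1/2) / x powr 2" using x by (simp add: powr_numeral)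
    also have "\<dots> = x powr (-3/2)" by (simp add: powr_diff[symmetric])
    finally show "\<bar>f x\<bar> \<le> x powr (-3/2)" using f0[of x] by simp
  qed auto
  ultimately have "f integrable_on {0..}" by (intro integral_halfline_split(1)[of 0 1]) auto
  then have "f absolutely_integrable_on {0..}" using f0 by (intro nonnegative_absolutely_integrable_1)
  then have 1: "integrable lborel (\<lambda>x. indicator {0..} x * f x)"
    by (intro set_lborel_integral_eq_integral(1)) auto
  then have 2: "integrable lborel (\<lambda>x. indicator {0..} (- x) * f (- x))"
    using lborel_integrable_real_affine[OF 1, of "-1" 0] by simp
  have "integrable lborel (\<lambda>x. indicator {0..} x * f x + indicator {0..} (- x) * f (- x))"
    by (rule Bochner_Integration.integrable_add[OF 1 2])
  then have "integrable lborel f"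
    by (rule Bochner_Integration.integrable_bound) (use f0 in \<open>auto simp: indicator_def f_def\<close>)
  then show ?thesis by (simp add: f_def[abs_def])
qed

text \<open>Merges the two bounds into one integrable profile: the first governs D |v| <= 1, the
  second larger |v|. The constants 16 and 250 add up to less than 500.\<close>

lemma smooth_weight_cos_transform_bound:
  assumes "1 \<le> T" "1 \<le> D" "D \<le> T" "v \<noteq> 0"
  shows "\<bar>integral {0..T + D} (\<lambda>t. smooth_weight T D t * cos (t * v))\<bar> \<le> 500 * T\<^sup>2 / (\<bar>v\<bar> * (1 + (D * v)\<^sup>2))"
proof -
  define w where "w = \<bar>v\<bar>"
  define I where "I = integral {0..T + D} (\<lambda>t. smooth_weight T D t * cos (t * w))"
  have w: "w > 0" using assms by (simp add: w_def)
  have "cos (t * v) = cos (t * w)" for t by (cases "v \<ge> 0") (auto simp: w_def)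
  then have I: "integral {0..T + D} (\<lambda>t. smooth_weight T D t * cos (t * v)) = I" by (simp add: I_def)
  have b: "\<bar>I\<bar> \<le> 16 * T\<^sup>2 / w" "\<bar>I\<bar> \<le> 250 * T\<^sup>2 / (D\<^sup>2 * w ^ 3)"
    unfolding I_def using smooth_weight_cos_transform[OF assms(1-3) w] by auto
  have "\<bar>I\<bar> * w \<le> 16 * T\<^sup>2" using b(1) w by (simp add: field_simps)
  moreover have "\<bar>I\<bar> * w * (D * w)\<^sup>2 \<le> 250 * T\<^sup>2"
  proof -
    have "\<bar>I\<bar> * (D\<^sup>2 * w ^ 3) \<le> 250 * T\<^sup>2" using b(2) w assms(2) by (subst (asm) pos_le_divide_eq) auto
    then show ?thesis by (simp add: power2_eq_square power3_eq_cube mult_ac)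
  qed
  moreover have "0 \<le> T\<^sup>2" by simp
  moreover have "\<bar>I\<bar> * (w * (1 + (D * w)\<^sup>2)) = \<bar>I\<bar> * w + \<bar>I\<bar> * w * (D * w)\<^sup>2" by (simp add: algebra_simps)
  ultimately have "\<bar>I\<bar> * (w * (1 + (D * w)\<^sup>2)) \<le> 500 * T\<^sup>2" by linarith
  then have "\<bar>I\<bar> \<le> 500 * T\<^sup>2 / (w * (1 + (D * w)\<^sup>2))"
    using w by (subst pos_le_divide_eq) (auto simp: add_pos_nonneg)
  then show ?thesis unfolding I by (simp add: w_def power_mult_distrib)
qed

text \<open>After exchanging the integrals, \<open>E\<close> is tested against the cosine transform
  of the weight. The factor |v|^(3/2) outweighs the 1/|v| at 0, and the smoothing makes the product
  integrable at infinity.\<close>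

lemma smooth_weight_remainder:
  assumes E: "integrable lborel E" "\<And>v. v \<noteq> 0 \<Longrightarrow> \<bar>E v\<bar> \<le> K * \<bar>v\<bar> powr (3/2)"
    and T: "1 \<le> T" "1 \<le> D" "D \<le> T"
  shows "(\<lambda>t. smooth_weight T D t * (\<integral>v. E v * cos (t * v) \<partial>lborel)) integrable_on {0..T + D}"
    and "\<bar>integral {0..T + D} (\<lambda>t. smooth_weight T D t * (\<integral>v. E v * cos (t * v) \<partial>lborel))\<bar>
           \<le> 500 * K * decay_const * T\<^sup>2 * D powr (-3/2)"
proof -
  define b where "b = T + D"
  define \<phi> where "\<phi> t = (\<integral>v. E v * cos (t * v) \<partial>lborel)" for t
  define w where "w t = indicator {0..b} t * smooth_weight T D t" for t
  have Em [measurable]: "E \<in> borel_measurable borel" using E(1) by (simp add: borel_measurable_integrable)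
  have swm [measurable]: "smooth_weight T D \<in> borel_measurable borel"
    unfolding smooth_weight_def[abs_def] by measurable
  have wm [measurable]: "w \<in> borel_measurable borel" unfolding w_def[abs_def] by measurable
  have sw_abs: "smooth_weight T D absolutely_integrable_on {0..b}"
  proof (rule nonnegative_absolutely_integrable_1)
    show "smooth_weight T D integrable_on {0..b}"
      using smooth_weight_integrable_cos[of T D 0] T by (simp add: b_def)
    show "0 \<le> smooth_weight T D t" if "t \<in> {0..b}" for t
      using smooth_step_bounds[of D t T] T that by (simp add: smooth_weight_def b_def add_pos_nonneg)
  qed
  have iw: "integrable lborel w"
    unfolding w_def[abs_def] by (rule set_lborel_integral_eq_integral(1)[OF swm sw_abs]) simp
  have iprod: "integrable (lborel \<Otimes>\<^sub>M lborel) (\<lambda>(t, v). w t * E v * cos (t * v))"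
  proof (rule lborel_pair.Fubini_integrable)
    have "integrable lborel (\<lambda>t. \<bar>w t\<bar> * (\<integral>v. \<bar>E v\<bar> \<partial>lborel))" using iw by simp
    then show "integrable lborel (\<lambda>t. \<integral>v. norm (case (t, v) of (t, v) \<Rightarrow> w t * E v * cos (t * v)) \<partial>lborel)"
    proof (rule Bochner_Integration.integrable_bound)
      have "(\<integral>v. \<bar>w t * E v * cos (t * v)\<bar> \<partial>lborel) \<le> \<bar>w t\<bar> * (\<integral>v. \<bar>E v\<bar> \<partial>lborel)" for t
      proof -
        have "(\<integral>v. \<bar>w t * E v * cos (t * v)\<bar> \<partial>lborel) \<le> (\<integral>v. \<bar>w t\<bar> * \<bar>E v\<bar> \<partial>lborel)"
        proof (rule integral_mono)
          show "integrable lborel (\<lambda>v. \<bar>w t * E v * cos (t * v)\<bar>)"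
            using E(1) by (intro integrable_abs integrable_mult_cos) simp
          show "integrable lborel (\<lambda>v. \<bar>w t\<bar> * \<bar>E v\<bar>)" using E(1) by simp
          show "\<bar>w t * E v * cos (t * v)\<bar> \<le> \<bar>w t\<bar> * \<bar>E v\<bar>" for v
            by (auto simp: abs_mult intro!: mult_left_le)
        qed
        then show ?thesis by simp
      qed
      then show "AE t in lborel. norm (\<integral>v. norm (case (t, v) of (t, v) \<Rightarrow> w t * E v * cos (t * v)) \<partial>lborel)
          \<le> norm (\<bar>w t\<bar> * (\<integral>v. \<bar>E v\<bar> \<partial>lborel))"
        by (intro AE_I2) (simp add: abs_of_nonneg)
    qed measurable
    have "integrable lborel (\<lambda>v. w t * E v * cos (t * v))" for t
      using E(1) by (intro integrable_mult_cos) simp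
    then show "AE t in lborel. integrable lborel (\<lambda>v. case (t, v) of (t, v) \<Rightarrow> w t * E v * cos (t * v))" by simp
  qed measurable
  have w\<phi>: "(\<integral>v. w t * E v * cos (t * v) \<partial>lborel) = w t * \<phi> t" for t
    unfolding \<phi>_def by (simp add: mult.assoc)
  have iw\<phi>: "integrable lborel (\<lambda>t. w t * \<phi> t)"
    using lborel_pair.integrable_fst[OF iprod] by (simp only: w\<phi>)
  have "(\<lambda>t. w t * \<phi> t) integrable_on UNIV" "integral UNIV (\<lambda>t. w t * \<phi> t) = (\<integral>t. w t * \<phi> t \<partial>lborel)"
    using integrable_on_lborel[OF iw\<phi>] integral_lborel[OF iw\<phi>] by auto
  moreover have "(\<lambda>t. w t * \<phi> t) = (\<lambda>t. if t \<in> {0..b} then smooth_weight T D t * \<phi> t else 0)"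
    by (auto simp: w_def indicator_def)
  ultimately have "(\<lambda>t. smooth_weight T D t * \<phi> t) integrable_on {0..b}"
    and val: "integral {0..b} (\<lambda>t. smooth_weight T D t * \<phi> t) = (\<integral>t. w t * \<phi> t \<partial>lborel)"
    using integrable_restrict_UNIV[of "{0..b}" "\<lambda>t. smooth_weight T D t * \<phi> t"]
      integral_restrict_UNIV[of "{0..b}" "\<lambda>t. smooth_weight T D t * \<phi> t"] by auto
  then show "(\<lambda>t. smooth_weight T D t * (\<integral>v. E v * cos (t * v) \<partial>lborel)) integrable_on {0..T + D}"
    by (simp add: \<phi>_def b_def)
  define I where "I v = integral {0..b} (\<lambda>t. smooth_weight T D t * cos (t * v))" for v
  have wI: "(\<integral>t. w t * E v * cos (t * v) \<partial>lborel) = E v * I v" for v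
  proof -
    have m: "(\<lambda>t. smooth_weight T D t * cos (t * v)) \<in> borel_measurable borel" by measurable
    have a: "(\<lambda>t. smooth_weight T D t * cos (t * v)) absolutely_integrable_on {0..b}"
    proof (rule borel_measurable_dominated_absolutely_integrable[OF m])
      show "(\<lambda>t. norm (smooth_weight T D t)) integrable_on {0..b}"
        using sw_abs by (simp add: absolutely_integrable_on_def)
    qed (auto simp: abs_mult intro!: mult_left_le)
    have "(\<integral>t. w t * E v * cos (t * v) \<partial>lborel) = (\<integral>t. E v * (indicator {0..b} t * (smooth_weight T D t * cos (t * v))) \<partial>lborel)"
      by (rule Bochner_Integration.integral_cong) (auto simp: w_def)
    also have "\<dots> = E v * I v"
      using set_lborel_integral_eq_integral[OF m a] by (simp add: I_def)
    finally show ?thesis .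
  qed
  have iEI: "integrable lborel (\<lambda>v. E v * I v)"
    using lborel_pair.integrable_snd[OF iprod] by (simp only: wI)
  have swap: "(\<integral>t. w t * \<phi> t \<partial>lborel) = (\<integral>v. E v * I v \<partial>lborel)"
    using lborel_pair.Fubini_integral[OF iprod] by (simp only: w\<phi> wI)
  have K: "K \<ge> 0" using E(2)[of 1] by simp
  define m where "m v = \<bar>D * v\<bar> powr (1/2) / (1 + (D * v)\<^sup>2)" for v
  have im: "integrable lborel m"
    unfolding m_def[abs_def] using lborel_integrable_real_affine[OF decay_integrable, of D 0] T by simp
  have lm: "(\<integral>v. m v \<partial>lborel) = decay_const / D"
    unfolding m_def[abs_def] decay_const_def
    using lborel_integral_real_affine[of D "\<lambda>x. \<bar>x\<bar> powr (1/2) / (1 + x\<^sup>2)" 0] T by simp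
  \<comment> \<open>Writing |v|^(1/2) = D^(-1/2) |D v|^(1/2) yields the factor D^(-1/2); the
    substitution x = D v in the integral yields the remaining 1 / D.\<close>
  define C where "C = 500 * K * T\<^sup>2 * D powr (-1/2)"
  have "\<bar>E v * I v\<bar> \<le> C * m v" if "v \<noteq> 0" for v
  proof -
    have "\<bar>E v * I v\<bar> \<le> (K * \<bar>v\<bar> powr (3/2)) * (500 * T\<^sup>2 / (\<bar>v\<bar> * (1 + (D * v)\<^sup>2)))"
      unfolding abs_mult I_def b_def
      using E(2)[OF that] smooth_weight_cos_transform_bound[OF T that] K by (intro mult_mono) auto
    also have "\<bar>v\<bar> powr (3/2) = \<bar>v\<bar> * \<bar>v\<bar> powr (1/2)"
    proof -
      have "\<bar>v\<bar> powr (3/2) = \<bar>v\<bar> powr (1 + 1/2)" by simp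
      also have "\<dots> = \<bar>v\<bar> * \<bar>v\<bar> powr (1/2)" using that by (subst powr_add) simp
      finally show ?thesis .
    qed
    also have "(K * (\<bar>v\<bar> * \<bar>v\<bar> powr (1/2))) * (500 * T\<^sup>2 / (\<bar>v\<bar> * (1 + (D * v)\<^sup>2)))
        = 500 * K * T\<^sup>2 * (\<bar>v\<bar> powr (1/2) / (1 + (D * v)\<^sup>2))"
      using that by simp
    also have "\<bar>v\<bar> powr (1/2) = D powr (-1/2) * \<bar>D * v\<bar> powr (1/2)"
    proof -
      have "D powr (-1/2) * D powr (1/2) = 1" using T by (simp add: powr_add[symmetric])
      then show ?thesis using T by (simp add: abs_mult powr_mult mult.assoc[symmetric])
    qed
    finally show ?thesis by (simp add: C_def m_def)
  qed
  then have "AE v in lborel. norm (E v * I v) \<le> C * m v"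
    using AE_lborel_singleton[of 0] by auto
  then have "(\<integral>v. norm (E v * I v) \<partial>lborel) \<le> (\<integral>v. C * m v \<partial>lborel)"
    using im iEI by (intro integral_mono_AE) auto
  then have "norm (\<integral>v. E v * I v \<partial>lborel) \<le> (\<integral>v. C * m v \<partial>lborel)"
    using integral_norm_bound[of lborel "\<lambda>v. E v * I v"] by linarith
  also have "\<dots> = C * (decay_const / D)" using lm by simp
  also have "\<dots> = 500 * K * decay_const * T\<^sup>2 * (D powr (-1/2) * D powr (-1))"
  proof -
    have "D powr (-1) = 1 / D" using T by (simp add: powr_minus inverse_eq_divide)
    then show ?thesis by (simp add: C_def)
  qed
  also have "D powr (-1/2) * D powr (-1) = D powr (-3/2)" by (subst powr_add[symmetric]) simp
  finally show "\<bar>integral {0..T + D} (\<lambda>t. smooth_weight T D t * (\<integral>v. E v * cos (t * v) \<partial>lborel))\<bar>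
           \<le> 500 * K * decay_const * T\<^sup>2 * D powr (-3/2)"
    unfolding swap[symmetric] val[symmetric] by (simp add: \<phi>_def b_def)
qed

section \<open>From the smoothed to the sharp mean square\<close>

definition zeta_mean_square :: "real \<Rightarrow> real" where
  "zeta_mean_square T = integral {0..T} (\<lambda>t. (norm (zeta (1/2 + \<i> * of_real t)))\<^sup>2)"

lemma continuous_on_norm_zeta_square:
  "continuous_on A (\<lambda>t::real. (norm (zeta (1/2 + \<i> * of_real t)))\<^sup>2)"
proof -
  have "continuous_on (- {1}) zeta"
    using is_zeta_zeta by (auto simp: is_zeta_def intro: holomorphic_on_imp_continuous_on)
  then have "continuous_on A (\<lambda>t. zeta (1/2 + \<i> * of_real t))"
    by (rule continuous_on_compose2) (auto intro!: continuous_intros simp: complex_eq_iff)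
  then show ?thesis by (intro continuous_intros)
qed

lemma norm_zeta_square_integrable:
  "(\<lambda>t::real. (norm (zeta (1/2 + \<i> * of_real t)))\<^sup>2) integrable_on {a..b}"
  by (intro integrable_continuous_real continuous_on_norm_zeta_square)

text \<open>The step is 1 up to T and lies in [0, 1] afterwards. Positivity is demanded only on the
  transition interval, because the comparison function for the mean square may be negative for small
  t.\<close>

lemma smooth_step_sandwich:
  fixes F :: "real \<Rightarrow> real"
  assumes F: "F \<in> borel_measurable borel" "F integrable_on {0..T + D}" "(\<lambda>t. \<bar>F t\<bar>) integrable_on {0..T + D}"
    and pos: "\<And>t. T \<le> t \<Longrightarrow> t \<le> T + D \<Longrightarrow> F t \<ge> 0" and "0 \<le> T" "0 < D"
  shows "(\<lambda>t. smooth_step T D t * F t) integrable_on {0..T + D}"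
    "integral {0..T} F \<le> integral {0..T + D} (\<lambda>t. smooth_step T D t * F t)"
    "integral {0..T + D} (\<lambda>t. smooth_step T D t * F t) \<le> integral {0..T + D} F"
proof -
  let ?G = "\<lambda>t. smooth_step T D t * F t"
  show G: "?G integrable_on {0..T + D}"
  proof (rule borel_measurable_dominated_integrable[OF _ F(3)])
    show "?G \<in> borel_measurable borel" using F(1) by measurable
    show "\<bar>?G t\<bar> \<le> \<bar>F t\<bar>" if "t \<in> {0..T + D}" for t
      unfolding abs_mult using smooth_step_bounds[of D t T] assms that by (intro mult_left_le_one_le) auto
  qed auto
  have sub: "f integrable_on {0..T}" "f integrable_on {T..T + D}" if "f integrable_on {0..T + D}" for f :: "real \<Rightarrow> real"
    using that assms by (auto intro: integrable_on_subinterval)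
  have spl: "integral {0..T + D} f = integral {0..T} f + integral {T..T + D} f"
    if "f integrable_on {0..T + D}" for f :: "real \<Rightarrow> real"
    using that assms by (intro Henstock_Kurzweil_Integration.integral_combine[symmetric]) auto
  have eq: "integral {0..T} ?G = integral {0..T} F"
    by (rule Henstock_Kurzweil_Integration.integral_cong) (auto simp: smooth_step_def)
  have b: "0 \<le> ?G t" "?G t \<le> F t" if "t \<in> {T..T + D}" for t
    using smooth_step_bounds[of D t T] assms that pos[of t] by (auto intro!: mult_left_le_one_le)
  have "0 \<le> integral {T..T + D} ?G"
    by (rule Henstock_Kurzweil_Integration.integral_nonneg[OF sub(2)[OF G]]) (rule b(1))
  then show "integral {0..T} F \<le> integral {0..T + D} ?G"
    unfolding spl[OF G] eq by simp
  have "integral {T..T + D} ?G \<le> integral {T..T + D} F"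
    by (rule integral_le[OF sub(2)[OF G] sub(2)[OF F(2)]]) (rule b(2))
  then show "integral {0..T + D} ?G \<le> integral {0..T + D} F"
    unfolding spl[OF G] spl[OF F(2)] eq by simp
qed

text \<open>A Cesaro argument: a fixed initial stretch contributes a constant, and beyond it the
  integrand is below c / 2.\<close>

lemma integral_vanishing_smallo:
  fixes e :: "real \<Rightarrow> real"
  assumes int: "\<And>x. e integrable_on {a..x}" and lim: "(e \<longlongrightarrow> 0) at_top"
  shows "(\<lambda>T. integral {a..T} e) \<in> o[at_top](\<lambda>T. T)"
proof (rule landau_o.smallI)
  fix c :: real assume c: "c > 0"
  have "\<forall>\<^sub>F t in at_top. \<bar>e t\<bar> < c / 2"
    using lim c by (auto simp: tendsto_iff dist_norm dest: spec[of _ "c/2"])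
  then obtain b where b: "b \<ge> a" "b \<ge> 0" "\<And>t. t \<ge> b \<Longrightarrow> \<bar>e t\<bar> < c / 2"
    unfolding eventually_at_top_linorder
    by (metis (no_types, opaque_lifting) linorder_le_cases order_trans)
  define B where "B = \<bar>integral {a..b} e\<bar>"
  show "\<forall>\<^sub>F T in at_top. norm (integral {a..T} e) \<le> c * norm T"
    using eventually_ge_at_top[of "max b (2 * B / c)"]
  proof eventually_elim
    case (elim T)
    have T: "T \<ge> b" "T \<ge> 2 * B / c" using elim by auto
    have "integral {a..T} e = integral {a..b} e + integral {b..T} e"
      using b T int by (intro Henstock_Kurzweil_Integration.integral_combine[symmetric]) auto
    moreover have "\<bar>integral {b..T} e\<bar> \<le> c / 2 * (T - b)"
    proof -
      have "e integrable_on {b..T}" by (rule integrable_on_subinterval[OF int[of T]]) (use b in auto)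
      then have "norm (integral {b..T} e) \<le> integral {b..T} (\<lambda>_. c / 2)"
        by (rule integral_norm_bound_integral) (use b(3) in \<open>auto intro: less_imp_le\<close>)
      then show ?thesis using T by (simp add: mult.commute)
    qed
    moreover have "B \<le> c / 2 * T" using T c by (simp add: field_simps)
    moreover have "c / 2 * (T - b) \<le> c / 2 * T" using b c by (intro mult_left_mono) auto
    ultimately have "\<bar>integral {a..T} e\<bar> \<le> c * T" unfolding B_def by linarith
    then show ?case using T b by simp
  qed
qed

lemma smallo_compose_bigo:
  fixes r :: "real \<Rightarrow> real"
  assumes "r \<in> o[at_top](\<lambda>T. T)" "filterlim g at_top at_top" "g \<in> O[at_top](\<lambda>T. T)"
  shows "(\<lambda>T. r (g T)) \<in> o[at_top](\<lambda>T. T)"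
proof -
  have "(\<lambda>T. r (g T)) \<in> o[at_top](\<lambda>T. g T)" by (rule landau_o.small.compose[OF assms(1,2)])
  then show ?thesis using assms(3) by (rule landau_o.small_big_trans)
qed

theorem zeta_mean_square_asymptotics:
  obtains A where "(\<lambda>T. zeta_mean_square T - (T * ln T + A * T)) \<in> o[at_top](\<lambda>T. T)"
proof -
  obtain E K \<alpha> \<beta> where E: "integrable lborel E" "\<And>v. v \<noteq> 0 \<Longrightarrow> \<bar>E v\<bar> \<le> K * \<bar>v\<bar> powr (3/2)"
    and zd: "\<And>t. t \<noteq> 0 \<Longrightarrow> zeta_density t =
        ln (1 + t\<^sup>2) / t\<^sup>2 / 2 + 2 * \<alpha> / (1 + t\<^sup>2) + 4 * \<beta> / (4 + t\<^sup>2) + (\<integral>v. E v * cos (t * v) \<partial>lborel)"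
    by (rule zeta_density_comparison) (rule that; assumption)
  define Z where "Z t = (norm (zeta (1/2 + \<i> * of_real t)))\<^sup>2" for t :: real
  define F where "F t = (1/4 + t\<^sup>2) * (ln (1 + t\<^sup>2) / t\<^sup>2 / 2 + 2 * \<alpha> / (1 + t\<^sup>2) + 4 * \<beta> / (4 + t\<^sup>2))" for t
  define \<phi> where "\<phi> t = (\<integral>v. E v * cos (t * v) \<partial>lborel)" for t
  define N where "N T = integral {0..T} F" for T
  \<comment> \<open>F t is ln t + 2 \<alpha> + 4 \<beta> + o(1), and a primitive of ln t + A + 1 is
    t ln t + A t; this accounts for the -1.\<close>
  define A where "A = 2 * \<alpha> + 4 * \<beta> - 1"
  have Fm [measurable]: "F \<in> borel_measurable borel" unfolding F_def[abs_def] by measurable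
  have Fabs: "(\<lambda>t. \<bar>F t\<bar>) integrable_on {0..x}" and Fint: "F integrable_on {0..x}" for x
  proof -
    have b: "\<bar>F t\<bar> \<le> (1/4 + x\<^sup>2) * (1 + 2 * \<bar>\<alpha>\<bar> + 4 * \<bar>\<beta>\<bar>)" if "t \<in> {0..x}" for t
    proof -
      have "ln (1 + t\<^sup>2) \<le> t\<^sup>2" by (rule ln_add_one_self_le_self) simp
      then have "ln (1 + t\<^sup>2) / t\<^sup>2 \<le> t\<^sup>2 / t\<^sup>2" by (rule divide_right_mono) simp
      also have "\<dots> \<le> 1" by simp
      finally have "ln (1 + t\<^sup>2) / t\<^sup>2 \<le> 1" .
      moreover have "0 \<le> ln (1 + t\<^sup>2) / t\<^sup>2" by simp
      moreover have "\<bar>x / 2\<bar> \<le> 1" if "x \<le> 1" "0 \<le> x" for x :: real using that by simp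
      ultimately have 1: "\<bar>ln (1 + t\<^sup>2) / t\<^sup>2 / 2\<bar> \<le> 1" by blast
      have p: "1 \<le> 1 + t\<^sup>2" "1 \<le> 4 + t\<^sup>2" using zero_le_power2[of t] by linarith+
      have 2: "\<bar>2 * \<alpha> / (1 + t\<^sup>2)\<bar> \<le> 2 * \<bar>\<alpha>\<bar> / 1" "\<bar>4 * \<beta> / (4 + t\<^sup>2)\<bar> \<le> 4 * \<bar>\<beta>\<bar> / 1"
        using divide_left_mono[of 1 "1 + t\<^sup>2" "2 * \<bar>\<alpha>\<bar>"] divide_left_mono[of 1 "4 + t\<^sup>2" "4 * \<bar>\<beta>\<bar>"] p
        by (simp_all add: abs_mult)
      have "\<bar>ln (1 + t\<^sup>2) / t\<^sup>2 / 2 + 2 * \<alpha> / (1 + t\<^sup>2) + 4 * \<beta> / (4 + t\<^sup>2)\<bar> \<le> 1 + 2 * \<bar>\<alpha>\<bar> + 4 * \<bar>\<beta>\<bar>"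
        using 1 2 by linarith
      moreover have "\<bar>1/4 + t\<^sup>2\<bar> \<le> 1/4 + x\<^sup>2" using that by (simp add: power_mono)
      ultimately show ?thesis unfolding F_def abs_mult by (intro mult_mono) auto
    qed
    show "(\<lambda>t. \<bar>F t\<bar>) integrable_on {0..x}"
      by (rule borel_measurable_dominated_integrable[of _ "\<lambda>_. (1/4 + x\<^sup>2) * (1 + 2 * \<bar>\<alpha>\<bar> + 4 * \<bar>\<beta>\<bar>)"]) (use b in auto)
    show "F integrable_on {0..x}"
      by (rule borel_measurable_dominated_integrable[of _ "\<lambda>_. (1/4 + x\<^sup>2) * (1 + 2 * \<bar>\<alpha>\<bar> + 4 * \<bar>\<beta>\<bar>)"]) (use b in auto)
  qed
  have Zc: "continuous_on S Z" for S unfolding Z_def[abs_def] by (rule continuous_on_norm_zeta_square)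
  have Zm: "Z \<in> borel_measurable borel" by (intro borel_measurable_continuous_onI Zc)
  have Zi: "Z integrable_on {a..b}" "(\<lambda>t. \<bar>Z t\<bar>) integrable_on {a..b}" for a b
    by (intro integrable_continuous_real continuous_intros Zc)+
  have M: "zeta_mean_square T = integral {0..T} Z" for T unfolding zeta_mean_square_def Z_def[abs_def] by (rule refl)
  have Zeq: "Z t = F t + (1/4 + t\<^sup>2) * \<phi> t" if "t \<noteq> 0" for t
    unfolding Z_def norm_zeta_square zd[OF that] by (simp add: F_def \<phi>_def distrib_left)
  have Fasym: "((\<lambda>t. F t - (ln t + (A + 1))) \<longlongrightarrow> 0) at_top"
    unfolding F_def A_def by real_asymp
  have "N \<in> {f. (\<lambda>T. f T - (T * ln T + A * T)) \<in> o[at_top](\<lambda>T. T)}"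
  proof -
    define e where "e t = F t - (ln t + (A + 1))" for t
    have ci: "(\<lambda>t. ln t + (A + 1)) integrable_on {1..x}" for x
      by (intro integrable_continuous_real continuous_intros) auto
    have ei: "e integrable_on {1..x}" for x
      unfolding e_def by (intro integrable_diff ci integrable_on_subinterval[OF Fint[of x]]) auto
    have small: "(\<lambda>T. integral {1..T} e) \<in> o[at_top](\<lambda>T. T)"
      by (rule integral_vanishing_smallo[OF ei]) (use Fasym in \<open>simp add: e_def[abs_def]\<close>)
    have "(\<lambda>T. integral {1..T} e + (N 1 - A)) \<in> o[at_top](\<lambda>T. T)"
      by (rule sum_in_smallo(1)[OF small]) real_asymp
    moreover have "\<forall>\<^sub>F T in at_top. integral {1..T} e + (N 1 - A) = N T - (T * ln T + A * T)"
      using eventually_ge_at_top[of 1]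
    proof eventually_elim
      case (elim T)
      have "((\<lambda>t. ln t + (A + 1)) has_integral (T * ln T + A * T) - (1 * ln 1 + A * 1)) {1..T}"
        using elim by (intro fundamental_theorem_of_calculus)
           (auto intro!: derivative_eq_intros simp: has_real_derivative_iff_has_vector_derivative[symmetric])
      then have 1: "integral {1..T} (\<lambda>t. ln t + (A + 1)) = T * ln T + A * T - A" by (simp add: integral_unique)
      have "N T = N 1 + integral {1..T} F"
        unfolding N_def using elim Fint by (intro Henstock_Kurzweil_Integration.integral_combine[symmetric]) auto
      moreover have "integral {1..T} e = integral {1..T} F - integral {1..T} (\<lambda>t. ln t + (A + 1))"
        unfolding e_def by (intro integral_diff ci integrable_on_subinterval[OF Fint[of T]]) auto
      ultimately show ?case using 1 by simp
    qed
    ultimately show ?thesis by (auto dest: landau_o.small.in_cong)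
  qed
  then have Nas: "(\<lambda>T. N T - (T * ln T + A * T)) \<in> o[at_top](\<lambda>T. T)" by simp
  have "\<forall>\<^sub>F t in at_top. F t \<ge> 0"
  proof -
    have "filterlim F at_top at_top"
    proof (rule filterlim_at_top_mono[where f = "\<lambda>t. ln t + (A + 1) - 1"])
      show "filterlim (\<lambda>t. ln t + (A + 1) - 1) at_top at_top" by real_asymp
      have "\<forall>\<^sub>F t in at_top. dist (F t - (ln t + (A + 1))) 0 < 1" using Fasym by (rule tendstoD) simp
      then show "\<forall>\<^sub>F t in at_top. ln t + (A + 1) - 1 \<le> F t" by eventually_elim (auto simp: dist_norm)
    qed
    then show ?thesis by (simp add: filterlim_at_top)
  qed
  then obtain t0 where t0: "t0 \<ge> 1" "\<And>t. t \<ge> t0 \<Longrightarrow> F t \<ge> 0"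
    unfolding eventually_at_top_linorder by (metis linorder_le_cases order_trans)
  define C where "C = 500 * K * decay_const"
  \<comment> \<open>The smoothed integrals of \<open>Z\<close> and \<open>F\<close> differ only by
    the remainder, and each is bracketed by its sharp integrals up to T and up to T + D.\<close>
  have key: "zeta_mean_square T \<le> N (T + D) + C * T\<^sup>2 * D powr (-3/2)"
     "N T - C * T\<^sup>2 * D powr (-3/2) \<le> zeta_mean_square (T + D)"
    if "t0 \<le> T" "1 \<le> D" "D \<le> T" for T D
  proof -
    have T: "1 \<le> T" using that t0 by simp
    note SZ = smooth_step_sandwich[of Z T D, OF Zm Zi]
    note SF = smooth_step_sandwich[of F T D, OF Fm Fint Fabs]
    have sz: "integral {0..T} Z \<le> integral {0..T + D} (\<lambda>t. smooth_step T D t * Z t)"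
      "integral {0..T + D} (\<lambda>t. smooth_step T D t * Z t) \<le> integral {0..T + D} Z"
      using SZ that T by (auto simp: Z_def)
    have sf: "(\<lambda>t. smooth_step T D t * F t) integrable_on {0..T + D}"
      "N T \<le> integral {0..T + D} (\<lambda>t. smooth_step T D t * F t)"
      "integral {0..T + D} (\<lambda>t. smooth_step T D t * F t) \<le> N (T + D)"
      unfolding N_def using SF that T t0 by auto
    note R = smooth_weight_remainder[OF E T that(2,3), folded \<phi>_def C_def]
    have "integral {0..T + D} (\<lambda>t. smooth_step T D t * Z t)
        = integral {0..T + D} (\<lambda>t. smooth_step T D t * F t + smooth_weight T D t * \<phi> t)"
      by (rule integral_spike[of "{0}"]) (auto simp: Zeq smooth_weight_def algebra_simps)
    also have "\<dots> = integral {0..T + D} (\<lambda>t. smooth_step T D t * F t) + integral {0..T + D} (\<lambda>t. smooth_weight T D t * \<phi> t)"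
      by (rule integral_add[OF sf(1) R(1)])
    finally show "zeta_mean_square T \<le> N (T + D) + C * T\<^sup>2 * D powr (-3/2)"
     "N T - C * T\<^sup>2 * D powr (-3/2) \<le> zeta_mean_square (T + D)"
      unfolding M using sz sf(2,3) R(2) by linarith+
  qed
  \<comment> \<open>With D = T^(9/10) the remainder T^2 D^(-3/2) is T^(13/20), and D ln T is o(T) as
    well. Any exponent strictly between 2/3 and 1 would serve.\<close>
  define U where "U T = N (T + T powr (9/10)) + C * T\<^sup>2 * (T powr (9/10)) powr (-3/2)" for T
  \<comment> \<open>The lower estimate is applied at T - D, so that its smoothing interval ends at
    T.\<close>
  define L where "L T = N (T - T powr (9/10)) - C * (T - T powr (9/10))\<^sup>2 * (T powr (9/10)) powr (-3/2)" for T
  define r where "r T = N T - (T * ln T + A * T)" for T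
  have r: "r \<in> o[at_top](\<lambda>T. T)" using Nas by (simp add: r_def[abs_def])
  have Ule: "\<forall>\<^sub>F T in at_top. zeta_mean_square T \<le> U T"
  proof -
    have "\<forall>\<^sub>F T in at_top. 1 \<le> T powr (9/10::real)" "\<forall>\<^sub>F T in at_top. T powr (9/10) \<le> (T::real)" by real_asymp+
    then show ?thesis using eventually_ge_at_top[of t0]
      by eventually_elim (use key(1) in \<open>auto simp: U_def\<close>)
  qed
  have Lle: "\<forall>\<^sub>F T in at_top. L T \<le> zeta_mean_square T"
  proof -
    have "\<forall>\<^sub>F T in at_top. 1 \<le> T powr (9/10::real)" "\<forall>\<^sub>F T in at_top. T powr (9/10) \<le> T - T powr (9/10::real)"
      "\<forall>\<^sub>F T in at_top. t0 \<le> T - T powr (9/10::real)" by real_asymp+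
    then show ?thesis
    proof eventually_elim
      case (elim T)
      then show ?case using key(2)[of "T - T powr (9/10)" "T powr (9/10)"] by (simp add: L_def)
    qed
  qed
  have Ro: "(\<lambda>T. C * T\<^sup>2 * (T powr (9/10)) powr (-3/2)) \<in> o[at_top](\<lambda>T. T)"
    "(\<lambda>T. C * (T - T powr (9/10))\<^sup>2 * (T powr (9/10)) powr (-3/2)) \<in> o[at_top](\<lambda>T. T)"
  proof -
    have "(\<lambda>T::real. T\<^sup>2 * (T powr (9/10)) powr (-3/2)) \<in> o[at_top](\<lambda>T. T)" by real_asymp
    then show "(\<lambda>T. C * T\<^sup>2 * (T powr (9/10)) powr (-3/2)) \<in> o[at_top](\<lambda>T. T)"
      by (cases "C = 0") (auto simp: mult.assoc)
    have "(\<lambda>T::real. (T - T powr (9/10))\<^sup>2 * (T powr (9/10)) powr (-3/2)) \<in> o[at_top](\<lambda>T. T)" by real_asymp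
    then show "(\<lambda>T. C * (T - T powr (9/10))\<^sup>2 * (T powr (9/10)) powr (-3/2)) \<in> o[at_top](\<lambda>T. T)"
      by (cases "C = 0") (auto simp: mult.assoc)
  qed
  define g1 where "g1 T = T + T powr (9/10)" for T :: real
  define g2 where "g2 T = T - T powr (9/10)" for T :: real
  have r1: "(\<lambda>T. r (g1 T)) \<in> o[at_top](\<lambda>T. T)"
    by (rule smallo_compose_bigo[OF r]; unfold g1_def; real_asymp)
  have r2: "(\<lambda>T. r (g2 T)) \<in> o[at_top](\<lambda>T. T)"
    by (rule smallo_compose_bigo[OF r]; unfold g2_def; real_asymp)
  have d1: "(\<lambda>T. g1 T * ln (g1 T) + A * g1 T - (T * ln T + A * T)) \<in> o[at_top](\<lambda>T. T)"
    unfolding g1_def by real_asymp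
  have d2: "(\<lambda>T. g2 T * ln (g2 T) + A * g2 T - (T * ln T + A * T)) \<in> o[at_top](\<lambda>T. T)"
    unfolding g2_def by real_asymp
  have "(\<lambda>T. r (g1 T) + (g1 T * ln (g1 T) + A * g1 T - (T * ln T + A * T)) + C * T\<^sup>2 * (T powr (9/10)) powr (-3/2)) \<in> o[at_top](\<lambda>T. T)"
    by (rule sum_in_smallo(1)[OF sum_in_smallo(1)[OF r1 d1] Ro(1)])
  then have Uo: "(\<lambda>T. U T - (T * ln T + A * T)) \<in> o[at_top](\<lambda>T. T)"
    by (simp add: U_def g1_def r_def algebra_simps)
  have "(\<lambda>T. r (g2 T) + (g2 T * ln (g2 T) + A * g2 T - (T * ln T + A * T)) - C * (T - T powr (9/10))\<^sup>2 * (T powr (9/10)) powr (-3/2)) \<in> o[at_top](\<lambda>T. T)"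
    by (rule sum_in_smallo(2)[OF sum_in_smallo(1)[OF r2 d2] Ro(2)])
  moreover have "(\<lambda>T. r (g2 T) + (g2 T * ln (g2 T) + A * g2 T - (T * ln T + A * T)) - C * (T - T powr (9/10))\<^sup>2 * (T powr (9/10)) powr (-3/2))
     = (\<lambda>T. L T - (T * ln T + A * T))"
    by (rule ext) (simp add: L_def g2_def r_def)
  ultimately have Lo: "(\<lambda>T. L T - (T * ln T + A * T)) \<in> o[at_top](\<lambda>T. T)" by simp
  have "(\<lambda>T. \<bar>U T - (T * ln T + A * T)\<bar> + \<bar>L T - (T * ln T + A * T)\<bar>) \<in> o[at_top](\<lambda>T. T)"
    using Uo Lo by (intro sum_in_smallo) auto
  then have "(\<lambda>T. zeta_mean_square T - (T * ln T + A * T)) \<in> o[at_top](\<lambda>T. T)"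
  proof (rule landau_o.big_small_trans[rotated], intro bigoI[where c = 1])
    show "\<forall>\<^sub>F T in at_top. norm (zeta_mean_square T - (T * ln T + A * T))
       \<le> 1 * norm (\<bar>U T - (T * ln T + A * T)\<bar> + \<bar>L T - (T * ln T + A * T)\<bar>)"
      using Ule Lle by eventually_elim auto
  qed
  then show ?thesis by (rule that)
qed

section \<open>The Laplace transform of the mean square\<close>

lemma has_integral_t_exp:
  "((\<lambda>t::real. exp (- t)) has_integral 1) {0..}" "((\<lambda>t::real. t * exp (- t)) has_integral 1) {0..}"
  "((\<lambda>t::real. t\<^sup>2 * exp (- t)) has_integral 2) {0..}"
proof -
  have s: "((\<lambda>t. t powr (x - 1) * exp (- t)) has_integral Gamma x) {0..}" if "x > 0" for x :: real
    using Gamma_integral_real[OF that] by (simp add: exp_minus divide_inverse)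
  have G: "Gamma (1::real) = 1" "Gamma (2::real) = 1" "Gamma (3::real) = 2"
    using Gamma_fact[of 0, where 'a = real] Gamma_fact[of 1, where 'a = real] Gamma_fact[of 2, where 'a = real] by simp_all
  \<comment> \<open>At t = 0 the value of \<open>0 powr 0\<close> is 0 and not 1; removing this null
    point reconciles the Gamma integrand with e^(-t).\<close>
  show "((\<lambda>t::real. exp (- t)) has_integral 1) {0..}"
    by (rule has_integral_spike[of "{0}", OF _ _ s[of 1, unfolded G]]) auto
  show "((\<lambda>t::real. t * exp (- t)) has_integral 1) {0..}"
    by (rule has_integral_spike[of "{0}", OF _ _ s[of 2, unfolded G]]) auto
  show "((\<lambda>t::real. t\<^sup>2 * exp (- t)) has_integral 2) {0..}"
    by (rule has_integral_spike[of "{0}", OF _ _ s[of 3, unfolded G]]) (auto simp: powr_numeral)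
qed

lemma abs_mult_ln_le: "\<bar>t * ln t\<bar> \<le> 1 + t\<^sup>2" if "t \<ge> 0" for t :: real
proof (cases "t = 0")
  case False
  then have t: "t > 0" using that by simp
  have "ln t \<le> t - 1" by (rule ln_le_minus_one[OF t])
  then have "t * ln t \<le> t * (t - 1)" using t by (intro mult_left_mono) auto
  moreover have "ln (1 / t) \<le> 1 / t - 1" by (rule ln_le_minus_one) (use t in simp)
  then have "t * (- ln t) \<le> t * (1 / t - 1)" using t by (intro mult_left_mono) (auto simp: ln_div)
  then have "- (t * ln t) \<le> 1 - t" using t by (simp add: algebra_simps)
  moreover have "t * (t - 1) = t\<^sup>2 - t" by (simp add: power2_eq_square algebra_simps)
  ultimately show ?thesis unfolding abs_le_iff using t zero_le_power2[of t] by (intro conjI) linarith+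
qed simp

lemma t_ln_t_exp_integrable: "(\<lambda>t::real. t * ln t * exp (- t)) absolutely_integrable_on {0..}"
proof (rule borel_measurable_dominated_absolutely_integrable)
  show "(\<lambda>t::real. t * ln t * exp (- t)) \<in> borel_measurable borel" by measurable
  show "(\<lambda>t::real. exp (- t) + t\<^sup>2 * exp (- t)) integrable_on {0..}"
    using has_integral_t_exp by (intro integrable_add) auto
  fix t :: real assume "t \<in> {0..}"
  then have "\<bar>t * ln t\<bar> * exp (- t) \<le> (1 + t\<^sup>2) * exp (- t)"
    by (intro mult_right_mono abs_mult_ln_le) auto
  then show "norm (t * ln t * exp (- t)) \<le> exp (- t) + t\<^sup>2 * exp (- t)"
    by (simp add: abs_mult distrib_right)
qed auto

text \<open>\<open>\<Gamma>'(2)\<close>, obtained by squeezing \<open>ln t\<close> between the difference quotients of \<open>t\<^sup>h\<close> at \<open>h = 0\<close>.\<close>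

lemma integral_t_ln_t_exp: "integral {0..} (\<lambda>t::real. t * ln t * exp (- t)) = 1 - euler_mascheroni"
proof -
  define I where "I = integral {0..} (\<lambda>t::real. t * ln t * exp (- t))"
  have I: "((\<lambda>t::real. t * ln t * exp (- t)) has_integral I) {0..}"
    unfolding I_def using t_ln_t_exp_integrable by (intro integrable_integral set_lebesgue_integral_eq_integral(1))
  have s: "((\<lambda>t. t powr (x - 1) * exp (- t)) has_integral Gamma x) {0..}" if "x > 0" for x :: real
    using Gamma_integral_real[OF that] by (simp add: exp_minus divide_inverse)
  have G2: "Gamma (2::real) = 1" using Gamma_fact[of 1, where 'a = real] by simp
  \<comment> \<open>From 1 + x <= e^x at x = h ln t, for either sign of h. Dividing by h > 0 bounds
    \<open>I\<close> from above, dividing by h < 0 bounds it from below.\<close>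
  have le: "h * I \<le> Gamma (2 + h) - Gamma 2" if h: "h > -1" for h :: real
  proof (rule has_integral_le[OF has_integral_mult_right[OF I, of h]])
    show "((\<lambda>t. t powr (2 + h - 1) * exp (- t) - t powr (2 - 1) * exp (- t)) has_integral Gamma (2 + h) - Gamma 2) {0..}"
      using h by (intro has_integral_diff s) auto
    fix t :: real assume t: "t \<in> {0..}"
    show "h * (t * ln t * exp (- t)) \<le> t powr (2 + h - 1) * exp (- t) - t powr (2 - 1) * exp (- t)"
    proof (cases "t = 0")
      case False
      then have t0: "t > 0" using t by simp
      have "t powr h = exp (h * ln t)" using t0 by (simp add: powr_def)
      then have "h * ln t \<le> t powr h - 1" using exp_ge_add_one_self[of "h * ln t"] by linarith
      then have "(t * exp (- t)) * (h * ln t) \<le> (t * exp (- t)) * (t powr h - 1)" using t0 by (intro mult_left_mono) auto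
      also have "\<dots> = t powr (2 + h - 1) * exp (- t) - t powr (2 - 1) * exp (- t)"
      proof -
        have "t powr (2 + h - 1) = t powr (1 + h)" by (simp add: algebra_simps)
        also have "\<dots> = t * t powr h" using t0 by (subst powr_add) simp
        finally show ?thesis using t0 by (simp add: algebra_simps)
      qed
      finally show ?thesis by (simp add: mult_ac)
    qed simp
  qed
  have d: "(Gamma has_field_derivative Gamma 2 * Digamma 2) (at (2::real))"
    by (rule has_field_derivative_Gamma) (auto dest: nonpos_Ints_nonpos)
  have "Digamma (2::real) = Digamma 1 + 1 / 1" using Digamma_plus1[of "1::real"] by simp
  then have d2: "Gamma 2 * Digamma 2 = 1 - (euler_mascheroni :: real)" using G2 by (simp add: Digamma_1)
  have lim: "((\<lambda>h. (Gamma (2 + h) - Gamma 2) / h) \<longlongrightarrow> 1 - (euler_mascheroni :: real)) (at 0)"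
    using d unfolding DERIV_def d2 .
  have "I \<le> 1 - euler_mascheroni"
  proof (rule tendsto_lowerbound)
    show "((\<lambda>h. (Gamma (2 + h) - Gamma 2) / h) \<longlongrightarrow> 1 - (euler_mascheroni :: real)) (at_right 0)"
      using lim by (rule filterlim_mono) (auto simp: at_le)
    show "\<forall>\<^sub>F h in at_right 0. I \<le> (Gamma (2 + h) - Gamma 2) / h"
      using eventually_at_right_less[of 0]
      by eventually_elim (use le in \<open>auto simp: pos_le_divide_eq mult.commute\<close>)
  qed auto
  moreover have "1 - euler_mascheroni \<le> I"
  proof (rule tendsto_upperbound)
    show "((\<lambda>h. (Gamma (2 + h) - Gamma 2) / h) \<longlongrightarrow> 1 - (euler_mascheroni :: real)) (at_left 0)"
      using lim by (rule filterlim_mono) (auto simp: at_le)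
    have "\<forall>\<^sub>F h in at_left 0. h \<in> {-1<..<(0::real)}" by (rule eventually_at_left_real) simp
    then show "\<forall>\<^sub>F h in at_left 0. (Gamma (2 + h) - Gamma 2) / h \<le> I"
      by eventually_elim (use le in \<open>auto simp: neg_divide_le_eq mult.commute\<close>)
  qed auto
  ultimately show ?thesis by (simp add: I_def)
qed

section \<open>The mean square under Abel summation\<close>

lemma zeta_mean_square_mono: "mono zeta_mean_square"
proof (rule monoI)
  fix x y :: real assume "x \<le> y"
  then show "zeta_mean_square x \<le> zeta_mean_square y"
    unfolding zeta_mean_square_def
    by (intro integral_subset_le norm_zeta_square_integrable) auto
qed

lemma zeta_mean_square_nonneg: "zeta_mean_square x \<ge> 0"
  unfolding zeta_mean_square_def
  by (intro Henstock_Kurzweil_Integration.integral_nonneg norm_zeta_square_integrable) auto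

lemma borel_measurable_zeta_mean_square [measurable]: "zeta_mean_square \<in> borel_measurable borel"
  using zeta_mean_square_mono by (rule borel_measurable_mono)

text \<open>The Landau bound holds for large t only. The constant absorbs the bounded range, so that
  the estimate can be integrated against the exponential from 0 on.\<close>

lemma zeta_mean_square_linear_remainder:
  assumes A: "(\<lambda>T. zeta_mean_square T - (T * ln T + A * T)) \<in> o[at_top](\<lambda>T. T)" and "\<epsilon> > 0"
  obtains C where "\<And>t. t \<ge> 0 \<Longrightarrow> \<bar>zeta_mean_square t - (t * ln t + A * t)\<bar> \<le> \<epsilon> * t + C"
proof -
  have "\<forall>\<^sub>F T in at_top. norm (zeta_mean_square T - (T * ln T + A * T)) \<le> \<epsilon> * norm T"
    using landau_o.smallD[OF A \<open>\<epsilon> > 0\<close>] .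
  then obtain b where b: "b \<ge> 0" "\<And>t. t \<ge> b \<Longrightarrow> \<bar>zeta_mean_square t - (t * ln t + A * t)\<bar> \<le> \<epsilon> * \<bar>t\<bar>"
    unfolding eventually_at_top_linorder real_norm_def by (metis linorder_le_cases order_trans)
  define C where "C = zeta_mean_square b + (1 + b\<^sup>2) + \<bar>A\<bar> * b"
  show ?thesis
  proof (rule that[of C])
    fix t :: real assume t: "t \<ge> 0"
    show "\<bar>zeta_mean_square t - (t * ln t + A * t)\<bar> \<le> \<epsilon> * t + C"
    proof (cases "t \<ge> b")
      case True
      moreover have "C \<ge> 0" unfolding C_def using zeta_mean_square_nonneg[of b] b by simp
      ultimately show ?thesis using b(2)[of t] t by simp
    next
      case False
      have "zeta_mean_square t \<le> zeta_mean_square b" using False monoD[OF zeta_mean_square_mono] by simp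
      moreover have "\<bar>t * ln t\<bar> \<le> 1 + t\<^sup>2" by (rule abs_mult_ln_le[OF t])
      moreover have "t\<^sup>2 \<le> b\<^sup>2" using False t by (intro power_mono) auto
      moreover have "\<bar>A * t\<bar> \<le> \<bar>A\<bar> * b" unfolding abs_mult using False t by (intro mult_left_mono) auto
      moreover have "0 \<le> \<epsilon> * t" using t \<open>\<epsilon> > 0\<close> by simp
      ultimately show ?thesis unfolding C_def using zeta_mean_square_nonneg[of t] by linarith
    qed
  qed
qed

text \<open>The Laplace transform of the squared modulus at 1/y, already integrated by parts: in
  this form it depends on the mean square alone, whose growth is known.\<close>

definition zeta_laplace :: "real \<Rightarrow> real" where
  "zeta_laplace y = integral {0..} (\<lambda>t. zeta_mean_square t * exp (- (t / y)) / y)"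

lemma laplace_polynomial:
  fixes a c y :: real
  assumes "y > 0"
  shows "((\<lambda>t. (a * t + c) * exp (- (t / y)) / y) has_integral a * y + c) {0..}"
proof -
  have "((\<lambda>u::real. (a * y) * (u * exp (- u)) + c * exp (- u)) has_integral (a * y) * 1 + c * 1) {0..}"
    by (intro has_integral_add has_integral_mult_right has_integral_t_exp)
  moreover have "(\<lambda>u::real. (a * y) * (u * exp (- u)) + c * exp (- u)) absolutely_integrable_on {0..}"
    using has_integral_t_exp
    by (intro set_integral_add set_integrable_mult_right nonnegative_absolutely_integrable_1)
       (auto simp: integrable_on_def)
  moreover have "((a * y) * ((t / y) * exp (- (t / y))) + c * exp (- (t / y))) / y = (a * t + c) * exp (- (t / y)) / y" for t
  proof -
    have "(a * y) * ((t / y) * exp (- (t / y))) = a * t * exp (- (t / y))" using assms by simp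
    then show ?thesis by (simp add: distrib_right)
  qed
  ultimately show ?thesis
    using integral_atLeast_scaled[where c = "1 / y" and a = 0 and F = "\<lambda>u. (a * y) * (u * exp (- u)) + c * exp (- u)"] assms
    by (simp add: has_integral_iff set_lebesgue_integral_eq_integral(1))
qed

text \<open>With t = y u the logarithm splits as ln y + ln u. The first part meets Gamma(2) = 1, the
  second contributes 1 - \<gamma>.\<close>

lemma laplace_t_ln_t:
  fixes y :: real
  assumes "y > 0"
  shows "((\<lambda>t. t * ln t * exp (- (t / y)) / y) has_integral y * ln y + (1 - euler_mascheroni) * y) {0..}"
proof -
  define F where "F u = y * (u * ln u * exp (- u)) + (y * ln y) * (u * exp (- u))" for u
  have a: "(\<lambda>u::real. u * exp (- u)) absolutely_integrable_on {0..}"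
    using has_integral_t_exp by (intro nonnegative_absolutely_integrable_1) (auto simp: integrable_on_def)
  have F: "F absolutely_integrable_on {0..}"
    unfolding F_def by (intro set_integral_add set_integrable_mult_right t_ln_t_exp_integrable a)
  have "((\<lambda>u::real. u * ln u * exp (- u)) has_integral 1 - euler_mascheroni) {0..}"
    using t_ln_t_exp_integrable integral_t_ln_t_exp by (simp add: has_integral_iff set_lebesgue_integral_eq_integral(1))
  then have "(F has_integral y * (1 - euler_mascheroni) + (y * ln y) * 1) {0..}"
    unfolding F_def by (intro has_integral_add has_integral_mult_right has_integral_t_exp)
  then have "integral {0..} F = y * ln y + (1 - euler_mascheroni) * y" by (simp add: integral_unique)
  moreover have "((\<lambda>t. F (t / y) / y) has_integral integral {0..} F) {0..}"
    using integral_atLeast_scaled[where c = "1 / y" and a = 0 and F = F] F assms by (simp add: has_integral_iff set_lebesgue_integral_eq_integral(1))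
  ultimately have *: "((\<lambda>t. F (t / y) / y) has_integral y * ln y + (1 - euler_mascheroni) * y) {0..}" by simp
  have "F (t / y) / y = t * ln t * exp (- (t / y)) / y" if "t \<in> {0..}" for t
  proof (cases "t = 0")
    case False
    then have "t > 0" using that by simp
    then have lt: "ln t = ln (t / y) + ln y" using assms by (simp add: ln_div)
    have "F (t / y) / y = (t / y) * (ln (t / y) + ln y) * exp (- (t / y))"
      using assms by (simp add: F_def distrib_left distrib_right add_divide_distrib)
    then show ?thesis unfolding lt[symmetric] by simp
  qed (simp add: F_def)
  from has_integral_eq[OF this *] show ?thesis .
qed

lemma zeta_laplace_asymptotics_aux:
  assumes C: "\<And>t. t \<ge> 0 \<Longrightarrow> \<bar>zeta_mean_square t - (t * ln t + A * t)\<bar> \<le> \<epsilon> * t + C" and y: "y > 0"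
  shows "(\<lambda>t. zeta_mean_square t * exp (- (t / y)) / y) integrable_on {0..}"
    "\<bar>zeta_laplace y - (y * ln y + (1 - euler_mascheroni + A) * y)\<bar> \<le> \<epsilon> * y + C"
proof -
  define r where "r t = (zeta_mean_square t - (t * ln t + A * t)) * exp (- (t / y)) / y" for t
  have rm: "r \<in> borel_measurable borel" unfolding r_def[abs_def] by measurable
  have rb: "\<bar>r t\<bar> \<le> (\<epsilon> * t + C) * exp (- (t / y)) / y" if "t \<in> {0..}" for t
  proof -
    have "\<bar>r t\<bar> = \<bar>zeta_mean_square t - (t * ln t + A * t)\<bar> * exp (- (t / y)) / y"
      using y by (simp add: r_def abs_mult)
    also have "\<dots> \<le> (\<epsilon> * t + C) * exp (- (t / y)) / y"
      using y C that by (intro divide_right_mono mult_right_mono) auto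
    finally show ?thesis .
  qed
  have ri: "r integrable_on {0..}"
    by (rule borel_measurable_dominated_integrable[OF rm _ rb]) (use laplace_polynomial[OF y] in \<open>auto simp: integrable_on_def\<close>)
  have ir: "\<bar>integral {0..} r\<bar> \<le> \<epsilon> * y + C"
    using integral_norm_bound_integral[OF ri, of "\<lambda>t. (\<epsilon> * t + C) * exp (- (t / y)) / y"] rb laplace_polynomial[OF y, of \<epsilon> C]
    by (auto simp: has_integral_iff)
  have main: "((\<lambda>t. t * ln t * exp (- (t / y)) / y + (A * t + 0) * exp (- (t / y)) / y + r t) has_integral
      (y * ln y + (1 - euler_mascheroni) * y) + (A * y + 0) + integral {0..} r) {0..}"
    by (intro has_integral_add laplace_t_ln_t[OF y] laplace_polynomial[OF y] integrable_integral ri)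
  have eq: "t * ln t * exp (- (t / y)) / y + (A * t + 0) * exp (- (t / y)) / y + r t = zeta_mean_square t * exp (- (t / y)) / y" for t
    by (simp add: r_def algebra_simps add_divide_distrib diff_divide_distrib)
  show "(\<lambda>t. zeta_mean_square t * exp (- (t / y)) / y) integrable_on {0..}"
    using main unfolding eq by (auto simp: integrable_on_def)
  have "zeta_laplace y = (y * ln y + (1 - euler_mascheroni) * y) + (A * y + 0) + integral {0..} r"
    unfolding zeta_laplace_def using main unfolding eq by (rule integral_unique)
  then have "zeta_laplace y - (y * ln y + (1 - euler_mascheroni + A) * y) = integral {0..} r" by (simp add: algebra_simps)
  then show "\<bar>zeta_laplace y - (y * ln y + (1 - euler_mascheroni + A) * y)\<bar> \<le> \<epsilon> * y + C" using ir by simp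
qed

lemma zeta_laplace_integrable:
  assumes "y > 0"
  shows "(\<lambda>t. zeta_mean_square t * exp (- (t / y)) / y) integrable_on {0..}"
proof -
  obtain A where A: "(\<lambda>T. zeta_mean_square T - (T * ln T + A * T)) \<in> o[at_top](\<lambda>T. T)"
    by (rule zeta_mean_square_asymptotics)
  show ?thesis
  proof (rule zeta_mean_square_linear_remainder[OF A, of 1])
    fix C assume "\<And>t. t \<ge> 0 \<Longrightarrow> \<bar>zeta_mean_square t - (t * ln t + A * t)\<bar> \<le> 1 * t + C"
    then show ?thesis using assms by (rule zeta_laplace_asymptotics_aux(1))
  qed simp
qed

text \<open>An Abelian argument: the linear error (c/2) t transforms into (c/2) y, and the constant
  C stays a constant, which is below (c/2) y for large y.\<close>

lemma zeta_laplace_asymptotics: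
  assumes A: "(\<lambda>T. zeta_mean_square T - (T * ln T + A * T)) \<in> o[at_top](\<lambda>T. T)"
  shows "(\<lambda>y. zeta_laplace y - (y * ln y + (1 - euler_mascheroni + A) * y)) \<in> o[at_top](\<lambda>y. y)"
proof (rule landau_o.smallI)
  fix c :: real assume c: "c > 0"
  then obtain C where C: "\<And>t. t \<ge> 0 \<Longrightarrow> \<bar>zeta_mean_square t - (t * ln t + A * t)\<bar> \<le> (c / 2) * t + C"
    using zeta_mean_square_linear_remainder[OF A, of "c / 2"] by auto
  show "\<forall>\<^sub>F y in at_top. norm (zeta_laplace y - (y * ln y + (1 - euler_mascheroni + A) * y)) \<le> c * norm y"
    using eventually_gt_at_top[of "max 0 (2 * C / c)"]
  proof eventually_elim
    case (elim y)
    then have y: "y > 0" "C \<le> c / 2 * y" using c by (auto simp: field_simps)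
    then show ?case using zeta_laplace_asymptotics_aux(2)[of A "c/2" C, OF C y(1)] by simp
  qed
qed

lemma nonneg_integrable_halfline_mono:
  fixes f :: "real \<Rightarrow> real"
  assumes f: "f integrable_on {a..}" "\<And>t. t \<ge> a \<Longrightarrow> f t \<ge> 0" and "a \<le> b"
  shows "f integrable_on {b..}"
proof -
  have "f absolutely_integrable_on {a..}" using f by (intro nonnegative_absolutely_integrable_1) auto
  then have "f absolutely_integrable_on {b..}" by (rule set_integrable_subset) (use assms in auto)
  then show ?thesis by (rule set_lebesgue_integral_eq_integral(1))
qed

text \<open>Integration by parts on [0, X] leaves the boundary term M(X) e^(-X/y), M being the mean
  square. As M is increasing, this term lies between 0 and the tail of \<open>zeta_laplace\<close>
  beyond X, so the difference is at most that tail.\<close>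

lemma zeta_laplace_tail:
  assumes y: "y > 0" and X: "X \<ge> 0"
  shows "\<bar>integral {0..X} (\<lambda>t. (norm (zeta (1/2 + \<i> * of_real t)))\<^sup>2 * exp (- (t / y))) - zeta_laplace y\<bar>
           \<le> 2 * exp (- (X / (2 * y))) * zeta_laplace (2 * y)"
proof -
  define Z where "Z t = (norm (zeta (1/2 + \<i> * of_real t)))\<^sup>2" for t :: real
  define G where "G t = zeta_mean_square t * exp (- (t / y)) / y" for t
  have Zc: "continuous_on S Z" for S unfolding Z_def by (rule continuous_on_norm_zeta_square)
  have M: "zeta_mean_square = (\<lambda>x. integral {0..x} Z)" by (simp add: zeta_mean_square_def[abs_def] Z_def[abs_def])
  have Mder: "(zeta_mean_square has_vector_derivative Z t) (at t within {0..X})" if "t \<in> {0..X}" for t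
    unfolding M using Zc that by (rule integral_has_vector_derivative)
  have Gi: "G integrable_on {0..}" unfolding G_def by (rule zeta_laplace_integrable[OF y])
  have G0: "G t \<ge> 0" for t using y zeta_mean_square_nonneg by (simp add: G_def)
  have Gi2: "G integrable_on {0..X}" "G integrable_on {X..}"
  proof -
    show "G integrable_on {0..X}" by (rule integrable_on_subinterval[OF Gi]) auto
    show "G integrable_on {X..}" by (rule nonneg_integrable_halfline_mono[OF Gi]) (use G0 X in auto)
  qed
  have Zi: "(\<lambda>t. Z t * exp (- (t / y))) integrable_on {0..X}"
    using y by (intro integrable_continuous_real continuous_intros Zc) auto
  have ftc: "((\<lambda>t. Z t * exp (- (t / y)) - G t) has_integral
      zeta_mean_square X * exp (- (X / y)) - zeta_mean_square 0 * exp (- (0 / y))) {0..X}"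
  proof (rule fundamental_theorem_of_calculus[OF X])
    fix t assume t: "t \<in> {0..X}"
    have "((\<lambda>t. exp (- (t / y))) has_real_derivative exp (- (t / y)) * (- (1 / y))) (at t within {0..X})"
      using y by (auto intro!: derivative_eq_intros)
    then have e: "((\<lambda>t. exp (- (t / y))) has_vector_derivative exp (- (t / y)) * (- (1 / y))) (at t within {0..X})"
      by (simp add: has_real_derivative_iff_has_vector_derivative)
    show "((\<lambda>t. zeta_mean_square t * exp (- (t / y))) has_vector_derivative Z t * exp (- (t / y)) - G t) (at t within {0..X})"
      using has_vector_derivative_mult[OF Mder[OF t] e] by (simp add: G_def algebra_simps)
  qed
  have M0: "zeta_mean_square 0 = 0" by (simp add: zeta_mean_square_def)
  have "((\<lambda>t. Z t * exp (- (t / y)) - G t) has_integral integral {0..X} (\<lambda>t. Z t * exp (- (t / y))) - integral {0..X} G) {0..X}"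
    by (intro has_integral_diff integrable_integral Zi Gi2)
  from has_integral_unique[OF this ftc]
  have 1: "integral {0..X} (\<lambda>t. Z t * exp (- (t / y))) = integral {0..X} G + zeta_mean_square X * exp (- (X / y))"
    by (simp add: M0)
  note split = integral_halfline_split(2)[OF X]
  have 2: "zeta_laplace y = integral {0..X} G + integral {X..} G"
  proof -
    have "zeta_laplace y = integral {0..} G" by (simp add: zeta_laplace_def G_def[abs_def])
    then show ?thesis by (simp only: split[OF Gi2])
  qed
  define E where "E t = exp (- (t / y)) / y" for t
  have E1: "(E has_integral 1) {0..}"
    using laplace_polynomial[OF y, of 0 1] by (simp add: E_def[abs_def])
  then have Ei: "E integrable_on {0..}" by (rule has_integral_integrable)
  have Ei2: "E integrable_on {X..}" "E integrable_on {0..X}"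
  proof -
    show "E integrable_on {0..X}" by (rule integrable_on_subinterval[OF Ei]) auto
    show "E integrable_on {X..}" by (rule nonneg_integrable_halfline_mono[OF Ei]) (use y X in \<open>auto simp: E_def\<close>)
  qed
  have iE: "integral {X..} E = exp (- (X / y))"
  proof -
    have "integral {0..} E = 1" using E1 by (rule integral_unique)
    moreover have "integral {0..} E = integral {0..X} E + integral {X..} E"
      by (rule split[OF Ei2(2,1)])
    moreover have "(E has_integral - exp (- (X / y)) - - exp (- (0 / y))) {0..X}"
    proof (rule fundamental_theorem_of_calculus[OF X])
      fix t assume "t \<in> {0..X}"
      show "((\<lambda>t. - exp (- (t / y))) has_vector_derivative E t) (at t within {0..X})"
        unfolding has_real_derivative_iff_has_vector_derivative[symmetric] E_def
        using y by (auto intro!: derivative_eq_intros)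
    qed
    then have "integral {0..X} E = 1 - exp (- (X / y))" by (simp add: integral_unique)
    ultimately show ?thesis by linarith
  qed
  have low: "zeta_mean_square X * exp (- (X / y)) \<le> integral {X..} G"
  proof -
    have "zeta_mean_square X * integral {X..} E = integral {X..} (\<lambda>t. zeta_mean_square X * E t)" by simp
    also have "\<dots> \<le> integral {X..} G"
    proof (rule integral_le)
      show "(\<lambda>t. zeta_mean_square X * E t) integrable_on {X..}" using Ei2 by (intro integrable_on_mult_right)
      show "zeta_mean_square X * E t \<le> G t" if "t \<in> {X..}" for t
      proof -
        have "zeta_mean_square X * E t \<le> zeta_mean_square t * E t"
          using that y monoD[OF zeta_mean_square_mono] by (intro mult_right_mono) (auto simp: E_def)
        then show ?thesis by (simp add: G_def E_def)
      qed
    qed (rule Gi2)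
    finally show ?thesis by (simp add: iE)
  qed
  \<comment> \<open>Half of the exponent pays for the decay factor at X; the other half keeps the
    tail integrable, as a Laplace integral at 2 y.\<close>
  have up: "integral {X..} G \<le> 2 * exp (- (X / (2 * y))) * zeta_laplace (2 * y)"
  proof -
    define H where "H t = zeta_mean_square t * exp (- (t / (2 * y))) / (2 * y)" for t
    have Hi: "H integrable_on {0..}" unfolding H_def by (rule zeta_laplace_integrable) (use y in simp)
    have H0: "H t \<ge> 0" for t using y zeta_mean_square_nonneg by (simp add: H_def)
    have Hi2: "H integrable_on {X..}" by (rule nonneg_integrable_halfline_mono[OF Hi]) (use H0 X in auto)
    have "integral {X..} G \<le> integral {X..} (\<lambda>t. 2 * exp (- (X / (2 * y))) * H t)"
    proof (rule integral_le[OF Gi2(2)])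
      show "(\<lambda>t. 2 * exp (- (X / (2 * y))) * H t) integrable_on {X..}" using Hi2 by (intro integrable_on_mult_right)
      fix t assume t: "t \<in> {X..}"
      have "exp (- (t / y)) = exp (- (t / (2 * y))) * exp (- (t / (2 * y)))"
        using y by (simp add: exp_add[symmetric])
      also have "\<dots> \<le> exp (- (X / (2 * y))) * exp (- (t / (2 * y)))"
        using t y by (intro mult_right_mono) (auto simp: divide_right_mono)
      finally have "zeta_mean_square t * exp (- (t / y)) / y \<le> zeta_mean_square t * (exp (- (X / (2 * y))) * exp (- (t / (2 * y)))) / y"
        using y zeta_mean_square_nonneg by (intro divide_right_mono mult_left_mono) auto
      then show "G t \<le> 2 * exp (- (X / (2 * y))) * H t" using y by (simp add: G_def H_def mult_ac)
    qed
    also have "\<dots> = 2 * exp (- (X / (2 * y))) * integral {X..} H" by simp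
    also have "\<dots> \<le> 2 * exp (- (X / (2 * y))) * integral {0..} H"
      using X H0 by (intro mult_left_mono integral_subset_le Hi Hi2) auto
    finally show ?thesis by (simp add: zeta_laplace_def H_def[abs_def])
  qed
  have "0 \<le> zeta_mean_square X * exp (- (X / y))" using zeta_mean_square_nonneg by simp
  then have "\<bar>integral {0..X} (\<lambda>t. Z t * exp (- (t / y))) - zeta_laplace y\<bar> \<le> integral {X..} G"
    unfolding 1 2 using low by simp
  then show ?thesis using up by (simp add: Z_def)
qed

section \<open>Jacob's ladder\<close>

text \<open>By the functional equation, moving the unit window from 1 to T changes the integral by
  that of ln over [1, T]. The constant is left as an integral, since it cancels between two
  windows.\<close>

lemma integral_ln_Gamma_unit:
  fixes T :: real
  assumes "T \<ge> 1"
  shows "integral {T..T + 1} (\<lambda>t. ln (Gamma t)) = T * ln T - T + (1 + integral {1..2} (\<lambda>t. ln (Gamma t)))"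
proof -
  let ?g = "\<lambda>t::real. ln (Gamma t)"
  have cont: "continuous_on {1..} ?g"
    by (intro continuous_intros) (auto dest: nonpos_Ints_nonpos simp: Gamma_eq_zero_iff)
  have int: "?g integrable_on {a..b}" if "a \<ge> 1" for a b
    by (intro integrable_continuous_real continuous_on_subset[OF cont]) (use that in auto)
  have "integral {1..T} ?g + integral {T..T + 1} ?g = integral {1..T + 1} ?g"
    using assms by (intro Henstock_Kurzweil_Integration.integral_combine int) auto
  moreover have "integral {1..2} ?g + integral {2..T + 1} ?g = integral {1..T + 1} ?g"
    using assms by (intro Henstock_Kurzweil_Integration.integral_combine int) auto
  moreover have "integral {2..T + 1} ?g = integral {1..T} (\<lambda>t. ?g t + ln t)"
  proof -
    have "integral {2..T + 1} ?g = integral {1 + 1..T + 1} ?g" by simp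
    also have "\<dots> = integral {1..T} (?g \<circ> ((+) 1))" by (rule integral_shift_Icc_real[symmetric])
    also have "\<dots> = integral {1..T} (\<lambda>t. ?g t + ln t)"
    proof (rule Henstock_Kurzweil_Integration.integral_cong)
      fix t :: real assume t: "t \<in> {1..T}"
      have "Gamma (t + 1) = t * Gamma t" by (rule Gamma_plus1) (use t in \<open>auto dest: nonpos_Ints_nonpos\<close>)
      moreover have "Gamma t > 0" by (rule Gamma_real_pos) (use t in simp)
      then have "ln (t * Gamma t) = ln t + ln (Gamma t)"
        by (intro ln_mult_pos) (use t in auto)
      ultimately show "(?g \<circ> ((+) 1)) t = ?g t + ln t" by (simp add: add.commute)
    qed
    finally show ?thesis .
  qed
  moreover have ln_int: "((\<lambda>t. ln t) has_integral (T * ln T - T) - (1 * ln 1 - 1)) {1..T}"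
    using assms by (intro fundamental_theorem_of_calculus)
      (auto intro!: derivative_eq_intros simp: has_real_derivative_iff_has_vector_derivative[symmetric])
  then have "integral {1..T} (\<lambda>t. ?g t + ln t) = integral {1..T} ?g + (T * ln T - T + 1)"
    by (subst integral_add) (auto simp: integral_unique int has_integral_integrable)
  ultimately show ?thesis by simp
qed

text \<open>Since ln is increasing, y / T lies between 1 and the ratio q of the products, whichever
  of y and T is larger. So it is at least as close to 1 as q.\<close>

lemma mult_ln_ratio_imp_ratio:
  fixes y :: "real \<Rightarrow> real"
  assumes lim: "((\<lambda>T. (y T * ln (y T)) / (T * ln T)) \<longlongrightarrow> 1) at_top" and y: "filterlim y at_top at_top"
  shows "((\<lambda>T. y T / T) \<longlongrightarrow> 1) at_top"
proof (rule tendstoI)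
  fix e :: real assume e: "e > 0"
  have "\<forall>\<^sub>F T in at_top. dist ((y T * ln (y T)) / (T * ln T)) 1 < e" using lim e by (rule tendstoD)
  moreover have "\<forall>\<^sub>F T in at_top. y T \<ge> 2" using y by (simp add: filterlim_at_top)
  ultimately show "\<forall>\<^sub>F T in at_top. dist (y T / T) 1 < e" using eventually_ge_at_top[of 2]
  proof eventually_elim
    case (elim T)
    have pos: "T > 0" "ln T > 0" "y T > 0" "ln (y T) > 0" using elim by auto
    define q where "q = (y T * ln (y T)) / (T * ln T)"
    have q: "\<bar>q - 1\<bar> < e" using elim by (simp add: q_def dist_norm)
    have "\<bar>y T / T - 1\<bar> \<le> \<bar>q - 1\<bar>"
    proof (cases "y T \<ge> T")
      case True
      then have "ln T \<le> ln (y T)" using pos by simp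
      then have "y T / T * 1 \<le> y T / T * (ln (y T) / ln T)" using pos by (intro mult_left_mono) auto
      also have "\<dots> = q" by (simp add: q_def)
      finally show ?thesis using True pos by (simp add: abs_if)
    next
      case False
      then have "ln (y T) \<le> ln T" using pos by simp
      then have "y T / T * (ln (y T) / ln T) \<le> y T / T * 1" using pos by (intro mult_left_mono) auto
      moreover have "y T / T * (ln (y T) / ln T) = q" by (simp add: q_def)
      moreover have "y T / T \<le> 1" using False pos by simp
      ultimately show ?thesis by (simp add: abs_if)
    qed
    then show ?case using q by (simp add: dist_norm)
  qed
qed

theorem jacobs_ladder_ln_Gamma_gap:
  assumes \<mu>: "admissible \<mu>" and \<phi>: "ladder_solution \<mu> \<phi>"
  shows "((\<lambda>T. (integral {T..T + 1} (\<lambda>t. ln (Gamma t))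
      - integral {jacobs_ladder \<phi> T..jacobs_ladder \<phi> T + 1} (\<lambda>t. ln (Gamma t))) / T)
      \<longlongrightarrow> 1 - euler_mascheroni) at_top"
proof -
  obtain A where A: "(\<lambda>T. zeta_mean_square T - (T * ln T + A * T)) \<in> o[at_top](\<lambda>T. T)"
    by (rule zeta_mean_square_asymptotics)
  \<comment> \<open>The linear coefficient on the Laplace side; it exceeds the coefficient A of the
    mean square by exactly the limit to be found.\<close>
  define g where "g = 1 - euler_mascheroni + A"
  define y where "y = jacobs_ladder \<phi>"
  define r where "r T = zeta_mean_square T - (T * ln T + A * T)" for T
  define s where "s y = zeta_laplace y - (y * ln y + g * y)" for y
  have r: "r \<in> o[at_top](\<lambda>T. T)" using A by (simp add: r_def[abs_def])
  have s: "s \<in> o[at_top](\<lambda>y. y)" using zeta_laplace_asymptotics[OF A] by (simp add: s_def[abs_def] g_def)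
  from \<mu> obtain y0 where "\<forall>x>y0. \<mu> x \<ge> 7 * x * ln x"
    unfolding admissible_def by (elim exE conjE) (rule that)
  then have y0: "\<mu> x \<ge> 7 * x * ln x" if "x > y0" for x using that by simp
  from \<phi> have \<phi>1: "filterlim \<phi> at_top at_top" and \<phi>2: "\<forall>\<^sub>F T in at_top.
        integral {0..\<mu> (\<phi> T)}
          (\<lambda>t. (norm (zeta (1/2 + \<i> * of_real t)))\<^sup>2 * exp (- (2 / \<phi> T) * t))
        = integral {0..T} (\<lambda>t. (norm (zeta (1/2 + \<i> * of_real t)))\<^sup>2)"
    unfolding ladder_solution_def by auto
  have y\<phi>: "\<phi> T = 2 * y T" for T by (simp add: y_def jacobs_ladder_def)
  have yt: "filterlim y at_top at_top"
    unfolding y_def jacobs_ladder_def[abs_def]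
  proof (rule filterlim_compose[OF _ \<phi>1])
    show "filterlim (\<lambda>x::real. x / 2) at_top at_top" by real_asymp
  qed
  define d where "d T = zeta_mean_square T - zeta_laplace (y T)" for T
  have d: "d \<in> o[at_top](y)"
  proof -
    \<comment> \<open>A crude order y^2 for \<open>zeta_laplace (2 * y)\<close> is enough, as the
      truncation brings the factor (2 y)^(-7).\<close>
    have "(\<lambda>y. 2 * y * ln (2 * y) + g * (2 * y)) \<in> O[at_top](\<lambda>y. y\<^sup>2)" by real_asymp
    moreover have "(\<lambda>y. s (2 * y)) \<in> O[at_top](\<lambda>y. y\<^sup>2)"
    proof -
      have "(\<lambda>y. s (2 * y)) \<in> o[at_top](\<lambda>y. 2 * y)"
        by (rule landau_o.small.compose[OF s]) real_asymp
      also have "(\<lambda>y::real. 2 * y) \<in> O[at_top](\<lambda>y. y\<^sup>2)" by real_asymp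
      finally show ?thesis by (rule landau_o.small_imp_big)
    qed
    ultimately have "(\<lambda>y. s (2 * y) + (2 * y * ln (2 * y) + g * (2 * y))) \<in> O[at_top](\<lambda>y. y\<^sup>2)"
      by (rule sum_in_bigo(1)[rotated])
    then have L2: "(\<lambda>y. zeta_laplace (2 * y)) \<in> O[at_top](\<lambda>y. y\<^sup>2)" by (simp add: s_def)
    have "(\<lambda>y. 2 * (2 * y) powr (-7) * zeta_laplace (2 * y)) \<in> o[at_top](\<lambda>y. y)"
    proof -
      have "(\<lambda>y. 2 * (2 * y) powr (-7) * zeta_laplace (2 * y)) \<in> O[at_top](\<lambda>y. 2 * (2 * y) powr (-7) * y\<^sup>2)"
        by (rule landau_o.big.mult_left[OF L2])
      also have "(\<lambda>y::real. 2 * (2 * y) powr (-7) * y\<^sup>2) \<in> o[at_top](\<lambda>y. y)" by real_asymp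
      finally show ?thesis .
    qed
    from landau_o.small.compose[OF this yt]
    have 1: "(\<lambda>T. 2 * (2 * y T) powr (-7) * zeta_laplace (2 * y T)) \<in> o[at_top](y)" by simp
    have "d \<in> O[at_top](\<lambda>T. 2 * (2 * y T) powr (-7) * zeta_laplace (2 * y T))"
    proof (rule bigoI[of _ 1])
      have "\<forall>\<^sub>F T in at_top. y T > max (y0 / 2) 1" using yt unfolding filterlim_at_top_dense by (rule spec)
      then show "\<forall>\<^sub>F T in at_top. norm (d T) \<le> 1 * norm (2 * (2 * y T) powr (-7) * zeta_laplace (2 * y T))"
        using \<phi>2
      proof eventually_elim
        case (elim T)
        then have y1: "y T > 1" "2 * y T > y0" by auto
        define X where "X = \<mu> (\<phi> T)"
        \<comment> \<open>The lower bound on \<mu> is applied at \<open>\<phi> T\<close>, which is 2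
          y, so the factor 7 becomes 14. Divided by 2 y it makes the exponent at least 7 ln (2
          y).\<close>
        have X: "X \<ge> 14 * y T * ln (2 * y T)" using y0[OF y1(2)] by (simp add: X_def y\<phi>)
        have "14 * y T * ln (2 * y T) \<ge> 0" using y1 by simp
        then have X0: "X \<ge> 0" using X by linarith
        have L0: "zeta_laplace (2 * y T) \<ge> 0"
          unfolding zeta_laplace_def using y1 zeta_mean_square_nonneg
          by (intro Henstock_Kurzweil_Integration.integral_nonneg zeta_laplace_integrable) auto
        have "zeta_mean_square T = integral {0..X} (\<lambda>t. (norm (zeta (1/2 + \<i> * of_real t)))\<^sup>2 * exp (- (t / y T)))"
          unfolding zeta_mean_square_def X_def elim(2)[symmetric] y\<phi> by simp
        then have "\<bar>d T\<bar> \<le> 2 * exp (- (X / (2 * y T))) * zeta_laplace (2 * y T)"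
          unfolding d_def using zeta_laplace_tail[of "y T" X] y1 X0 by simp
        also have "exp (- (X / (2 * y T))) \<le> (2 * y T) powr (-7)"
        proof -
          have "7 * ln (2 * y T) \<le> X / (2 * y T)" using X y1 by (simp add: pos_le_divide_eq mult_ac)
          then have "exp (- (X / (2 * y T))) \<le> exp (- 7 * ln (2 * y T))" by simp
          also have "\<dots> = (2 * y T) powr (-7)" using y1 by (simp add: powr_def)
          finally show ?thesis .
        qed
        then have "2 * exp (- (X / (2 * y T))) * zeta_laplace (2 * y T) \<le> 2 * (2 * y T) powr (-7) * zeta_laplace (2 * y T)"
          using L0 by (intro mult_right_mono mult_left_mono) auto
        finally show ?case using L0 by (simp add: abs_mult)
      qed
    qed
    then show ?thesis using 1 by (rule landau_o.big_small_trans)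
  qed
  have sy: "(\<lambda>T. s (y T)) \<in> o[at_top](y)" using landau_o.small.compose[OF s yt] by simp
  define u where "u T = s (y T) + d T" for T
  have u: "u \<in> o[at_top](y)" unfolding u_def[abs_def] by (rule sum_in_smallo(1)[OF sy d])
  have eqn: "T * ln T + A * T + r T = y T * ln (y T) + g * y T + u T" for T
    by (simp add: r_def s_def u_def d_def)
  have rT: "((\<lambda>T. r T / T) \<longlongrightarrow> 0) at_top" using r by (rule smalloD_tendsto)
  have uy: "((\<lambda>T. u T / y T) \<longlongrightarrow> 0) at_top" using u by (rule smalloD_tendsto)
  have lny: "filterlim (\<lambda>T. ln (y T)) at_top at_top" by (rule filterlim_compose[OF ln_at_top yt])
  have ratio: "((\<lambda>T. (y T * ln (y T)) / (T * ln T)) \<longlongrightarrow> 1) at_top"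
  proof -
    \<comment> \<open>\<open>a\<close> and \<open>b\<close> are the two sides of the equation
      divided by their leading terms. Both tend to 1, hence so does the ratio of the leading
      terms.\<close>
    define a where "a T = 1 + (A + r T / T) / ln T" for T
    define b where "b T = 1 + (g + u T / y T) / ln (y T)" for T
    have "((\<lambda>T. 1 + (A + r T / T) / ln T) \<longlongrightarrow> 1 + 0) at_top"
      by (intro tendsto_add tendsto_const tendsto_divide_0[OF tendsto_add[OF tendsto_const rT]]
          filterlim_at_top_imp_at_infinity ln_at_top)
    then have a: "(a \<longlongrightarrow> 1) at_top" by (simp add: a_def[abs_def])
    have "((\<lambda>T. 1 + (g + u T / y T) / ln (y T)) \<longlongrightarrow> 1 + 0) at_top"
      by (intro tendsto_add tendsto_const tendsto_divide_0[OF tendsto_add[OF tendsto_const uy]]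
          filterlim_at_top_imp_at_infinity lny)
    then have b: "(b \<longlongrightarrow> 1) at_top" by (simp add: b_def[abs_def])
    have "((\<lambda>T. a T / b T) \<longlongrightarrow> 1 / 1) at_top" by (intro tendsto_divide a b) simp
    moreover have "\<forall>\<^sub>F T in at_top. a T / b T = (y T * ln (y T)) / (T * ln T)"
    proof -
      have "\<forall>\<^sub>F T in at_top. b T > 1/2" using b by (rule order_tendstoD) simp
      moreover have "\<forall>\<^sub>F T in at_top. y T \<ge> 2" using yt by (simp add: filterlim_at_top)
      ultimately show ?thesis using eventually_ge_at_top[of 2]
      proof eventually_elim
        case (elim T)
        have p: "T > 0" "ln T > 0" "y T > 0" "ln (y T) > 0" using elim by auto
        have "(T * ln T) * a T = T * ln T + A * T + r T" using p by (simp add: a_def field_simps)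
        also have "\<dots> = y T * ln (y T) + g * y T + u T" by (rule eqn)
        also have "\<dots> = (y T * ln (y T)) * b T" using p by (simp add: b_def field_simps)
        finally show ?case using p elim(1) by (simp add: frac_eq_eq mult_ac)
      qed
    qed
    ultimately show ?thesis by (auto intro: Lim_transform_eventually)
  qed
  have yT: "((\<lambda>T. y T / T) \<longlongrightarrow> 1) at_top" by (rule mult_ln_ratio_imp_ratio[OF ratio yt])
  \<comment> \<open>The equation solved for (T ln T - T) - (y ln y - y) and divided by T. As y / T
    tends to 1, the limit is (g + 1) - (A + 1), in which A drops out. The error \<open>u\<close> is
    small relative to y, hence the detour through u / y.\<close>
  have "((\<lambda>T. (g + 1) * (y T / T) - (A + 1) + (u T / y T) * (y T / T) - r T / T) \<longlongrightarrow> (g + 1) * 1 - (A + 1) + 0 * 1 - 0) at_top"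
    by (intro tendsto_intros yT uy rT)
  then have "((\<lambda>T. (g + 1) * (y T / T) - (A + 1) + (u T / y T) * (y T / T) - r T / T) \<longlongrightarrow> 1 - euler_mascheroni) at_top"
    by (simp add: g_def)
  moreover have "\<forall>\<^sub>F T in at_top. (g + 1) * (y T / T) - (A + 1) + (u T / y T) * (y T / T) - r T / T
     = (integral {T..T + 1} (\<lambda>t. ln (Gamma t)) - integral {y T..y T + 1} (\<lambda>t. ln (Gamma t))) / T"
  proof -
    have "\<forall>\<^sub>F T in at_top. y T \<ge> 1" using yt by (simp add: filterlim_at_top)
    then show ?thesis using eventually_ge_at_top[of 1]
    proof eventually_elim
      case (elim T)
      have "integral {T..T + 1} (\<lambda>t. ln (Gamma t)) - integral {y T..y T + 1} (\<lambda>t. ln (Gamma t))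
          = (T * ln T - T) - (y T * ln (y T) - y T)"
        using elim by (simp add: integral_ln_Gamma_unit)
      also have "\<dots> = (g + 1) * y T - (A + 1) * T + u T - r T" using eqn[of T] by (simp add: algebra_simps)
      also have "\<dots> / T = (g + 1) * (y T / T) - (A + 1) + (u T / y T) * (y T / T) - r T / T"
        using elim by (simp add: diff_divide_distrib add_divide_distrib)
      finally show ?case by simp
    qed
  qed
  ultimately show ?thesis unfolding y_def[symmetric] by (rule Lim_transform_eventually)
qed

text \<open>Assertion (i) is read as: the limit exists and differs from 1. Existence is established
  for all positive x, y, z, so the equivalence turns on the value alone.\<close>

theorem theorem2:
  fixes \<mu> \<phi> :: "real \<Rightarrow> real"
  assumes "admissible \<mu>" and "ladder_solution \<mu> \<phi>"
  shows "(\<forall>(x::nat) (y::nat) (z::nat) (n::nat). x > 0 \<and> y > 0 \<and> z > 0 \<and> n \<ge> 3 \<longrightarrow>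
            (\<exists>L :: real.
              ((\<lambda>\<tau> :: real.
                  let T = (real x ^ n + real y ^ n) / real z ^ n * (\<tau> / (1 - euler_mascheroni))
                  in 1 / \<tau> * (integral {T..T + 1} (\<lambda>t. ln (Gamma t))
                       - integral {jacobs_ladder \<phi> T..jacobs_ladder \<phi> T + 1}
                           (\<lambda>t. ln (Gamma t))))
               \<longlongrightarrow> L) at_top \<and> L \<noteq> 1))
         \<longleftrightarrow>
         \<not> (\<exists>(x::nat) (y::nat) (z::nat) (n::nat). x > 0 \<and> y > 0 \<and> z > 0 \<and> n \<ge> 3 \<and> x ^ n + y ^ n = z ^ n)"
proof -
  define G where "G T = integral {T..T + 1} (\<lambda>t. ln (Gamma t))
      - integral {jacobs_ladder \<phi> T..jacobs_ladder \<phi> T + 1} (\<lambda>t. ln (Gamma t))" for T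
  define c where "c = 1 - (euler_mascheroni :: real)"
  \<comment> \<open>Euler's constant is below 13/22. Positivity of \<open>c\<close> is what sends T
    to infinity together with \<tau>.\<close>
  have c: "c > 0" using euler_mascheroni_less_13_over_22 by (simp add: c_def)
  have G: "((\<lambda>T. G T / T) \<longlongrightarrow> c) at_top"
    using jacobs_ladder_ln_Gamma_gap[OF assms] by (simp add: G_def c_def)
  have lim: "((\<lambda>\<tau>. let T = k * (\<tau> / c) in 1 / \<tau> * G T) \<longlongrightarrow> k) at_top" if k: "k > 0" for k
  proof -
    have "filterlim (\<lambda>\<tau>. k * (\<tau> / c)) at_top at_top" using k c by real_asymp
    from filterlim_compose[OF G this]
    have "((\<lambda>\<tau>. (k / c) * (G (k * (\<tau> / c)) / (k * (\<tau> / c)))) \<longlongrightarrow> (k / c) * c) at_top"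
      by (intro tendsto_mult tendsto_const)
    moreover have "(k / c) * (G (k * (\<tau> / c)) / (k * (\<tau> / c))) = (let T = k * (\<tau> / c) in 1 / \<tau> * G T)" for \<tau>
      using k c by (simp add: Let_def)
    ultimately show ?thesis using c by simp
  qed
  \<comment> \<open>Uniqueness of limits settles one direction, as any witness \<open>L\<close> must
    be k; k itself is the witness for the other.\<close>
  have iff: "(\<exists>L. ((\<lambda>\<tau>. let T = (real x ^ n + real y ^ n) / real z ^ n * (\<tau> / c) in 1 / \<tau> * G T) \<longlongrightarrow> L) at_top \<and> L \<noteq> 1)
      \<longleftrightarrow> x ^ n + y ^ n \<noteq> z ^ n" if "x > 0" "y > 0" "z > 0" for x y z n :: nat
  proof -
    define k where "k = (real x ^ n + real y ^ n) / real z ^ n"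
    have k: "k > 0" using that by (simp add: k_def add_pos_pos)
    have "(\<exists>L. ((\<lambda>\<tau>. let T = k * (\<tau> / c) in 1 / \<tau> * G T) \<longlongrightarrow> L) at_top \<and> L \<noteq> 1) \<longleftrightarrow> k \<noteq> 1"
    proof
      assume "\<exists>L. ((\<lambda>\<tau>. let T = k * (\<tau> / c) in 1 / \<tau> * G T) \<longlongrightarrow> L) at_top \<and> L \<noteq> 1"
      then obtain L where L: "((\<lambda>\<tau>. let T = k * (\<tau> / c) in 1 / \<tau> * G T) \<longlongrightarrow> L) at_top" "L \<noteq> 1" by (elim exE conjE)
      then show "k \<noteq> 1" using tendsto_unique[OF trivial_limit_at_top_linorder L(1) lim[OF k]] by simp
    next
      assume "k \<noteq> 1"
      with lim[OF k] show "\<exists>L. ((\<lambda>\<tau>. let T = k * (\<tau> / c) in 1 / \<tau> * G T) \<longlongrightarrow> L) at_top \<and> L \<noteq> 1"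
        by (intro exI conjI)
    qed
    also have "k = 1 \<longleftrightarrow> real (x ^ n + y ^ n) = real (z ^ n)" using that by (auto simp: k_def)
    then have "k \<noteq> 1 \<longleftrightarrow> x ^ n + y ^ n \<noteq> z ^ n" by (simp only: of_nat_eq_iff)
    finally show ?thesis by (simp only: k_def)
  qed
  show ?thesis
    unfolding G_def[symmetric] c_def[symmetric]
  proof (intro iffI notI allI impI; (elim exE conjE)?)
    fix x y z n :: nat
    assume L: "\<forall>x y z n. x > 0 \<and> y > 0 \<and> z > 0 \<and> n \<ge> 3 \<longrightarrow>
      (\<exists>L. ((\<lambda>\<tau>. let T = (real x ^ n + real y ^ n) / real z ^ n * (\<tau> / c) in 1 / \<tau> * G T) \<longlongrightarrow> L) at_top \<and> L \<noteq> 1)"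
      and xyzn: "x > 0" "y > 0" "z > 0" "n \<ge> 3" and "x ^ n + y ^ n = z ^ n"
    moreover have "x ^ n + y ^ n \<noteq> z ^ n"
      by (rule iff[OF xyzn(1-3), THEN iffD1], rule L[rule_format], intro conjI xyzn)
    ultimately show False by simp
  next
    fix x y z n :: nat
    assume no: "\<not> (\<exists>(x::nat) (y::nat) (z::nat) (n::nat). x > 0 \<and> y > 0 \<and> z > 0 \<and> n \<ge> 3 \<and> x ^ n + y ^ n = z ^ n)"
      and xyzn: "x > 0" "y > 0" "z > 0" "n \<ge> 3"
    then have "x ^ n + y ^ n \<noteq> z ^ n" by blast
    then show "\<exists>L. ((\<lambda>\<tau>. let T = (real x ^ n + real y ^ n) / real z ^ n * (\<tau> / c) in 1 / \<tau> * G T) \<longlongrightarrow> L) at_top \<and> L \<noteq> 1"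
      by (rule iff[OF xyzn(1-3), THEN iffD2])
  qed
qed

end
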